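(* Let $Y$ be a connected graph with more edges than vertices, and let $B$ be its non-backtracking matrix. Fix $\varepsilon>0$. Let $\mathbf{Y}_n$ be a uniformly random $n$-lift of $Y$, and let $\mathbf{X}_n$ be a uniformly random signing of $\mathbf{Y}_n$. Let $\mathbf{B}_n$ be the non-backtracking matrix of $\mathbf{X}_n$. Then $$\Pr\big[\rho(\mathbf{B}_n)\ge \sqrt{\rho(B)}+\varepsilon\big]=o_{n\to\infty}(1).$$
   Context: An $n$-lift of a graph $Y=(V,E)$ has vertex set $V\times[n]$ and, for each edge $\{u,v\}\in E$, a perfect matching between $\{u\}\times[n]$ and $\{v\}\times[n]$. In a uniformly random $n$-lift these matchings are chosen independently and uniformly. A random signing of a graph labels each edge independently and uniformly with $\pm1$. The non-backtracking matrix of an edge-signed graph is indexed by directed edges: each undirected edge gives two arcs, both carrying the edge's sign. The entries are $B[(i,j),(k,\ell)]$ equal to the sign of $(i,j)$ if $j=k$ and $i\neq\ell$, and $0$ otherwise. For unsigned graphs all signs are $+1$. $\rho(\cdot)$ denotes the spectral radius, i.e. the maximum modulus of a (complex) eigenvalue. *)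

theory Defs
  imports
    "HOL-Probability.Probability"
    "Graph_Theory.Graph_Theory"
    "Jordan_Normal_Form.Spectral_Radius"
begin

text \<open>
  A finite simple undirected graph is a \<^locale>\<open>pair_graph\<close>, i.e. a finite symmetric loop-free
  digraph without parallel arcs; each undirected edge contributes both of its orientations to
  \<open>parcs\<close>.
\<close>

definition uedges :: "'v pair_pre_digraph \<Rightarrow> 'v set set" where
  "uedges G = {{u, v} | u v. (u, v) \<in> parcs G}"

text \<open>
  Rows and columns are indexed by the arcs. Library matrices are indexed by initial segments of the
  naturals, so the arcs are numbered by \<^const>\<open>from_nat_into\<close>; another numbering would only conjugate
  the matrix by a permutation. The sign \<open>s\<close> is given on undirected edges, so both arcs of an edge
  carry the same sign.
\<close>

definition nb_entry :: "('v set \<Rightarrow> int) \<Rightarrow> 'v \<times> 'v \<Rightarrow> 'v \<times> 'v \<Rightarrow> complex" where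
  "nb_entry s a b =
     (case a of (i, j) \<Rightarrow> case b of (k, l) \<Rightarrow>
        if j = k \<and> i \<noteq> l then of_int (s {i, j}) else 0)"

definition nb_matrix :: "'v pair_pre_digraph \<Rightarrow> ('v set \<Rightarrow> int) \<Rightarrow> complex Matrix.mat" where
  "nb_matrix G s =
     Matrix.mat (card (parcs G)) (card (parcs G))
       (\<lambda>(p, q). nb_entry s (from_nat_into (parcs G) p) (from_nat_into (parcs G) q))"

definition perfect_matchings_between :: "'v set \<Rightarrow> 'v set \<Rightarrow> 'v set set set" where
  "perfect_matchings_between A B =
     {M. M \<subseteq> {{a, b} | a b. a \<in> A \<and> b \<in> B} \<and> (\<forall>x\<in>A \<union> B. \<exists>!f. f \<in> M \<and> x \<in> f)}"

text \<open>
  For an undirected edge \<open>e = {u, v}\<close>, the perfect matchings between the fibres of \<open>u\<close> and \<open>v\<close>. The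
  union ranges over the two orientations of \<open>e\<close>, which give the same set of matchings.
\<close>

definition fibre_matchings :: "nat \<Rightarrow> 'v set \<Rightarrow> ('v \<times> nat) set set set" where
  "fibre_matchings n e =
     (\<Union>(u, v)\<in>{(u, v). e = {u, v}}. perfect_matchings_between ({u} \<times> {1..n}) ({v} \<times> {1..n}))"

definition lift_graph ::
  "'v pair_pre_digraph \<Rightarrow> nat \<Rightarrow> ('v set \<Rightarrow> ('v \<times> nat) set set) \<Rightarrow> ('v \<times> nat) pair_pre_digraph" where
  "lift_graph Y n M =
     \<lparr> pverts = pverts Y \<times> {1..n}, parcs = {(x, y). {x, y} \<in> (\<Union>e\<in>uedges Y. M e)} \<rparr>"

definition random_lift :: "'v pair_pre_digraph \<Rightarrow> nat \<Rightarrow> ('v \<times> nat) pair_pre_digraph pmf" where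
  "random_lift Y n =
     map_pmf (lift_graph Y n) (Pi_pmf (uedges Y) {} (\<lambda>e. pmf_of_set (fibre_matchings n e)))"

text \<open>The default value \<open>1\<close> outside the edge set is never looked at.\<close>

definition random_signing :: "'v pair_pre_digraph \<Rightarrow> ('v set \<Rightarrow> int) pmf" where
  "random_signing G = Pi_pmf (uedges G) 1 (\<lambda>_. pmf_of_set {-1, 1})"

definition random_signed_lift ::
  "'v pair_pre_digraph \<Rightarrow> nat \<Rightarrow> (('v \<times> nat) pair_pre_digraph \<times> (('v \<times> nat) set \<Rightarrow> int)) pmf" where
  "random_signed_lift Y n =
     bind_pmf (random_lift Y n) (\<lambda>L. map_pmf (\<lambda>s. (L, s)) (random_signing L))"

text \<open>
  The spectrum does not depend on the numbering: it is that of the operator on functions of arcs.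
\<close>

lemma eigenvalue_nb_matrix_iff:
  assumes "finite (parcs G)"
  shows "eigenvalue (nb_matrix G s) z \<longleftrightarrow>
    (\<exists>f. (\<exists>a\<in>parcs G. f a \<noteq> 0) \<and>
         (\<forall>a\<in>parcs G. (\<Sum>b\<in>parcs G. nb_entry s a b * f b) = z * f a))"
    (is "?L \<longleftrightarrow> ?R")
proof -
  define A where "A = parcs G"
  define N where "N = card A"
  define e where "e = from_nat_into A"
  have bij: "bij_betw e {..<N} A"
    using assms bij_betw_from_nat_into_finite unfolding e_def N_def A_def by blast
  have im: "A = e ` {..<N}" using bij by (simp add: bij_betw_def)
  have B: "nb_matrix G s = Matrix.mat N N (\<lambda>(p, q). nb_entry s (e p) (e q))"
    by (simp add: nb_matrix_def A_def N_def e_def)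
  have mv: "vec_index (nb_matrix G s *\<^sub>v v) p = (\<Sum>b\<in>A. nb_entry s (e p) b * f b)"
    if "p < N" "v \<in> carrier_vec N" "\<And>q. q < N \<Longrightarrow> vec_index v q = f (e q)" for v f p
  proof -
    have "vec_index (nb_matrix G s *\<^sub>v v) p = (\<Sum>q\<in>{..<N}. nb_entry s (e p) (e q) * f (e q))"
      using that by (auto simp: B scalar_prod_def lessThan_atLeast0 intro!: sum.cong)
    also have "\<dots> = (\<Sum>b\<in>A. nb_entry s (e p) b * f b)"
      by (rule sum.reindex_bij_betw[OF bij])
    finally show ?thesis .
  qed
  show ?thesis
  proof
    assume ?L
    then obtain v where v: "v \<in> carrier_vec N" "v \<noteq> 0\<^sub>v N" "nb_matrix G s *\<^sub>v v = z \<cdot>\<^sub>v v"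
      by (auto simp: eigenvalue_def eigenvector_def B)
    define f where "f a = vec_index v (inv_into {..<N} e a)" for a
    have fe: "vec_index v q = f (e q)" if "q < N" for q
      using that bij by (simp add: f_def bij_betw_def)
    obtain p where "p < N" "vec_index v p \<noteq> 0" using v(1,2) by (auto simp: vec_eq_iff)
    then have "\<exists>a\<in>A. f a \<noteq> 0" using fe im by auto
    moreover have "\<forall>a\<in>A. (\<Sum>b\<in>A. nb_entry s a b * f b) = z * f a"
    proof
      fix a assume "a \<in> A"
      then obtain p where p: "p < N" "a = e p" using im by auto
      show "(\<Sum>b\<in>A. nb_entry s a b * f b) = z * f a"
        using mv[OF p(1) v(1) fe] v p fe[OF p(1)] by simp
    qed
    ultimately show ?R unfolding A_def by blast
  next
    assume ?R
    then obtain f where f: "\<exists>a\<in>A. f a \<noteq> 0" "\<forall>a\<in>A. (\<Sum>b\<in>A. nb_entry s a b * f b) = z * f a"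
      unfolding A_def by blast
    define v where "v = Matrix.vec N (\<lambda>p. f (e p))"
    have v: "v \<in> carrier_vec N" "\<And>q. q < N \<Longrightarrow> vec_index v q = f (e q)" by (auto simp: v_def)
    have "v \<noteq> 0\<^sub>v N" using f(1) v(2) im by auto
    moreover have "nb_matrix G s *\<^sub>v v = z \<cdot>\<^sub>v v"
    proof (rule eq_vecI)
      fix p assume "p < dim_vec (z \<cdot>\<^sub>v v)"
      then have p: "p < N" using v(1) by simp
      then show "vec_index (nb_matrix G s *\<^sub>v v) p = vec_index (z \<cdot>\<^sub>v v) p"
        using mv[OF p v] f(2) v im by auto
    qed (use v(1) in \<open>simp add: B\<close>)
    ultimately show ?L using v(1) by (auto simp: eigenvalue_def eigenvector_def B)
  qed
qed

lemma finite_fibre_matchings: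
  assumes "finite e"
  shows "finite (fibre_matchings n e)"
proof -
  have "fibre_matchings n e \<subseteq> Pow (Pow (e \<times> {1..n}))"
    unfolding fibre_matchings_def perfect_matchings_between_def by fastforce
  then show ?thesis using assms by (auto intro: finite_subset)
qed

lemma fibre_matchings_nonempty:
  assumes "u \<noteq> v"
  shows "fibre_matchings n {u, v} \<noteq> {}"
proof -
  have "(\<lambda>i. {(u, i), (v, i)}) ` {1..n}
      \<in> perfect_matchings_between ({u} \<times> {1..n}) ({v} \<times> {1..n})"
    (is "?M \<in> perfect_matchings_between ?A ?B")
  proof -
    have "?M \<subseteq> {{a, b} | a b. a \<in> ?A \<and> b \<in> ?B}" by blast
    moreover have "\<exists>!f. f \<in> ?M \<and> x \<in> f" if "x \<in> ?A \<union> ?B" for x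
      using that assms by auto
    ultimately show ?thesis unfolding perfect_matchings_between_def by blast
  qed
  then show ?thesis unfolding fibre_matchings_def by blast
qed

lemma pair_graph_lift_graph:
  assumes "pair_graph Y" and "\<And>e. e \<in> uedges Y \<Longrightarrow> M e \<in> fibre_matchings n e"
  shows "pair_graph (lift_graph Y n M)"
proof -
  interpret Y: pair_graph Y by fact
  have *: "x \<in> pverts Y \<times> {1..n} \<and> y \<in> pverts Y \<times> {1..n} \<and> x \<noteq> y"
    if "(x, y) \<in> parcs (lift_graph Y n M)" for x y
  proof -
    from that obtain e where e: "e \<in> uedges Y" "{x, y} \<in> M e" by (auto simp: lift_graph_def)
    then obtain u v where uv: "e = {u, v}"
        "M e \<in> perfect_matchings_between ({u} \<times> {1..n}) ({v} \<times> {1..n})"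
      using assms(2)[OF e(1)] by (auto simp: fibre_matchings_def)
    then obtain i j where ij: "{x, y} = {(u, i), (v, j)}" "i \<in> {1..n}" "j \<in> {1..n}"
      using e(2) unfolding perfect_matchings_between_def by blast
    have "(u, v) \<in> parcs Y"
      using e(1) uv(1) Y.arcs_symmetric by (auto simp: uedges_def doubleton_eq_iff)
    then have "u \<in> pverts Y" "v \<in> pverts Y" "u \<noteq> v"
      using Y.in_arcsD1 Y.in_arcsD2 Y.no_loops' by auto
    with ij show ?thesis by (auto simp: doubleton_eq_iff)
  qed
  have sub: "parcs (lift_graph Y n M) \<subseteq> (pverts Y \<times> {1..n}) \<times> (pverts Y \<times> {1..n})"
    using * by auto
  show ?thesis
  proof
    show "finite (pverts (lift_graph Y n M))"
      using Y.pair_finite_verts by (simp add: lift_graph_def)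
    show "finite (parcs (lift_graph Y n M))"
      by (rule finite_subset[OF sub]) (use Y.pair_finite_verts in simp)
    show "symmetric (with_proj (lift_graph Y n M))"
      by (auto simp: symmetric_def lift_graph_def insert_commute intro!: symI)
    show "fst a \<in> pverts (lift_graph Y n M)" "snd a \<in> pverts (lift_graph Y n M)" "fst a \<noteq> snd a"
      if "a \<in> parcs (lift_graph Y n M)" for a
      using *[of "fst a" "snd a"] that by (auto simp: lift_graph_def)
  qed
qed

end

theory Submission
  imports Defs "HOL-Real_Asymp.Real_Asymp"
begin

text \<open>
  If \<open>B\<close> is the signed non-backtracking matrix of a graph, \<open>S\<close> the diagonal matrix of signs and \<open>J\<close> the
  reversal of arcs, then \<open>B\<^bsup>k\<^esup> S J\<close> is symmetric and \<open>S J\<close> is orthogonal, so that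
  \<open>\<rho>(B)\<^bsup>2km\<^esup>\<close> is at most the trace of \<open>(B\<^bsup>k\<^esup> S J)\<^bsup>2m\<^esup>\<close>. Averaging this trace over the signs
  leaves the number of closed hikes (walks of \<open>2m\<close> non-backtracking segments of \<open>k + 1\<close> steps, with a
  reversal between consecutive segments) that use every edge an even number of times. Such a hike has
  at most \<open>m(k+1)\<close> different edges. New edges are explored along walks that project to
  non-backtracking walks of the base graph, which accounts for a factor \<open>R\<^bsup>m(k+1)\<^esup>\<close> with \<open>R\<close> slightly
  above the spectral radius of the base graph. Old edges cost only a factor polynomial in \<open>k\<close> and
  \<open>m\<close> per phase of the hike, provided that subgraphs of size \<open>O(k)\<close> of the lift contain at most one
  cycle per component, and there are \<open>O(m)\<close> phases, provided that subgraphs with \<open>m(k+1)\<close> edges have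
  excess at most \<open>m\<close>. Both provisos hold with high probability by a union bound over edge
  sets, since \<open>j\<close> given edges belong to the random lift with probability about \<open>n\<^bsup>-j\<^esup>\<close>. With \<open>m\<close> about
  \<open>ln n\<close> and \<open>k\<close> about \<open>\<surd>(ln n)\<close>, Markov's inequality gives the theorem.
\<close>

section \<open>Walks in graphs of small excess\<close>

text \<open>The orders of \<open>k\<close> and \<open>m\<close> balance four costs. The
  \<open>O(m)\<close> phases cost \<open>exp(O(m ln(k m)))\<close> and the starting points a factor
  proportional to \<open>n\<close>. Both must be beaten by the gain
  \<open>(R / \<Lambda>^2)^(k m)\<close>, where \<open>\<Lambda>\<close> is the threshold, so
  \<open>k\<close> has to outgrow \<open>ln(k m)\<close> and \<open>k m\<close> has to outgrow
  \<open>ln n\<close>. On the other hand the union bounds cost \<open>k^(O(k)) / n\<close> for a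
  second cycle within \<open>O(k)\<close> edges and \<open>(k m)^(O(k m)) / n^m\<close> for large
  excess, so \<open>k ln(k m)\<close> has to stay below \<open>ln n\<close>.

  The trace of a power of \<open>B\<close> itself may suffer cancellation between complex
  eigenvalues, hence the detour through a symmetric matrix. Its price are the turns, each of which
  may end a phase; long segments keep turns rare.

  Replacing \<open>R^e\<close> for \<open>e\<close> distinct edges by \<open>R^(m(k+1))\<close>
  requires \<open>R\<close> to be at least one. A base graph of spectral radius below one has no
  long non-backtracking walks at all and is treated separately.\<close>

definition nb_step :: "'w \<times> 'w \<Rightarrow> 'w \<times> 'w \<Rightarrow> bool" where
  "nb_step a b \<longleftrightarrow> snd a = fst b \<and> fst a \<noteq> snd b"

definition uedge :: "'w \<times> 'w \<Rightarrow> 'w set" where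
  "uedge a = {fst a, snd a}"

definition nb_walks :: "('w \<times> 'w) set \<Rightarrow> nat \<Rightarrow> ('w \<times> 'w) list set" where
  "nb_walks A k = {p. length p = k \<and> set p \<subseteq> A \<and> successively nb_step p}"

text \<open>An empty list of arcs has no end points of its own, so the start is passed separately:
  the empty walk starts everywhere and ends where it starts. Phases with an empty return or onward
  part rely on this.\<close>

definition starts_at :: "'w \<Rightarrow> ('w \<times> 'w) list \<Rightarrow> bool" where
  "starts_at x p \<longleftrightarrow> p = [] \<or> fst (hd p) = x"

definition end_from :: "'w \<Rightarrow> ('w \<times> 'w) list \<Rightarrow> 'w" where
  "end_from x p = (if p = [] then x else snd (last p))"

text \<open>In a connected graph, edges minus vertices plus one is the number of independent cycles.
  So for \<open>c = 0\<close> a connected subgraph with at most \<open>N\<close> edges has at most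
  one cycle. Quantifying over arbitrary edge sets, connected or not, suits a union bound.\<close>

definition excess_le :: "('w \<times> 'w) set \<Rightarrow> nat \<Rightarrow> nat \<Rightarrow> bool" where
  "excess_le A N c \<longleftrightarrow> (\<forall>F \<subseteq> uedge ` A. card F \<le> N \<longrightarrow> card F \<le> card (\<Union>F) + c)"

lemma uedge_swap [simp]: "uedge (prod.swap a) = uedge a"
  by (auto simp: uedge_def)

lemma uedge_eq_iff: "uedge a = uedge b \<longleftrightarrow> a = b \<or> a = prod.swap b"
  by (cases a; cases b) (auto simp: uedge_def doubleton_eq_iff)

lemma finite_nb_walks: "finite A \<Longrightarrow> finite (nb_walks A k)"
  by (rule finite_subset[OF _ finite_lists_length_eq[of A k]]) (auto simp: nb_walks_def)

text \<open>Handshake identity: the incidences of vertices and edges are counted in two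
  ways.\<close>

lemma sum_degrees:
  assumes "finite F" and "\<And>e. e \<in> F \<Longrightarrow> card e = 2"
  shows "(\<Sum>v\<in>\<Union>F. card {e\<in>F. v \<in> e}) = 2 * card F"
proof -
  have fin: "finite e" if "e \<in> F" for e
    using assms(2)[OF that] by (intro card_ge_0_finite) simp
  have finU: "finite (\<Union>F)" using assms(1) fin by blast
  have "(\<Sum>v\<in>\<Union>F. card {e\<in>F. v \<in> e}) = (\<Sum>v\<in>\<Union>F. \<Sum>e\<in>F. if v \<in> e then 1 else 0)"
    using assms(1) by (intro sum.cong) (auto simp: sum.If_cases Int_def)
  also have "\<dots> = (\<Sum>e\<in>F. \<Sum>v\<in>\<Union>F. if v \<in> e then 1 else 0)" by (rule sum.swap)
  also have "\<dots> = (\<Sum>e\<in>F. card e)"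
  proof (rule sum.cong[OF refl])
    fix e assume "e \<in> F"
    then have "{v \<in> \<Union>F. v \<in> e} = e" by auto
    then show "(\<Sum>v\<in>\<Union>F. if v \<in> e then 1 else 0) = card e"
      using finU by (simp add: sum.If_cases Int_def)
  qed
  finally show ?thesis using assms(2) by simp
qed

text \<open>The degrees sum to \<open>2 * card F\<close>, at most twice the number of vertices. Once
  all of them are at least two, none can exceed two.\<close>

lemma degree_eq_2:
  assumes "finite F" and "\<And>e. e \<in> F \<Longrightarrow> card e = 2"
    and "card F \<le> card (\<Union>F)" and ge: "\<And>v. v \<in> \<Union>F \<Longrightarrow> 2 \<le> card {e\<in>F. v \<in> e}"
    and "v \<in> \<Union>F"
  shows "card {e\<in>F. v \<in> e} = 2"
proof (rule ccontr)
  assume neq: "card {e\<in>F. v \<in> e} \<noteq> 2"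
  have "finite e" if "e \<in> F" for e
    using assms(2)[OF that] by (intro card_ge_0_finite) simp
  then have "finite (\<Union>F)" using assms(1) by blast
  moreover have "2 < card {e\<in>F. v \<in> e}" using ge[OF assms(5)] neq by simp
  ultimately have "(\<Sum>v\<in>\<Union>F. 2) < (\<Sum>v\<in>\<Union>F. card {e\<in>F. v \<in> e})"
    using ge assms(5) by (intro sum_strict_mono_ex1) blast+
  then show False using sum_degrees[OF assms(1,2)] assms(3) by simp
qed


lemma uedge_neq_if_same_start:
  assumes "a \<noteq> b" "fst a = fst b" "fst a \<noteq> snd a"
  shows "uedge a \<noteq> uedge b"
  using assms by (cases a; cases b) (auto simp: uedge_eq_iff)

lemma uedge_neq_if_same_end:
  assumes "a \<noteq> b" "snd a = snd b" "fst a \<noteq> snd a"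
  shows "uedge a \<noteq> uedge b"
  using assms by (cases a; cases b) (auto simp: uedge_eq_iff)

lemma uedge_neq_if_nb_step:
  assumes "nb_step a b" "fst a \<noteq> snd a"
  shows "uedge a \<noteq> uedge b"
  using assms by (cases a; cases b) (auto simp: uedge_eq_iff nb_step_def)

lemma nb_walks_nth:
  assumes "p \<in> nb_walks A k"
  shows "\<And>t. t < k \<Longrightarrow> p ! t \<in> A" "\<And>t. Suc t < k \<Longrightarrow> nb_step (p ! t) (p ! Suc t)"
  using assms by (auto simp: nb_walks_def successively_conv_nth)

text \<open>
  Three walks that leave a common vertex, two of them differently from the first, and meet again
  span a graph of minimum degree two; with excess at most zero it is a disjoint union of cycles,
  on which a non-backtracking walk has no choice.
\<close>

lemma nb_walks_detour_unique:
  assumes loopless: "\<And>a. a \<in> A \<Longrightarrow> fst a \<noteq> snd a"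
    and excess: "excess_le A (3 * k) 0"
    and walks: "p0 \<in> nb_walks A k" "p \<in> nb_walks A k" "p' \<in> nb_walks A k"
    and starts: "starts_at x p0" "starts_at x p" "starts_at x p'"
    and ends: "end_from x p0 = y" "end_from x p = y" "end_from x p' = y"
    and ij: "i \<le> j" "j < k"
    and diff: "p ! i \<noteq> p0 ! i" "p' ! i \<noteq> p0 ! i" "p ! j \<noteq> p0 ! j" "p' ! j \<noteq> p0 ! j"
    and same: "\<And>t. t < k \<Longrightarrow> t < i \<or> j < t \<Longrightarrow> p ! t = p0 ! t"
      "\<And>t. t < k \<Longrightarrow> t < i \<or> j < t \<Longrightarrow> p' ! t = p0 ! t"
  shows "p = p'"
proof -
  define R where "R = {p0, p, p'}"
  \<comment> \<open>Outside the window from \<open>i\<close> to \<open>j\<close> the three walks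
    coincide. \<open>F\<close> consists of the edges used inside it and will turn out to be
    2-regular.\<close>
  define F where "F = (\<Union>r\<in>R. (\<lambda>t. uedge (r ! t)) ` {i..j})"
  have R: "r \<in> nb_walks A k" "starts_at x r" "end_from x r = y" if "r \<in> R" for r
    using that walks starts ends by (auto simp: R_def)
  have len: "length r = k" if "r \<in> R" for r using R(1)[OF that] by (simp add: nb_walks_def)
  have inA: "r ! t \<in> A" if "r \<in> R" "t < k" for r t using nb_walks_nth(1)[OF R(1)] that by blast
  have nb: "nb_step (r ! t) (r ! Suc t)" if "r \<in> R" "Suc t < k" for r t
    using nb_walks_nth(2)[OF R(1)] that by blast
  have finR: "finite R" by (simp add: R_def)
  have finF: "finite F" by (simp add: F_def finR)
  have mem: "uedge (r ! t) \<in> F" if "r \<in> R" "i \<le> t" "t \<le> j" for r t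
    unfolding F_def using that by (intro UN_I[of r] imageI) auto
  have start: "fst (r ! i) = fst (p0 ! i)" if "r \<in> R" for r
  proof (cases i)
    case 0
    have "r \<noteq> []" "p0 \<noteq> []" using len[OF that] len[of p0] ij by (auto simp: R_def)
    then show ?thesis using R(2)[OF that] R(2)[of p0] 0
      by (simp add: starts_at_def hd_conv_nth R_def)
  next
    case (Suc i')
    have "r ! i' = p0 ! i'" using same[of i'] Suc ij that by (auto simp: R_def)
    moreover have "snd (r ! i') = fst (r ! i)" "snd (p0 ! i') = fst (p0 ! i)"
      using nb[of r i'] nb[of p0 i'] that Suc ij by (auto simp: nb_step_def R_def)
    ultimately show ?thesis by simp
  qed
  have finish: "snd (r ! j) = snd (p0 ! j)" if "r \<in> R" for r
  proof (cases "Suc j < k")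
    case False
    then have "j = k - 1" using ij by simp
    moreover have "r \<noteq> []" "p0 \<noteq> []" using len[OF that] len[of p0] ij by (auto simp: R_def)
    ultimately show ?thesis using R(3)[OF that] R(3)[of p0] len[OF that] len[of p0]
      by (simp add: end_from_def last_conv_nth R_def)
  next
    case True
    have "r ! Suc j = p0 ! Suc j" using same[of "Suc j"] True that by (auto simp: R_def)
    moreover have "snd (r ! j) = fst (r ! Suc j)" "snd (p0 ! j) = fst (p0 ! Suc j)"
      using nb[of r j] nb[of p0 j] that True by (auto simp: nb_step_def R_def)
    ultimately show ?thesis by simp
  qed
  have two: "2 \<le> card {e\<in>F. v \<in> e}" if "e1 \<in> F" "e2 \<in> F" "v \<in> e1" "v \<in> e2" "e1 \<noteq> e2" for v e1 e2
  proof -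
    have "card {e1, e2} \<le> card {e\<in>F. v \<in> e}" using that finF by (intro card_mono) auto
    then show ?thesis using that by simp
  qed
  have three: "3 \<le> card {e\<in>F. v \<in> e}"
    if "e1 \<in> F" "e2 \<in> F" "e3 \<in> F" "v \<in> e1" "v \<in> e2" "v \<in> e3" "e1 \<noteq> e2" "e1 \<noteq> e3" "e2 \<noteq> e3"
    for v e1 e2 e3
  proof -
    have "card {e1, e2, e3} \<le> card {e\<in>F. v \<in> e}" using that finF by (intro card_mono) auto
    then show ?thesis using that by simp
  qed
  \<comment> \<open>An inner vertex of the window has the edges by which a walk enters and leaves
    it; an end of the window has the edges of two walks that differ there.\<close>
  have degF: "2 \<le> card {e\<in>F. v \<in> e}" if "v \<in> \<Union>F" for v
  proof -
    obtain r t where rt: "r \<in> R" "i \<le> t" "t \<le> j" "v \<in> uedge (r ! t)"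
      using \<open>v \<in> \<Union>F\<close> by (auto simp: F_def)
    \<comment> \<open>Each walk in \<open>R\<close> has a partner that differs from it at both
      \<open>i\<close> and \<open>j\<close>: \<open>p0\<close> for \<open>p\<close> and
      \<open>p'\<close>, and either of these for \<open>p0\<close>.\<close>
    obtain r' where r': "r' \<in> R" "r' ! i \<noteq> r ! i" "r' ! j \<noteq> r ! j"
      using rt(1) diff unfolding R_def by (cases "r = p0") (metis insertI1 insertI2 insertE singletonD)+
    have tk: "t < k" using rt ij by simp
    consider "v = fst (r ! t)" | "v = snd (r ! t)" using rt(4) by (auto simp: uedge_def)
    then show ?thesis
    proof cases
      case 1
      show ?thesis
      proof (cases "t = i")
        case True
        have "uedge (r ! i) \<noteq> uedge (r' ! i)"
          using uedge_neq_if_same_start[of "r ! i" "r' ! i"] r' start[OF rt(1)] start[OF r'(1)]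
            loopless[OF inA[OF rt(1) tk]] True by auto
        then show ?thesis
          using True 1 start[OF rt(1)] start[OF r'(1)] ij
          by (intro two[OF mem[OF rt(1), of i] mem[OF r'(1), of i]]) (auto simp: uedge_def)
      next
        case False
        then obtain t' where t': "t = Suc t'" "i \<le> t'" using rt(2) by (cases t) auto
        have "nb_step (r ! t') (r ! t)" using nb[OF rt(1), of t'] t' tk by simp
        moreover have "fst (r ! t') \<noteq> snd (r ! t')" using loopless inA[OF rt(1), of t'] t' tk by simp
        ultimately show ?thesis
          using 1 t' rt uedge_neq_if_nb_step[of "r ! t'" "r ! t"]
          by (intro two[OF mem[OF rt(1), of t'] mem[OF rt(1), of t]]) (auto simp: uedge_def nb_step_def)
      qed
    next
      case 2
      show ?thesis
      proof (cases "t = j")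
        case True
        have "uedge (r ! j) \<noteq> uedge (r' ! j)"
          using uedge_neq_if_same_end[of "r ! j" "r' ! j"] r' finish[OF rt(1)] finish[OF r'(1)]
            loopless[OF inA[OF rt(1) tk]] True by auto
        then show ?thesis
          using True 2 finish[OF rt(1)] finish[OF r'(1)] ij
          by (intro two[OF mem[OF rt(1), of j] mem[OF r'(1), of j]]) (auto simp: uedge_def)
      next
        case False
        then have t': "Suc t \<le> j" using rt by simp
        have "nb_step (r ! t) (r ! Suc t)" using nb[OF rt(1), of t] t' ij by simp
        moreover have "fst (r ! t) \<noteq> snd (r ! t)" using loopless inA[OF rt(1) tk] by simp
        ultimately show ?thesis
          using 2 t' rt uedge_neq_if_nb_step[of "r ! t" "r ! Suc t"]
          by (intro two[OF mem[OF rt(1), of t] mem[OF rt(1), of "Suc t"]]) (auto simp: uedge_def nb_step_def)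
      qed
    qed
  qed
  have FA: "F \<subseteq> uedge ` A" using inA ij by (auto simp: F_def)
  have card2: "card e = 2" if "e \<in> F" for e
  proof -
    obtain a where "a \<in> A" "e = uedge a" using \<open>e \<in> F\<close> FA by blast
    then show ?thesis using loopless by (simp add: uedge_def)
  qed
  \<comment> \<open>At most three walks with at most \<open>k\<close> edges each: the origin of
    \<open>3 * k\<close>.\<close>
  have "card F \<le> (\<Sum>r\<in>R. card ((\<lambda>t. uedge (r ! t)) ` {i..j}))"
    unfolding F_def by (rule card_UN_le[OF finR])
  also have "\<dots> \<le> (\<Sum>r\<in>R. Suc j - i)"
    by (intro sum_mono order.trans[OF card_image_le]) auto
  also have "\<dots> = card R * (Suc j - i)" by simp
  also have "\<dots> \<le> 3 * k"
    using ij by (intro mult_mono) (auto simp: R_def card_insert_if)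
  finally have "card F \<le> 3 * k" .
  then have le: "card F \<le> card (\<Union>F)" using excess FA by (auto simp: excess_le_def)
  note deg2 = degree_eq_2[OF finF card2 le degF]
  have pR: "p0 \<in> R" "p \<in> R" "p' \<in> R" by (auto simp: R_def)
  \<comment> \<open>A first time at which \<open>p\<close> and \<open>p'\<close> differ would yield
    a vertex of degree three: at time \<open>i\<close> the third edge is that of \<open>p0\<close>,
    later it is the common edge just traversed.\<close>
  have mid: "p ! t = p' ! t" if "i \<le> t" "t \<le> j" for t
    using that
  proof (induction t rule: dec_induct)
    case base
    show ?case
    proof (rule ccontr)
      assume neq: "p ! i \<noteq> p' ! i"
      have l: "fst (p0 ! i) \<noteq> snd (p0 ! i)" "fst (p ! i) \<noteq> snd (p ! i)"
        using loopless inA pR ij by auto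
      note st = start[OF pR(2)] start[OF pR(3)]
      have "uedge (p0 ! i) \<noteq> uedge (p ! i)" "uedge (p0 ! i) \<noteq> uedge (p' ! i)"
        by (rule uedge_neq_if_same_start; use st diff l in simp)+
      moreover have "uedge (p ! i) \<noteq> uedge (p' ! i)"
        by (rule uedge_neq_if_same_start) (use st neq l in simp_all)
      ultimately have "3 \<le> card {e\<in>F. fst (p0 ! i) \<in> e}"
        using st ij
        by (intro three[OF mem[OF pR(1)] mem[OF pR(2)] mem[OF pR(3)], of i i i])
          (auto simp: uedge_def)
      moreover have "fst (p0 ! i) \<in> \<Union>F"
        by (rule UnionI[OF mem[OF pR(1), of i]]) (use ij in \<open>auto simp: uedge_def\<close>)
      ultimately show False using deg2[of "fst (p0 ! i)"] by simp
    qed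
  next
    case (step t)
    show ?case
    proof (rule ccontr)
      assume neq: "p ! Suc t \<noteq> p' ! Suc t"
      have eq: "p ! t = p' ! t" using step by simp
      have n: "nb_step (p ! t) (p ! Suc t)" "nb_step (p ! t) (p' ! Suc t)"
        using nb[OF pR(2), of t] nb[OF pR(3), of t] eq step ij by auto
      have l: "fst (p ! t) \<noteq> snd (p ! t)" "fst (p ! Suc t) \<noteq> snd (p ! Suc t)"
        using loopless[OF inA[OF pR(2), of t]] loopless[OF inA[OF pR(2), of "Suc t"]] step ij by simp_all
      have "uedge (p ! t) \<noteq> uedge (p ! Suc t)" "uedge (p ! t) \<noteq> uedge (p' ! Suc t)"
        using uedge_neq_if_nb_step[OF n(1) l(1)] uedge_neq_if_nb_step[OF n(2) l(1)] by simp_all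
      moreover have "uedge (p ! Suc t) \<noteq> uedge (p' ! Suc t)"
        by (rule uedge_neq_if_same_start[OF neq _ l(2)]) (use n in \<open>simp add: nb_step_def\<close>)
      ultimately have "3 \<le> card {e\<in>F. snd (p ! t) \<in> e}"
        using n step
        by (intro three[OF mem[OF pR(2), of t] mem[OF pR(2), of "Suc t"] mem[OF pR(3), of "Suc t"]])
          (auto simp: uedge_def nb_step_def)
      moreover have "snd (p ! t) \<in> \<Union>F"
        by (rule UnionI[OF mem[OF pR(2), of t]]) (use step in \<open>auto simp: uedge_def\<close>)
      ultimately show False using deg2[of "snd (p ! t)"] by simp
    qed
  qed
  show ?thesis
  proof (rule nth_equalityI)
    show "length p = length p'" using len pR by simp
    show "p ! t = p' ! t" if "t < length p" for t
      using mid[of t] same[of t] that len[OF pR(2)] by (cases "i \<le> t \<and> t \<le> j") auto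
  qed
qed

text \<open>Fix one walk \<open>p0\<close>. By \<open>nb_walks_detour_unique\<close> any other walk
  is determined by the first and the last time at which it differs from \<open>p0\<close>, which
  leaves \<open>k * k\<close> possibilities.\<close>

lemma card_nb_walks_between:
  assumes "finite A" and loopless: "\<And>a. a \<in> A \<Longrightarrow> fst a \<noteq> snd a"
    and excess: "excess_le A (3 * k) 0"
  shows "card {p \<in> nb_walks A k. starts_at x p \<and> end_from x p = y} \<le> k * k + 1" (is "card ?X \<le> _")
proof (cases "?X = {}")
  case False
  then obtain p0 where p0: "p0 \<in> ?X" by blast
  define D where "D p = {t. t < k \<and> p ! t \<noteq> p0 ! t}" for p
  have finX: "finite ?X" using finite_nb_walks[OF assms(1)] by simp
  have finD: "finite (D p)" for p by (simp add: D_def)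
  have neD: "D p \<noteq> {}" if "p \<in> ?X - {p0}" for p
    using that p0 by (auto simp: D_def nb_walks_def list_eq_iff_nth_eq)
  have "card (?X - {p0}) \<le> card ({..<k} \<times> {..<k})"
  proof (rule card_inj_on_le)
    show "(\<lambda>p. (Min (D p), Max (D p))) ` (?X - {p0}) \<subseteq> {..<k} \<times> {..<k}"
    proof
      fix z assume "z \<in> (\<lambda>p. (Min (D p), Max (D p))) ` (?X - {p0})"
      then obtain p where p: "p \<in> ?X - {p0}" "z = (Min (D p), Max (D p))" by blast
      have "Min (D p) \<in> D p" "Max (D p) \<in> D p" using finD neD[OF p(1)] by auto
      then show "z \<in> {..<k} \<times> {..<k}" using p(2) by (auto simp: D_def)
    qed
    show "inj_on (\<lambda>p. (Min (D p), Max (D p))) (?X - {p0})"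
    proof (rule inj_onI)
      fix p p' assume p: "p \<in> ?X - {p0}" "p' \<in> ?X - {p0}"
        and eq: "(Min (D p), Max (D p)) = (Min (D p'), Max (D p'))"
      define i where "i = Min (D p)"
      define j where "j = Max (D p)"
      have i: "i \<in> D p" "i \<in> D p'" and j: "j \<in> D p" "j \<in> D p'"
        using Min_in[OF finD neD[OF p(1)]] Min_in[OF finD neD[OF p(2)]]
          Max_in[OF finD neD[OF p(1)]] Max_in[OF finD neD[OF p(2)]] eq by (auto simp: i_def j_def)
      have out: "t \<notin> D p \<and> t \<notin> D p'" if "t < i \<or> j < t" for t
        using that eq Min_le[OF finD, of t p] Min_le[OF finD, of t p'] Max_ge[OF finD, of t p]
          Max_ge[OF finD, of t p'] by (auto simp: i_def j_def)
      show "p = p'"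
      proof (rule nb_walks_detour_unique[of A k p0 p p' x y i j])
        show "i \<le> j" using i j Min_le[OF finD j(1)] by (simp add: i_def)
        show "\<And>t. t < k \<Longrightarrow> t < i \<or> j < t \<Longrightarrow> p ! t = p0 ! t"
          "\<And>t. t < k \<Longrightarrow> t < i \<or> j < t \<Longrightarrow> p' ! t = p0 ! t"
          using out by (auto simp: D_def)
      qed (use p0 p i j loopless excess in \<open>auto simp: D_def\<close>)
    qed
  qed simp
  then have "card (?X - {p0}) \<le> k * k" by simp
  then show ?thesis using finX p0 by (simp add: card_Diff_singleton)
next
  case True
  then show ?thesis by (simp only: card.empty)
qed

section \<open>Hikes and their phases\<close>

definition visited :: "'w \<Rightarrow> ('w \<times> 'w) list \<Rightarrow> 'w set" where
  "visited x p = insert x (snd ` set p)"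

definition walks_from :: "('w \<times> 'w) set \<Rightarrow> 'w \<Rightarrow> nat \<Rightarrow> ('w \<times> 'w) list set" where
  "walks_from A x b = {p \<in> nb_walks A b. starts_at x p}"

definition walks_between :: "('w \<times> 'w) set \<Rightarrow> 'w \<Rightarrow> 'w \<Rightarrow> nat \<Rightarrow> ('w \<times> 'w) list set" where
  "walks_between A x y a = {p \<in> nb_walks A a. starts_at x p \<and> end_from x p = y}"

text \<open>
  A phase consists of a walk back to a vertex visited earlier, followed by a walk that is going to
  be used for new edges only. \<open>phases A q x J e\<close> contains the concatenations of \<open>J\<close> phases with \<open>e\<close>
  steps of the second kind in total; that those steps really are new is not imposed, since only an
  upper bound on the number of concatenations is needed.
\<close>

primrec phases :: "('w \<times> 'w) set \<Rightarrow> nat \<Rightarrow> 'w \<Rightarrow> nat \<Rightarrow> nat \<Rightarrow> ('w \<times> 'w) list set" where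
  "phases A q x 0 e = (if e = 0 then {[]} else {})"
| "phases A q x (Suc J) e =
     (\<Union>b\<in>{..min e q}. \<Union>u\<in>phases A q x J (e - b). \<Union>a\<in>{..q}. \<Union>y\<in>visited x u.
        (\<lambda>(s, f). u @ s @ f) ` (walks_between A (end_from x u) y a \<times> walks_from A y b))"

text \<open>Arcs are numbered from 0, so a step into an index divisible by \<open>q\<close> is the
  turn between two segments. The turn repeats the last arc in the opposite direction; a segment of
  \<open>q\<close> arcs therefore contains \<open>q - 1\<close> non-backtracking steps.\<close>

definition hike :: "('w \<times> 'w) set \<Rightarrow> nat \<Rightarrow> ('w \<times> 'w) list \<Rightarrow> bool" where
  "hike A q w \<longleftrightarrow> set w \<subseteq> A \<and>
     (\<forall>t. Suc t < length w \<longrightarrow>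
        (if Suc t mod q = 0 then w ! Suc t = prod.swap (w ! t) else nb_step (w ! t) (w ! Suc t)))"

lemma finite_visited [simp]: "finite (visited x p)"
  by (simp add: visited_def)

lemma card_visited_le: "card (visited x p) \<le> length p + 1"
proof -
  have "card (visited x p) \<le> Suc (card (snd ` set p))"
    unfolding visited_def by (rule card_insert_le_m1) simp_all
  also have "card (snd ` set p) \<le> length p"
    using card_image_le[of "set p" snd] card_length[of p] by simp
  finally show ?thesis by simp
qed

lemma phases_length:
  "w \<in> phases A q x J e \<Longrightarrow> length w \<le> 2 * q * J"
proof (induction J arbitrary: w e)
  case 0
  then show ?case by (simp split: if_splits)
next
  case (Suc J)
  then obtain b u a y s f where *: "b \<le> q" "u \<in> phases A q x J (e - b)" "a \<le> q"
    "s \<in> walks_between A (end_from x u) y a" "f \<in> walks_from A y b" "w = u @ s @ f"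
    by auto
  have "length u \<le> 2 * q * J" using Suc.IH *(2) by blast
  moreover have "length s \<le> q" "length f \<le> q"
    using * by (auto simp: walks_between_def walks_from_def nb_walks_def)
  ultimately show ?case using *(6) by simp
qed

lemma finite_phases: "finite A \<Longrightarrow> finite (phases A q x J e)"
  by (induction J arbitrary: e)
    (auto simp: walks_between_def walks_from_def finite_nb_walks intro!: finite_imageI finite_cartesian_product)

text \<open>One phase is chosen through the two lengths \<open>a\<close> and \<open>b\<close>
  (\<open>q + 1\<close> values each), the target among at most \<open>2 * q * J0 + 1\<close> visited
  vertices, one of \<kappa> walks back and one of \<open>c * R ^ b\<close> walks onward. The onward
  lengths sum to \<open>e\<close>, so the powers of \<open>R\<close> multiply to
  \<open>R ^ e\<close>. The fixed bound \<open>J0\<close> makes the cost of a phase independent of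
  its position.\<close>

lemma card_phases:
  fixes R c :: real
  assumes "finite A" and "0 < R" and "0 \<le> c"
    and between: "\<And>y z a. a \<le> q \<Longrightarrow> card (walks_between A y z a) \<le> \<kappa>"
    and onward: "\<And>y b. b \<le> q \<Longrightarrow> real (card (walks_from A y b)) \<le> c * R ^ b"
    and "J \<le> J0"
  shows "real (card (phases A q x J e)) \<le> (real ((q + 1) ^ 2 * (2 * q * J0 + 1) * \<kappa>) * c) ^ J * R ^ e"
  using \<open>J \<le> J0\<close>
proof (induction J arbitrary: e)
  case 0
  then show ?case using assms by simp
next
  case (Suc J)
  define K where "K = real ((q + 1) ^ 2 * (2 * q * J0 + 1) * \<kappa>) * c"
  \<comment> \<open>The cost of a phase whose onward length \<open>b\<close> is fixed; the factor
    \<open>q + 1\<close> by which \<open>K\<close> is larger pays for the choice of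
    \<open>b\<close>.\<close>
  define K' where "K' = real ((q + 1) * (2 * q * J0 + 1) * \<kappa>) * c"
  have K: "K = real (q + 1) * K'" by (simp only: K_def K'_def power2_eq_square of_nat_mult mult.assoc)
  have K0: "0 \<le> K" "0 \<le> K'" using assms by (simp_all add: K_def K'_def)
  let ?S = "\<lambda>b u a y. (\<lambda>(s, f). u @ s @ f) ` (walks_between A (end_from x u) y a \<times> walks_from A y b)"
  have fin: "finite (walks_between A y z a)" "finite (walks_from A y b)" for y z a b
    using finite_nb_walks[OF assms(1)] by (auto simp: walks_between_def walks_from_def)
  have S: "real (card (?S b u a y)) \<le> real \<kappa> * (c * R ^ b)" if "a \<le> q" "b \<le> q" for b u a y
  proof -
    have "card (?S b u a y) \<le> card (walks_between A (end_from x u) y a \<times> walks_from A y b)"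
      using fin by (intro card_image_le) simp
    then have "real (card (?S b u a y)) \<le>
        real (card (walks_between A (end_from x u) y a)) * real (card (walks_from A y b))"
      by (metis card_cartesian_product of_nat_le_iff of_nat_mult)
    also have "\<dots> \<le> real \<kappa> * (c * R ^ b)"
      using between[OF that(1)] onward[OF that(2)] by (intro mult_mono) auto
    finally show ?thesis .
  qed
  have U: "real (card (\<Union>a\<in>{..q}. \<Union>y\<in>visited x u. ?S b u a y)) \<le> K' * R ^ b"
    if "u \<in> phases A q x J (e - b)" "b \<le> q" for u b
  proof -
    have "card (\<Union>a\<in>{..q}. \<Union>y\<in>visited x u. ?S b u a y) \<le> (\<Sum>a\<in>{..q}. card (\<Union>y\<in>visited x u. ?S b u a y))"
      by (rule card_UN_le) simp
    also have "\<dots> \<le> (\<Sum>a\<in>{..q}. \<Sum>y\<in>visited x u. card (?S b u a y))"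
      by (intro sum_mono card_UN_le) simp
    finally have "real (card (\<Union>a\<in>{..q}. \<Union>y\<in>visited x u. ?S b u a y))
        \<le> real (\<Sum>a\<in>{..q}. \<Sum>y\<in>visited x u. card (?S b u a y))"
      by (rule of_nat_mono)
    also have "\<dots> = (\<Sum>a\<in>{..q}. \<Sum>y\<in>visited x u. real (card (?S b u a y)))"
      by (simp only: of_nat_sum)
    also have "\<dots> \<le> (\<Sum>a\<in>{..q}. \<Sum>y\<in>visited x u. real \<kappa> * (c * R ^ b))"
      using S that(2) by (intro sum_mono) auto
    also have "\<dots> = real (q + 1) * (real (card (visited x u)) * (real \<kappa> * (c * R ^ b)))" by simp
    also have "\<dots> \<le> real (q + 1) * (real (2 * q * J0 + 1) * (real \<kappa> * (c * R ^ b)))"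
    proof (intro mult_left_mono mult_right_mono)
      have "card (visited x u) \<le> 2 * q * J + 1"
        using card_visited_le[of x u] phases_length[OF that(1)] by simp
      also have "\<dots> \<le> 2 * q * J0 + 1" using Suc.prems by simp
      finally show "real (card (visited x u)) \<le> real (2 * q * J0 + 1)" by linarith
    qed (use assms in auto)
    finally show ?thesis by (simp only: K'_def of_nat_mult mult_ac)
  qed
  have B: "real (card (\<Union>u\<in>phases A q x J (e - b). \<Union>a\<in>{..q}. \<Union>y\<in>visited x u. ?S b u a y))
      \<le> K ^ J * K' * R ^ e" if "b \<le> min e q" for b
  proof -
    have "card (\<Union>u\<in>phases A q x J (e - b). \<Union>a\<in>{..q}. \<Union>y\<in>visited x u. ?S b u a y)
        \<le> (\<Sum>u\<in>phases A q x J (e - b). card (\<Union>a\<in>{..q}. \<Union>y\<in>visited x u. ?S b u a y))"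
      by (rule card_UN_le[OF finite_phases[OF assms(1)]])
    then have "real (card (\<Union>u\<in>phases A q x J (e - b). \<Union>a\<in>{..q}. \<Union>y\<in>visited x u. ?S b u a y))
        \<le> real (\<Sum>u\<in>phases A q x J (e - b). card (\<Union>a\<in>{..q}. \<Union>y\<in>visited x u. ?S b u a y))"
      by (rule of_nat_mono)
    also have "\<dots> = (\<Sum>u\<in>phases A q x J (e - b). real (card (\<Union>a\<in>{..q}. \<Union>y\<in>visited x u. ?S b u a y)))"
      by (simp only: of_nat_sum)
    also have "\<dots> \<le> (\<Sum>u\<in>phases A q x J (e - b). K' * R ^ b)"
      using U that by (intro sum_mono) auto
    also have "\<dots> = real (card (phases A q x J (e - b))) * (K' * R ^ b)" by simp
    also have "\<dots> \<le> (K ^ J * R ^ (e - b)) * (K' * R ^ b)"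
      using Suc K0 assms by (intro mult_right_mono) (auto simp: K_def)
    also have "\<dots> = K ^ J * K' * R ^ e"
      using that by (simp add: power_add[symmetric])
    finally show ?thesis .
  qed
  have "real (card (phases A q x (Suc J) e))
      \<le> real (\<Sum>b\<in>{..min e q}. card (\<Union>u\<in>phases A q x J (e - b). \<Union>a\<in>{..q}. \<Union>y\<in>visited x u. ?S b u a y))"
    unfolding phases.simps of_nat_le_iff by (rule card_UN_le) simp
  also have "\<dots> = (\<Sum>b\<in>{..min e q}. real (card (\<Union>u\<in>phases A q x J (e - b). \<Union>a\<in>{..q}. \<Union>y\<in>visited x u. ?S b u a y)))"
    by (simp only: of_nat_sum)
  also have "\<dots> \<le> (\<Sum>b\<in>{..min e q}. K ^ J * K' * R ^ e)"
    using B by (intro sum_mono) auto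
  also have "\<dots> = real (min e q + 1) * (K ^ J * K' * R ^ e)" by simp
  also have "\<dots> \<le> real (q + 1) * (K ^ J * K' * R ^ e)"
    using K0 assms by (intro mult_right_mono) auto
  also have "\<dots> = K ^ Suc J * R ^ e" by (simp add: K)
  finally show ?case by (simp add: K_def)
qed

declare phases.simps(2) [simp del]

lemma phases_SucI:
  assumes "u \<in> phases A q x J e" "y \<in> visited x u" "s \<in> walks_between A (end_from x u) y (length s)"
    "f \<in> walks_from A y (length f)" "length s \<le> q" "length f \<le> q"
  shows "u @ s @ f \<in> phases A q x (Suc J) (e + length f)"
proof -
  have "u \<in> phases A q x J (e + length f - length f)" using assms(1) by simp
  then show ?thesis
    unfolding phases.simps(2) using assms
    by (intro UN_I[of "length f"] UN_I[of u] UN_I[of "length s"] UN_I[of y] image_eqI[of _ _ "(s, f)"]) auto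
qed

text \<open>
  A new vertex has only one old edge. So after a step to a new vertex the next edge is new as well,
  unless the hike turns around. Hence a phase ends only when the hike turns around or when a new edge
  leads to an old vertex, and the latter happens as often as the excess of the graph of the hike.
\<close>

lemma hike_in_phases:
  assumes hike: "hike A q w" and "w \<noteq> []" and x: "x = fst (hd w)" and "0 < q"
    and loopless: "\<And>a. a \<in> A \<Longrightarrow> fst a \<noteq> snd a"
  obtains J where "w \<in> phases A q x J (card (uedge ` set w))"
    and "J + card (visited x w) \<le> (length w - 1) div q + card (uedge ` set w) + 2"
proof -
  \<comment> \<open>The number \<open>ed t + 1 - nu t\<close> counts the independent cycles of the
    connected graph explored by the first \<open>t\<close> arcs. It grows by one exactly when a new
    edge leads to an old vertex.\<close>
  define nu where "nu t = card (visited x (take t w))" for t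
  define ed where "ed t = card (uedge ` set (take t w))" for t
  define N where "N = length w"
  have wA: "w ! i \<in> A" if "i < N" for i using that hike by (auto simp: hike_def N_def)
  have adj: "fst (w ! Suc i) = snd (w ! i)" if "Suc i < N" for i
    using that hike by (auto simp: hike_def N_def nb_step_def split: if_splits)
  have fst_vis: "fst (w ! i) \<in> visited x (take t w)" if "i < t" "t \<le> N" for i t
  proof (cases i)
    case 0
    then show ?thesis using x \<open>w \<noteq> []\<close> by (simp add: visited_def hd_conv_nth)
  next
    case (Suc i')
    then have "w ! i' \<in> set (take t w)" using that by (auto simp: in_set_conv_nth N_def intro!: exI[of _ i'])
    then show ?thesis using adj[of i'] Suc that by (auto simp: visited_def)
  qed
  have start: "fst (w ! t) = end_from x (take t w)" if "t < N" for t
  proof (cases t)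
    case 0
    then show ?thesis using x \<open>w \<noteq> []\<close> by (simp add: end_from_def hd_conv_nth)
  next
    case (Suc t')
    then have "last (take t w) = w ! t'" using that by (simp add: take_Suc_conv_app_nth N_def)
    then show ?thesis using adj[of t'] Suc that \<open>w \<noteq> []\<close> by (simp add: end_from_def)
  qed
  \<comment> \<open>The loop invariant. \<open>u\<close> holds \<open>J\<close> completed phases,
    \<open>s\<close> and \<open>f\<close> are the return and the onward part of the phase in
    progress. \<open>L\<close> bounds the length of that phase by the position in the current
    segment. Completed phases are charged to turns, counted by \<open>D\<close>, or to cycles. A
    nonempty \<open>f\<close> records that the last arc reached a new vertex.\<close>
  define st where "st t L D \<longleftrightarrow> (\<exists>J e u s f y. take t w = u @ s @ f \<and> u \<in> phases A q x J e \<and>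
      y \<in> visited x u \<and> s \<in> walks_between A (end_from x u) y (length s) \<and>
      f \<in> walks_from A y (length f) \<and> e + length f = ed t \<and> visited x (u @ s) = visited x u \<and>
      (f \<noteq> [] \<longrightarrow> end_from x (take t w) \<notin> visited x (take (t - 1) w)) \<and>
      length s + length f \<le> L \<and> J + nu t \<le> D + ed t + 1)" for t L D
  \<comment> \<open>A prefix made of completed phases opens a new one with both parts empty and the
    current vertex as target.\<close>
  have reset: "st t L D" if "take t w \<in> phases A q x J (ed t)" "J + nu t \<le> D + ed t + 1" for t J L D
    unfolding st_def
  proof (intro exI conjI)
    show "take t w = take t w @ [] @ []" by simp
    show "end_from x (take t w) \<in> visited x (take t w)"
      by (cases "take t w = []") (auto simp: end_from_def visited_def)
  qed (use that in \<open>auto simp: walks_between_def walks_from_def nb_walks_def starts_at_def end_from_def\<close>)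
  have close: "\<exists>J. take t w \<in> phases A q x J (ed t) \<and> J + nu t \<le> D + ed t + 2"
    if st: "st t L D" and "L \<le> q" for t L D
  proof -
    obtain J e u s f y where *: "take t w = u @ s @ f" "u \<in> phases A q x J e"
      "y \<in> visited x u" "s \<in> walks_between A (end_from x u) y (length s)"
      "f \<in> walks_from A y (length f)" "e + length f = ed t"
      "length s + length f \<le> L" "J + nu t \<le> D + ed t + 1"
      using st unfolding st_def by (elim exE conjE) (rule that; assumption)
    have "length s \<le> q" "length f \<le> q" using *(7) that(2) by simp_all
    from phases_SucI[OF *(2-5) this] have "take t w \<in> phases A q x (Suc J) (ed t)"
      by (simp only: *(1) *(6))
    then show ?thesis using *(8) by (intro exI[of _ "Suc J"]) simp
  qed
  have step: "st (Suc t) (t mod q + 1) (t div q)" if st: "st t (t mod q) (t div q)" and "t < N" for t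
  proof -
    obtain J e u s f y where *: "take t w = u @ s @ f" "u \<in> phases A q x J e"
      "y \<in> visited x u" "s \<in> walks_between A (end_from x u) y (length s)"
      "f \<in> walks_from A y (length f)" "e + length f = ed t" "visited x (u @ s) = visited x u"
      "f \<noteq> [] \<longrightarrow> end_from x (take t w) \<notin> visited x (take (t - 1) w)"
      "length s + length f \<le> t mod q" "J + nu t \<le> t div q + ed t + 1"
      using st unfolding st_def by (elim exE conjE) (rule that; assumption)
    define a where "a = w ! t"
    define p where "p = take t w"
    have tk: "take (Suc t) w = p @ [a]" using \<open>t < N\<close> by (simp add: p_def a_def take_Suc_conv_app_nth N_def)
    have p: "p = u @ s @ f" using *(1) by (simp add: p_def)
    have aA: "a \<in> A" using wA \<open>t < N\<close> by (simp add: a_def)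
    have fa: "fst a = end_from x p" using start \<open>t < N\<close> by (simp add: a_def p_def)
    have nb: "nb_step (last p) a" if "s @ f \<noteq> []"
    proof -
      \<comment> \<open>The phase in progress lies within the current segment. If it is nonempty,
        \<open>t\<close> is not a multiple of \<open>q\<close>, so the next arc is no
        reversal.\<close>
      have "0 < t mod q" using that *(9) by (cases s; cases f) auto
      then have "t mod q \<noteq> 0" "t \<noteq> 0" by (metis less_numeral_extra(3), metis less_numeral_extra(3) mod_0)
      then obtain t' where t': "t = Suc t'" by (cases t) auto
      have "nb_step (w ! t') (w ! t)"
        using hike \<open>t < N\<close> \<open>t mod q \<noteq> 0\<close> t' by (auto simp: hike_def N_def)
      moreover have "last p = w ! t'" using \<open>t < N\<close> t' by (simp add: p_def take_Suc_conv_app_nth N_def)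
      ultimately show ?thesis by (simp add: a_def)
    qed
    have ed': "ed (Suc t) = card (insert (uedge a) (uedge ` set p))"
      unfolding ed_def tk by simp
    have nu': "nu (Suc t) = card (insert (snd a) (visited x p))"
      unfolding nu_def tk visited_def by (simp add: insert_commute)
    have edt: "ed t = card (uedge ` set p)" and nut: "nu t = card (visited x p)"
      by (simp_all add: ed_def nu_def p_def)
    have y: "y = end_from (end_from x u) s" using *(4) by (simp add: walks_between_def)
    have sf: "s \<in> nb_walks A (length s)" "f \<in> nb_walks A (length f)"
      "starts_at (end_from x u) s" "starts_at y f"
      using *(4,5) by (auto simp: walks_between_def walks_from_def)
    show ?thesis
    proof (cases "uedge a \<in> uedge ` set p")
      case True
      then obtain i where i: "i < t" "uedge a = uedge (w ! i)"
        using \<open>t < N\<close> by (auto simp: p_def in_set_conv_nth N_def)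
      \<comment> \<open>A nonempty \<open>f\<close> would mean that the current vertex was first
        reached by the last arc. The edge of that arc is then the only explored edge there, and
        taking it again would be a reversal.\<close>
      have f: "f = []"
      proof (rule ccontr)
        assume "f \<noteq> []"
        then have new: "fst a \<notin> visited x (take (t - 1) w)" using *(8) fa by (simp add: p_def)
        have z: "fst a = fst (w ! i) \<or> fst a = snd (w ! i)"
          using i(2) by (auto simp: uedge_def doubleton_eq_iff)
        have "\<not> i < t - 1"
        proof
          assume "i < t - 1"
          then have "w ! i \<in> set (take (t - 1) w)"
            using \<open>t < N\<close> by (auto simp: in_set_conv_nth N_def intro!: exI[of _ i])
          then have "snd (w ! i) \<in> visited x (take (t - 1) w)" by (simp add: visited_def)
          moreover have "fst (w ! i) \<in> visited x (take (t - 1) w)"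
            by (rule fst_vis[OF \<open>i < t - 1\<close>]) (use \<open>t < N\<close> in simp)
          ultimately show False using new z by metis
        qed
        then have "last p = w ! i" using i \<open>t < N\<close>
          by (cases t) (auto simp: p_def take_Suc_conv_app_nth N_def less_Suc_eq)
        then have "nb_step (w ! i) a" using nb \<open>f \<noteq> []\<close> by simp
        then show False
          using uedge_neq_if_nb_step[of "w ! i" a] i(2) loopless[OF wA[of i]] i(1) \<open>t < N\<close> by simp
      qed
      have "w ! i \<in> set p" using i \<open>t < N\<close> by (auto simp: p_def in_set_conv_nth N_def intro!: exI[of _ i])
      then have "snd (w ! i) \<in> visited x p" by (simp add: visited_def)
      moreover have "fst (w ! i) \<in> visited x p" using fst_vis[OF i(1)] \<open>t < N\<close> by (simp add: p_def)
      ultimately have sa: "snd a \<in> visited x p"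
        using i(2) by (auto simp: uedge_def doubleton_eq_iff)
      have sau: "snd a \<in> visited x u" using sa *(7) by (simp add: p f)
      have s': "s @ [a] \<in> nb_walks A (length (s @ [a]))"
        using sf(1) aA nb by (auto simp: nb_walks_def successively_append_iff p f)
      have "starts_at (end_from x u) (s @ [a])"
        using sf(3) fa by (cases s) (auto simp: starts_at_def p f end_from_def)
      then have s'': "s @ [a] \<in> walks_between A (end_from x u) (snd a) (length (s @ [a]))"
        using s' by (simp add: walks_between_def end_from_def)
      have "ed (Suc t) = ed t" using True by (simp add: ed' edt insert_absorb)
      moreover have "nu (Suc t) = nu t" using sa by (simp add: nu' nut insert_absorb)
      moreover have "visited x (u @ s @ [a]) = visited x u"
        using *(7) sau by (auto simp: visited_def)
      ultimately show ?thesis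
        unfolding st_def using * f s'' sau
        by (intro exI[of _ J] exI[of _ e] exI[of _ u] exI[of _ "s @ [a]"] exI[of _ "[]"] exI[of _ "snd a"])
          (simp_all add: tk p walks_from_def nb_walks_def starts_at_def)
    next
      case False
      have f': "f @ [a] \<in> walks_from A y (length (f @ [a]))"
      proof -
        have "nb_step (last f) a" if "f \<noteq> []" using nb that by (simp add: p)
        then have "f @ [a] \<in> nb_walks A (length (f @ [a]))"
          using sf(2) aA by (auto simp: nb_walks_def successively_append_iff)
        moreover have "starts_at y (f @ [a])"
          using sf(4) fa y by (cases f) (auto simp: starts_at_def p end_from_def split: if_splits)
        ultimately show ?thesis by (simp add: walks_from_def)
      qed
      have ed1: "ed (Suc t) = ed t + 1" using False by (simp add: ed' edt)
      show ?thesis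
      proof (cases "snd a \<in> visited x p")
        case True
        \<comment> \<open>The cycle closed by this arc pays for the phase completed here:
          \<open>ed\<close> grows while \<open>nu\<close> does not.\<close>
        have nu1: "nu (Suc t) = nu t" using True by (simp add: nu' nut insert_absorb)
        have le: "t mod q + 1 \<le> q" using \<open>0 < q\<close> by (simp add: Suc_leI)
        have "u @ s @ (f @ [a]) \<in> phases A q x (Suc J) (e + length (f @ [a]))"
          using * f' le by (intro phases_SucI) auto
        then have "take (Suc t) w \<in> phases A q x (Suc J) (ed (Suc t))"
          using *(6) by (simp add: tk p ed1)
        then show ?thesis by (rule reset) (use *(10) ed1 nu1 in simp)
      next
        case new: False
        have nu1: "nu (Suc t) = nu t + 1" using new by (simp add: nu' nut)
        have "end_from x (take (Suc t) w) \<notin> visited x (take (Suc t - 1) w)"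
          using new by (simp add: tk end_from_def p_def)
        then show ?thesis
          unfolding st_def using * f' ed1 nu1
          by (intro exI[of _ J] exI[of _ e] exI[of _ u] exI[of _ s] exI[of _ "f @ [a]"] exI[of _ y])
            (simp_all add: tk p)
      qed
    qed
  qed
  have inv: "st (Suc t) (t mod q + 1) (t div q)" if "t < N" for t
    using that
  proof (induction t)
    case 0
    have "st 0 0 0" by (rule reset[of 0 0]) (simp_all add: ed_def nu_def visited_def)
    then show ?case using step[of 0] 0 by simp
  next
    case (Suc t)
    then have IH: "st (Suc t) (t mod q + 1) (t div q)" by simp
    \<comment> \<open>At the end of a segment the phase in progress is closed ahead of the reversal
      that follows; the increase of \<open>div\<close> pays for it.\<close>
    have "st (Suc t) (Suc t mod q) (Suc t div q)"
    proof (cases "Suc t mod q = 0")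
      case True
      have le: "t mod q + 1 \<le> q" using \<open>0 < q\<close> by (simp add: Suc_leI)
      obtain J where "take (Suc t) w \<in> phases A q x J (ed (Suc t))"
        "J + nu (Suc t) \<le> t div q + ed (Suc t) + 2"
        using close[OF IH le] by blast
      moreover have "Suc t div q = t div q + 1" using True by (simp add: div_Suc)
      ultimately show ?thesis by (intro reset) simp_all
    next
      case False
      then show ?thesis using IH by (simp add: mod_Suc div_Suc split: if_splits)
    qed
    then show ?case using step Suc.prems by blast
  qed
  have "0 < N" using \<open>w \<noteq> []\<close> by (simp add: N_def)
  then have "st N ((N - 1) mod q + 1) ((N - 1) div q)" using inv[of "N - 1"] by simp
  then obtain J where "take N w \<in> phases A q x J (ed N)" "J + nu N \<le> (N - 1) div q + ed N + 2"
    using close \<open>0 < q\<close> by (metis Suc_eq_plus1 Suc_leI mod_less_divisor)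
  then show thesis using that[of J] by (simp add: N_def ed_def nu_def)
qed

section \<open>Random lifts\<close>

definition matching_of :: "'v \<Rightarrow> 'v \<Rightarrow> nat \<Rightarrow> (nat \<Rightarrow> nat) \<Rightarrow> ('v \<times> nat) set set" where
  "matching_of u v n \<pi> = (\<lambda>i. {(u, i), (v, \<pi> i)}) ` {1..n}"

lemma pair_in_matching_of_iff:
  assumes "u \<noteq> v"
  shows "{(u, i), (v, j)} \<in> matching_of u v n \<pi> \<longleftrightarrow> i \<in> {1..n} \<and> \<pi> i = j"
  using assms by (auto simp: matching_of_def doubleton_eq_iff)

lemma matching_ofE:
  assumes "f \<in> matching_of u v n \<pi>"
  obtains i where "f = {(u, i), (v, \<pi> i)}" "i \<in> {1..n}"
  using assms unfolding matching_of_def by (rule imageE)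

lemma perfect_matchings_between_commute:
  "perfect_matchings_between A B = perfect_matchings_between B A"
proof -
  have *: "{{a, b} | a b. a \<in> A \<and> b \<in> B} \<subseteq> {{a, b} | a b. a \<in> B \<and> b \<in> A}" for A B :: "'a set"
  proof
    fix f assume "f \<in> {{a, b} | a b. a \<in> A \<and> b \<in> B}"
    then obtain a b where "f = {b, a}" "a \<in> A" "b \<in> B" by (auto simp: insert_commute)
    then show "f \<in> {{a, b} | a b. a \<in> B \<and> b \<in> A}" by blast
  qed
  have "{{a, b} | a b. a \<in> A \<and> b \<in> B} = {{a, b} | a b. a \<in> B \<and> b \<in> A}" by (rule equalityI[OF * *])
  then show ?thesis unfolding perfect_matchings_between_def by (simp add: Un_commute)
qed

lemma fibre_matchings_eq_between:
  "fibre_matchings n {u, v} = perfect_matchings_between ({u} \<times> {1..n}) ({v} \<times> {1..n})"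
proof -
  have *: "{(a, b). {u, v} = {a, b}} = {(u, v), (v, u)}" by (auto simp: doubleton_eq_iff)
  show ?thesis
    unfolding fibre_matchings_def * UN_insert UN_empty prod.case
    by (simp only: perfect_matchings_between_commute[of "{v} \<times> {1..n}" "{u} \<times> {1..n}"] Un_empty_right Un_absorb)
qed

text \<open>A perfect matching of two fibres is the graph of a bijection of their index sets. The
  existence of partners on the left gives the map, uniqueness on the right its injectivity, and
  surjectivity follows by finiteness.\<close>

lemma fibre_matchings_eq:
  assumes "u \<noteq> v"
  shows "fibre_matchings n {u, v} = matching_of u v n ` {\<pi>. \<pi> permutes {1..n}}"
proof (intro equalityI subsetI)
  fix m assume "m \<in> matching_of u v n ` {\<pi>. \<pi> permutes {1..n}}"
  then obtain \<pi> where \<pi>: "\<pi> permutes {1..n}" "m = matching_of u v n \<pi>" by blast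
  have "m \<subseteq> {{a, b} | a b. a \<in> {u} \<times> {1..n} \<and> b \<in> {v} \<times> {1..n}}"
  proof
    fix f assume "f \<in> m"
    then obtain i where i: "i \<in> {1..n}" "f = {(u, i), (v, \<pi> i)}" by (auto simp: \<pi>(2) matching_of_def)
    moreover have "\<pi> i \<in> {1..n}" using permutes_in_image[OF \<pi>(1)] i by blast
    ultimately show "f \<in> {{a, b} | a b. a \<in> {u} \<times> {1..n} \<and> b \<in> {v} \<times> {1..n}}" by blast
  qed
  moreover have "\<exists>!f. f \<in> m \<and> x \<in> f" if x: "x \<in> {u} \<times> {1..n} \<union> {v} \<times> {1..n}" for x
  proof -
    consider i where "x = (u, i)" "i \<in> {1..n}" | j where "x = (v, j)" "j \<in> {1..n}"
      using x by auto
    then show ?thesis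
    proof cases
      case 1
      then show ?thesis using assms
        by (intro ex1I[of _ "{(u, i), (v, \<pi> i)}"]) (auto simp: \<pi>(2) matching_of_def)
    next
      case 2
      then have "j \<in> \<pi> ` {1..n}" by (simp only: permutes_image[OF \<pi>(1)])
      then obtain i where i: "j = \<pi> i" "i \<in> {1..n}" by (rule imageE)
      have u1: "f = {(u, i), (v, \<pi> i)}" if f: "f \<in> m" "x \<in> f" for f
      proof -
        have "f \<in> matching_of u v n \<pi>" using f(1) by (simp only: \<pi>(2))
        then obtain i' where i': "f = {(u, i'), (v, \<pi> i')}" "i' \<in> {1..n}" by (rule matching_ofE)
        have "(v, \<pi> i) \<in> {(u, i'), (v, \<pi> i')}" using f(2) by (simp only: 2(1) i(1) i'(1))
        then have "\<pi> i = \<pi> i'" using assms by simp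
        then have "i' = i" by (rule injD[OF permutes_inj[OF \<pi>(1)], symmetric])
        then show ?thesis using i' by simp
      qed
      have u2: "{(u, i), (v, \<pi> i)} \<in> m" using i(2) unfolding \<pi>(2) matching_of_def by (rule imageI)
      have u3: "x \<in> {(u, i), (v, \<pi> i)}" using 2 i by simp
      show ?thesis
      proof (rule ex1I)
        show "{(u, i), (v, \<pi> i)} \<in> m \<and> x \<in> {(u, i), (v, \<pi> i)}" using u2 u3 by (rule conjI)
        show "f = {(u, i), (v, \<pi> i)}" if "f \<in> m \<and> x \<in> f" for f
          using that by (elim conjE) (rule u1)
      qed
    qed
  qed
  ultimately show "m \<in> fibre_matchings n {u, v}"
    unfolding fibre_matchings_eq_between perfect_matchings_between_def by blast
next
  fix m assume "m \<in> fibre_matchings n {u, v}"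
  then have m: "m \<subseteq> {{a, b} | a b. a \<in> {u} \<times> {1..n} \<and> b \<in> {v} \<times> {1..n}}"
    and ex1: "\<And>x. x \<in> {u} \<times> {1..n} \<union> {v} \<times> {1..n} \<Longrightarrow> \<exists>!f. f \<in> m \<and> x \<in> f"
    unfolding fibre_matchings_eq_between perfect_matchings_between_def by blast+
  have uniq: "f = g" if x: "x \<in> {u} \<times> {1..n} \<union> {v} \<times> {1..n}"
    and fg: "f \<in> m" "x \<in> f" "g \<in> m" "x \<in> g" for f g x
  proof -
    obtain h where h: "\<forall>k. k \<in> m \<and> x \<in> k \<longrightarrow> k = h" using ex1[OF x] by (elim ex1E) blast
    have "f = h" "g = h" using h fg by blast+
    then show ?thesis by simp
  qed
  have mE: "\<exists>i\<in>{1..n}. \<exists>j\<in>{1..n}. f = {(u, i), (v, j)}" if f: "f \<in> m" for f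
    using m f by blast
  have partner: "\<exists>j\<in>{1..n}. {(u, i), (v, j)} \<in> m" if i: "i \<in> {1..n}" for i
  proof -
    obtain f where f: "f \<in> m" "(u, i) \<in> f" using ex1[of "(u, i)"] i by auto
    then show ?thesis using mE[OF f(1)] assms by auto
  qed
  \<comment> \<open>The identity outside \<open>{1..n}\<close> is what \<open>permutes\<close>
    demands.\<close>
  define \<pi> where "\<pi> i = (if i \<in> {1..n} then SOME j. j \<in> {1..n} \<and> {(u, i), (v, j)} \<in> m else i)" for i
  have \<pi>: "\<pi> i \<in> {1..n} \<and> {(u, i), (v, \<pi> i)} \<in> m" if i: "i \<in> {1..n}" for i
  proof -
    have "\<exists>j. j \<in> {1..n} \<and> {(u, i), (v, j)} \<in> m" using partner[OF i] by blast
    from someI_ex[OF this] show ?thesis using i by (simp add: \<pi>_def)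
  qed
  have inj: "inj_on \<pi> {1..n}"
  proof (rule inj_onI)
    fix i i' assume i: "i \<in> {1..n}" "i' \<in> {1..n}" "\<pi> i = \<pi> i'"
    have "{(u, i), (v, \<pi> i)} = {(u, i'), (v, \<pi> i)}"
      by (rule uniq[of "(v, \<pi> i)"]) (use \<pi>[OF i(1)] \<pi>[OF i(2)] i(3) in auto)
    then show "i = i'" using assms by (auto simp: doubleton_eq_iff)
  qed
  have "\<pi> ` {1..n} \<subseteq> {1..n}" using \<pi> by blast
  then have "\<pi> ` {1..n} = {1..n}" using endo_inj_surj inj by blast
  then have perm: "\<pi> permutes {1..n}"
    using inj by (intro bij_imp_permutes) (auto simp: bij_betw_def \<pi>_def)
  have "m = matching_of u v n \<pi>"
  proof (intro equalityI subsetI)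
    fix f assume f: "f \<in> m"
    then obtain i j where ij: "i \<in> {1..n}" "f = {(u, i), (v, j)}" using mE by blast
    have "f = {(u, i), (v, \<pi> i)}"
      by (rule uniq[of "(u, i)"]) (use \<pi>[OF ij(1)] f ij in auto)
    then show "f \<in> matching_of u v n \<pi>" using ij(1) by (auto simp: matching_of_def)
  next
    fix f assume "f \<in> matching_of u v n \<pi>"
    then show "f \<in> m" using \<pi> by (auto simp: matching_of_def)
  qed
  then show "m \<in> matching_of u v n ` {\<pi>. \<pi> permutes {1..n}}" using perm by blast
qed

lemma card_fibre_matchings:
  assumes "u \<noteq> v"
  shows "card (fibre_matchings n {u, v}) = fact n"
proof -
  have "inj_on (matching_of u v n) {\<pi>. \<pi> permutes {1..n}}"
  proof (rule inj_onI)
    fix \<pi> \<sigma> assume perm: "\<pi> \<in> {\<pi>. \<pi> permutes {1..n}}" "\<sigma> \<in> {\<pi>. \<pi> permutes {1..n}}"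
      and eq: "matching_of u v n \<pi> = matching_of u v n \<sigma>"
    show "\<pi> = \<sigma>"
    proof
      fix i show "\<pi> i = \<sigma> i"
      proof (cases "i \<in> {1..n}")
        case True
        then have "{(u, i), (v, \<pi> i)} \<in> matching_of u v n \<sigma>"
          unfolding eq[symmetric] by (auto simp: matching_of_def)
        then show ?thesis using pair_in_matching_of_iff[OF assms] by metis
      next
        case False
        then show ?thesis using perm by (auto simp: permutes_not_in)
      qed
    qed
  qed
  then show ?thesis
    unfolding fibre_matchings_eq[OF assms] by (simp add: card_image card_permutations)
qed

lemma card_permutations_extending:
  assumes "finite S" and P: "P \<subseteq> S \<times> S"
  shows "card {\<pi>. \<pi> permutes S \<and> (\<forall>(i, j)\<in>P. \<pi> i = j)} \<le> fact (card S - card P)" (is "card ?X \<le> _")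
proof (cases "?X = {}")
  case True
  then show ?thesis by (simp only: card.empty)
next
  case False
  then obtain \<pi>0 where \<pi>0: "\<pi>0 \<in> ?X" by blast
  have \<pi>0P: "\<pi>0 i = j" if "(i, j) \<in> P" for i j using \<pi>0 that by auto
  have finP: "finite P" using P assms(1) finite_subset[OF P] by simp
  have "inj_on fst P" 
  proof (rule inj_onI)
    fix p p' assume p: "p \<in> P" "p' \<in> P" "fst p = fst p'"
    have "\<pi>0 (fst p) = snd p" "\<pi>0 (fst p') = snd p'"
      using \<pi>0P[of "fst p" "snd p"] \<pi>0P[of "fst p'" "snd p'"] p(1,2) by simp_all
    then show "p = p'" using p(3) by (simp add: prod_eq_iff)
  qed
  then have cardD: "card (fst ` P) = card P" by (rule card_image)
  have "card ?X \<le> card {\<pi>. \<pi> permutes (S - fst ` P)}"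
  proof (rule card_inj_on_le)
    show "inj_on (\<lambda>\<pi>. inv_into UNIV \<pi>0 \<circ> \<pi>) ?X"
    proof (rule inj_onI)
      fix \<pi> \<sigma> assume "inv_into UNIV \<pi>0 \<circ> \<pi> = inv_into UNIV \<pi>0 \<circ> \<sigma>"
      then have "(\<pi>0 \<circ> inv_into UNIV \<pi>0) \<circ> \<pi> = (\<pi>0 \<circ> inv_into UNIV \<pi>0) \<circ> \<sigma>" by (simp add: comp_assoc)
      then show "\<pi> = \<sigma>" using permutes_inv_o(1)[of \<pi>0 S] \<pi>0 by simp
    qed
    show "(\<lambda>\<pi>. inv_into UNIV \<pi>0 \<circ> \<pi>) ` ?X \<subseteq> {\<pi>. \<pi> permutes (S - fst ` P)}"
    proof
      fix \<tau> assume "\<tau> \<in> (\<lambda>\<pi>. inv_into UNIV \<pi>0 \<circ> \<pi>) ` ?X"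
      then obtain \<pi> where \<pi>: "\<pi> \<in> ?X" "\<tau> = inv_into UNIV \<pi>0 \<circ> \<pi>" by blast
      have "\<tau> permutes S" using \<pi> \<pi>0 by (auto intro!: permutes_compose permutes_inv)
      moreover have "\<tau> x = x" if x: "x \<in> S - (S - fst ` P)" for x
      proof -
        obtain j where "(x, j) \<in> P" using x by auto
        then have "\<pi> x = \<pi>0 x" using \<pi>(1) \<pi>0 by auto
        moreover have "\<pi>0 permutes S" using \<pi>0 by simp
        ultimately show ?thesis using \<pi>(2) permutes_inverses(2)[of \<pi>0 S] by simp
      qed
      ultimately show "\<tau> \<in> {\<pi>. \<pi> permutes (S - fst ` P)}" using permutes_superset by blast
    qed
    show "finite {\<pi>. \<pi> permutes (S - fst ` P)}" using assms(1) by (simp add: finite_permutations)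
  qed
  also have "\<dots> = fact (card (S - fst ` P))"
    using assms(1) by (intro card_permutations) simp_all
  also have "card (S - fst ` P) = card S - card P"
    using P assms(1) cardD finP by (subst card_Diff_subset) auto
  finally show ?thesis .
qed

text \<open>The quotient of \<open>fact n\<close> by \<open>fact (n - k)\<close> has
  \<open>k\<close> factors, each at least \<open>n - N\<close>.\<close>

lemma fact_mult_power_le:
  assumes "k \<le> N" "N < n"
  shows "fact (n - k) * (n - N) ^ k \<le> (fact n :: nat)"
  using assms(1)
proof (induction k)
  case (Suc k)
  have "fact (n - Suc k) * (n - N) ^ Suc k = (n - N) * (fact (n - Suc k) * (n - N) ^ k)"
    by (simp add: mult_ac)
  also have "\<dots> \<le> (n - k) * (fact (n - Suc k) * (n - N) ^ k)"
    using Suc.prems by (intro mult_right_mono) simp_all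
  also have "\<dots> = fact (n - k) * (n - N) ^ k"
    using Suc.prems assms(2) by (subst fact_reduce[of "n - k"]) (simp_all add: Suc_diff_Suc mult_ac)
  also have "\<dots> \<le> fact n" using Suc by simp
  finally show ?case .
qed simp

text \<open>If some matching contains \<open>F\<close>, then \<open>F\<close> prescribes
  \<open>card F\<close> values of the permutation, which leaves at most
  \<open>fact (n - card F)\<close> of the \<open>fact n\<close> matchings.\<close>

lemma prob_subset_matching:
  assumes "u \<noteq> v" and "card F \<le> N" "N < n"
  shows "measure_pmf.prob (pmf_of_set (fibre_matchings n {u, v})) {m. F \<subseteq> m} \<le> (1 / real (n - N)) ^ card F"
proof -
  let ?M = "fibre_matchings n {u, v}"
  have fin: "finite ?M" by (intro finite_fibre_matchings) simp
  have ne: "?M \<noteq> {}" by (rule fibre_matchings_nonempty[OF assms(1)])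
  have prob: "measure_pmf.prob (pmf_of_set ?M) {m. F \<subseteq> m} = real (card (?M \<inter> {m. F \<subseteq> m})) / fact n"
    by (simp add: measure_pmf_of_set[OF ne fin] card_fibre_matchings[OF assms(1)])
  show ?thesis
  proof (cases "?M \<inter> {m. F \<subseteq> m} = {}")
    case True
    then show ?thesis by (simp add: prob)
  next
    case False
    define g where "g = (\<lambda>(i, j). {(u, i), (v, j :: nat)} :: ('a \<times> nat) set)"
    define P where "P = {p \<in> {1..n} \<times> {1..n}. g p \<in> F}"
    obtain m0 where m0: "m0 \<in> ?M" "F \<subseteq> m0" using False by blast
    obtain \<pi>0 where "m0 = matching_of u v n \<pi>0" "\<pi>0 \<in> {\<pi>. \<pi> permutes {1..n}}"
      using m0(1) unfolding fibre_matchings_eq[OF assms(1)] by (rule imageE)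
    then have \<pi>0: "\<pi>0 permutes {1..n}" "F \<subseteq> matching_of u v n \<pi>0" using m0(2) by simp_all
    have "F \<subseteq> g ` P"
    proof
      fix f assume f: "f \<in> F"
      obtain i where i: "f = {(u, i), (v, \<pi>0 i)}" "i \<in> {1..n}"
        by (rule matching_ofE[OF subsetD[OF \<pi>0(2) f]])
      moreover have "\<pi>0 i \<in> {1..n}" using permutes_in_image[OF \<pi>0(1), of i] i(2) by simp
      ultimately show "f \<in> g ` P" using f by (intro image_eqI[of _ _ "(i, \<pi>0 i)"]) (simp_all add: P_def g_def)
    qed
    then have F: "F = g ` P" by (auto simp: P_def)
    have "inj_on g P" using assms(1) by (auto simp: inj_on_def g_def doubleton_eq_iff)
    then have cardP: "card P = card F" using F by (simp add: card_image)
    have "?M \<inter> {m. F \<subseteq> m} \<subseteq> matching_of u v n ` {\<pi>. \<pi> permutes {1..n} \<and> (\<forall>(i, j)\<in>P. \<pi> i = j)}"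
    proof
      fix m assume m: "m \<in> ?M \<inter> {m. F \<subseteq> m}"
      then obtain \<pi> where \<pi>: "\<pi> permutes {1..n}" "m = matching_of u v n \<pi>"
        using fibre_matchings_eq[OF assms(1)] by auto
      have "\<pi> i = j" if "(i, j) \<in> P" for i j
      proof -
        have "{(u, i), (v, j)} \<in> matching_of u v n \<pi>" using that m \<pi>(2) by (auto simp: P_def g_def)
        then show ?thesis using pair_in_matching_of_iff[OF assms(1)] by metis
      qed
      then show "m \<in> matching_of u v n ` {\<pi>. \<pi> permutes {1..n} \<and> (\<forall>(i, j)\<in>P. \<pi> i = j)}"
        using \<pi> by blast
    qed
    then have "card (?M \<inter> {m. F \<subseteq> m}) \<le> card (matching_of u v n ` {\<pi>. \<pi> permutes {1..n} \<and> (\<forall>(i, j)\<in>P. \<pi> i = j)})"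
      by (intro card_mono) (simp_all add: finite_permutations)
    also have "\<dots> \<le> card {\<pi>. \<pi> permutes {1..n} \<and> (\<forall>(i, j)\<in>P. \<pi> i = j)}"
      by (intro card_image_le) (simp add: finite_permutations)
    also have "\<dots> \<le> fact (card {1..n} - card P)"
      by (rule card_permutations_extending) (auto simp: P_def)
    finally have le: "card (?M \<inter> {m. F \<subseteq> m}) \<le> fact (n - card F)" by (simp add: cardP)
    let ?b = "real (n - N) ^ card F"
    have b: "0 < ?b" using assms(3) by simp
    have "real (card (?M \<inter> {m. F \<subseteq> m})) \<le> real (fact (n - card F))" by (rule of_nat_mono[OF le])
    then have "real (card (?M \<inter> {m. F \<subseteq> m})) * ?b \<le> real (fact (n - card F)) * ?b"
      using b by (intro mult_right_mono) simp_all
    also have "\<dots> = real (fact (n - card F) * (n - N) ^ card F)" by (simp only: of_nat_mult of_nat_power)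
    also have "\<dots> \<le> real (fact n)" by (rule of_nat_mono[OF fact_mult_power_le[OF assms(2,3)]])
    finally have "real (card (?M \<inter> {m. F \<subseteq> m})) * ?b \<le> fact n" by (simp only: of_nat_fact)
    then have "real (card (?M \<inter> {m. F \<subseteq> m})) / fact n * ?b \<le> 1"
      by (simp add: pos_divide_le_eq)
    then show ?thesis
      unfolding prob power_one_over by (simp only: pos_le_divide_eq[OF b])
  qed
qed

section \<open>Edge sets contained in the random lift, and the union bound for the excess\<close>

lemma fibre_matching_elem:
  assumes "m \<in> fibre_matchings n {u, v}" "f \<in> m"
  obtains i j where "f = {(u, i), (v, j)}" "i \<in> {1..n}" "j \<in> {1..n}"
proof -
  have "f \<in> {{a, b} | a b. a \<in> {u} \<times> {1..n} \<and> b \<in> {v} \<times> {1..n}}"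
    using assms unfolding fibre_matchings_eq_between perfect_matchings_between_def by blast
  then obtain a b where "f = {a, b}" "a \<in> {u} \<times> {1..n}" "b \<in> {v} \<times> {1..n}" by blast
  then show thesis using that by (cases a; cases b) simp
qed

text \<open>The family of matchings before it is merged into a graph. Independence is available at
  this level; \<open>random_lift\<close> is the image under \<open>lift_graph\<close>.\<close>

definition lift_pmf :: "'v pair_pre_digraph \<Rightarrow> nat \<Rightarrow> ('v set \<Rightarrow> ('v \<times> nat) set set) pmf" where
  "lift_pmf Y n = Pi_pmf (uedges Y) {} (\<lambda>e. pmf_of_set (fibre_matchings n e))"

lemma finite_uedges: "finite (parcs Y) \<Longrightarrow> finite (uedges Y)"
  unfolding uedges_def by (rule finite_subset[of _ "(\<lambda>(u, v). {u, v}) ` parcs Y"]) auto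

context
  fixes Y :: "'v pair_pre_digraph"
  assumes Y: "pair_graph Y"
begin

interpretation Y: pair_graph Y by (rule Y)

lemma uedgesE:
  assumes "e \<in> uedges Y"
  obtains u v where "e = {u, v}" "u \<noteq> v" "(u, v) \<in> parcs Y" "u \<in> pverts Y" "v \<in> pverts Y"
proof -
  obtain u v where uv: "e = {u, v}" "(u, v) \<in> parcs Y"
    using assms unfolding uedges_def mem_Collect_eq by (elim exE conjE) (rule that)
  have "u \<noteq> v" using Y.no_loops'[of u v] uv(2) by simp
  then show thesis using that uv Y.in_arcsD1[OF uv(2)] Y.in_arcsD2[OF uv(2)] by simp
qed

lemma set_fibre_pmf:
  assumes "e \<in> uedges Y"
  shows "set_pmf (pmf_of_set (fibre_matchings n e)) = fibre_matchings n e"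
proof -
  obtain u v where "e = {u, v}" "u \<noteq> v" "(u, v) \<in> parcs Y" "u \<in> pverts Y" "v \<in> pverts Y"
    by (rule uedgesE[OF assms])
  then show ?thesis
    by (simp add: fibre_matchings_nonempty finite_fibre_matchings)
qed

lemma set_lift_pmf:
  assumes "M \<in> set_pmf (lift_pmf Y n)" "e \<in> uedges Y"
  shows "M e \<in> fibre_matchings n e"
  using assms set_fibre_pmf[OF assms(2)] finite_uedges[OF Y.pair_finite_arcs]
  by (auto simp: lift_pmf_def set_Pi_pmf PiE_dflt_def)

text \<open>Sort \<open>F\<close> by projection to the base graph: the class \<open>G e\<close> has
  to lie in the matching above \<open>e\<close>. These matchings are independent, so the bounds for
  the classes multiply.\<close>

lemma prob_lift_contains:
  assumes "finite F" "card F \<le> N" "N < n"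
  shows "measure_pmf.prob (lift_pmf Y n) {M. F \<subseteq> (\<Union>e\<in>uedges Y. M e)} \<le> (1 / real (n - N)) ^ card F"
proof -
  let ?E = "{M. F \<subseteq> (\<Union>e\<in>uedges Y. M e)}"
  define G where "G e = {f \<in> F. fst ` f = e}" for e
  have finE: "finite (uedges Y)" by (rule finite_uedges[OF Y.pair_finite_arcs])
  have proj: "fst ` f = e" if M: "M \<in> set_pmf (lift_pmf Y n)" "e \<in> uedges Y" "f \<in> M e" for M e f
  proof -
    obtain u v where uv: "e = {u, v}" "u \<noteq> v" "(u, v) \<in> parcs Y" "u \<in> pverts Y" "v \<in> pverts Y"
        by (rule uedgesE[OF M(2)])
    have "M e \<in> fibre_matchings n {u, v}" using set_lift_pmf[OF M(1,2)] by (simp only: uv)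
    then obtain i j where "f = {(u, i), (v, j)}" "i \<in> {1..n}" "j \<in> {1..n}"
      by (rule fibre_matching_elem[OF _ M(3)])
    then show ?thesis by (simp add: uv)
  qed
  show ?thesis
  proof (cases "F = (\<Union>e\<in>uedges Y. G e)")
    case False
    \<comment> \<open>Some element of \<open>F\<close> lies above no edge of \<open>Y\<close>, hence
      in no lift.\<close>
    have "?E \<inter> set_pmf (lift_pmf Y n) = {}"
    proof (rule ccontr)
      assume "?E \<inter> set_pmf (lift_pmf Y n) \<noteq> {}"
      then obtain M where M: "M \<in> set_pmf (lift_pmf Y n)" "F \<subseteq> (\<Union>e\<in>uedges Y. M e)" by blast
      have "F = (\<Union>e\<in>uedges Y. G e)"
      proof (intro equalityI subsetI)
        fix f assume "f \<in> F"
        then obtain e where e: "e \<in> uedges Y" "f \<in> M e" using M(2) by blast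
        have "f \<in> G e" using proj[OF M(1) e] \<open>f \<in> F\<close> by (simp add: G_def)
        then show "f \<in> (\<Union>e\<in>uedges Y. G e)" using e(1) by blast
      qed (auto simp: G_def)
      then show False using False by blast
    qed
    then have "measure_pmf.prob (lift_pmf Y n) ?E = 0"
      using measure_Int_set_pmf[of "lift_pmf Y n" ?E] by simp
    then show ?thesis by simp
  next
    case True
    have finG: "finite (G e)" for e using assms(1) by (simp add: G_def)
    have cardG: "card (G e) \<le> N" for e
      using assms(2) card_mono[OF assms(1), of "G e"] by (auto simp: G_def)
    have "measure_pmf.prob (lift_pmf Y n) ?E = measure_pmf.prob (lift_pmf Y n) (?E \<inter> set_pmf (lift_pmf Y n))"
      by (simp add: measure_Int_set_pmf)
    also have "\<dots> \<le> measure_pmf.prob (lift_pmf Y n) (Pi (uedges Y) (\<lambda>e. {m. G e \<subseteq> m}))"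
    proof (rule measure_pmf.finite_measure_mono)
      show "?E \<inter> set_pmf (lift_pmf Y n) \<subseteq> Pi (uedges Y) (\<lambda>e. {m. G e \<subseteq> m})"
      proof (rule subsetI, rule Pi_I, rule CollectI, rule subsetI)
        fix M e f assume M: "M \<in> ?E \<inter> set_pmf (lift_pmf Y n)" and f: "f \<in> G e"
        have MS: "M \<in> set_pmf (lift_pmf Y n)" and MF: "F \<subseteq> (\<Union>e\<in>uedges Y. M e)" using M by simp_all
        have fF: "f \<in> F" "fst ` f = e" using f by (simp_all add: G_def)
        obtain e' where e': "e' \<in> uedges Y" "f \<in> M e'" using MF fF(1) by blast
        have "e' = e" using proj[OF MS e'] fF(2) by simp
        then show "f \<in> M e" using e'(2) by simp
      qed
    qed simp
    also have "\<dots> = (\<Prod>e\<in>uedges Y. measure_pmf.prob (pmf_of_set (fibre_matchings n e)) {m. G e \<subseteq> m})"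
      unfolding lift_pmf_def by (rule measure_Pi_pmf_Pi[OF finE])
    also have "\<dots> \<le> (\<Prod>e\<in>uedges Y. (1 / real (n - N)) ^ card (G e))"
    proof (rule prod_mono, intro conjI)
      fix e assume e: "e \<in> uedges Y"
      obtain u v where "e = {u, v}" "u \<noteq> v" "(u, v) \<in> parcs Y" "u \<in> pverts Y" "v \<in> pverts Y"
        by (rule uedgesE[OF e])
      then show "measure_pmf.prob (pmf_of_set (fibre_matchings n e)) {m. G e \<subseteq> m} \<le> (1 / real (n - N)) ^ card (G e)"
        using prob_subset_matching[of u v "G e" N n] cardG assms(3) by simp
    qed simp
    also have "\<dots> = (1 / real (n - N)) ^ (\<Sum>e\<in>uedges Y. card (G e))"
      by (simp add: power_sum)
    also have "(\<Sum>e\<in>uedges Y. card (G e)) = card F"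
    proof -
      have "card (\<Union>e\<in>uedges Y. G e) = (\<Sum>e\<in>uedges Y. card (G e))"
        using finE finG by (intro card_UN_disjoint) (auto simp: G_def)
      then show ?thesis using True by simp
    qed
    finally show ?thesis .
  qed
qed

text \<open>A violation is witnessed by \<open>v\<close> vertices carrying \<open>k\<close> edges
  with \<open>v + c + 1 \<le> k \<le> N\<close>. The union bound runs over \<open>v\<close> and
  \<open>k\<close>, at most \<open>N + 1\<close> values each, over vertex sets \<open>T\<close>, and
  over \<open>k\<close>-sets of the at most \<open>N ^ 2\<close> pairs in \<open>T\<close>.\<close>

lemma prob_excess:
  assumes "0 < N" and n: "2 * N \<le> n" and V: "0 < card (pverts Y)"
  shows "measure_pmf.prob (random_lift Y n) {L. \<not> excess_le (parcs L) N c}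
    \<le> real (N + 1) ^ 2 * (2 * real (card (pverts Y)) * real N ^ 2) ^ N * (2 / real n) ^ (c + 1)"
proof -
  define U where "U = pverts Y \<times> {1..n}"
  define E where "E F = {M. F \<subseteq> (\<Union>e\<in>uedges Y. M e)}" for F :: "('v \<times> nat) set set"
  define pairs where "pairs T = (\<lambda>(x, y). {x, y}) ` (T \<times> T)" for T :: "('v \<times> nat) set"
  define TT where "TT v = {T. T \<subseteq> U \<and> card T = v}" for v
  define G where "G T k = {F. F \<subseteq> pairs T \<and> card F = k}" for T k
  define y where "y = 1 / real (n - N)"
  let ?P = "measure_pmf.prob (lift_pmf Y n)"
  have finU: "finite U" using Y.pair_finite_verts by (simp add: U_def)
  have cardU: "card U = card (pverts Y) * n" by (simp add: U_def)
  have finT: "finite T" if "T \<in> TT v" for T v using that finU by (auto simp: TT_def intro: finite_subset)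
  have finTT: "finite (TT v)" for v using finU by (simp add: TT_def)
  have fin_pairs: "finite (pairs T)" if "finite T" for T using that by (simp add: pairs_def)
  have card_pairs: "card (pairs T) \<le> (card T)\<^sup>2" if "finite T" for T
    using card_image_le[of "T \<times> T" "\<lambda>(x, y). {x, y}"] that by (simp add: pairs_def power2_eq_square)
  have N: "N < n" using assms by simp
  \<comment> \<open>This uses \<open>2 * N \<le> n\<close>; both factors 2 of the final bound come
    from here.\<close>
  have y: "0 \<le> y" "y \<le> 1" "y \<le> 2 / real n" using assms N by (auto simp: y_def field_simps)
  have cardG: "card (G T k) \<le> ((card T)\<^sup>2) ^ k" if "finite T" for T k
  proof (cases "k \<le> card (pairs T)")
    case True
    have "card (G T k) = card (pairs T) choose k"
      unfolding G_def by (rule n_subsets[OF fin_pairs[OF that]])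
    also have "\<dots> \<le> card (pairs T) ^ k" by (rule binomial_le_pow[OF True])
    also have "\<dots> \<le> ((card T)\<^sup>2) ^ k" by (rule power_mono[OF card_pairs[OF that]]) simp
    finally show ?thesis .
  next
    case False
    then have "G T k = {}"
      unfolding G_def using card_mono[OF fin_pairs[OF that]] by auto
    then show ?thesis by simp
  qed
  have finG: "finite (G T k)" if "finite T" for T k
    using fin_pairs[OF that] by (simp add: G_def)
  have finF: "finite F" if "F \<in> G T k" "finite T" for F T k
    using that fin_pairs by (auto simp: G_def intro: finite_subset)
  let ?B = "\<Union>v\<in>{..N}. \<Union>k\<in>{v + c + 1..N}. \<Union>T\<in>TT v. \<Union>F\<in>G T k. E F"
  have sub: "lift_graph Y n -` {L. \<not> excess_le (parcs L) N c} \<inter> set_pmf (lift_pmf Y n) \<subseteq> ?B"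
  proof (rule subsetI)
    fix M assume M: "M \<in> lift_graph Y n -` {L. \<not> excess_le (parcs L) N c} \<inter> set_pmf (lift_pmf Y n)"
    have MS: "M e \<in> fibre_matchings n e" if "e \<in> uedges Y" for e
      by (rule set_lift_pmf[OF IntD2[OF M] that])
    have "\<not> excess_le (parcs (lift_graph Y n M)) N c" using IntD1[OF M] by simp
    then obtain F where F: "F \<subseteq> uedge ` parcs (lift_graph Y n M)" "card F \<le> N" "card (\<Union>F) + c < card F"
      unfolding excess_le_def not_all not_imp not_le by blast
    have FM: "F \<subseteq> (\<Union>e\<in>uedges Y. M e)"
    proof
      fix f assume f: "f \<in> F"
      obtain a where a: "f = uedge a" "a \<in> parcs (lift_graph Y n M)"
        by (rule imageE[OF subsetD[OF F(1) f]])
      have "uedge a \<in> (\<Union>e\<in>uedges Y. M e)"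
        using a(2) by (cases a) (simp add: lift_graph_def uedge_def)
      then show "f \<in> (\<Union>e\<in>uedges Y. M e)" by (simp only: a(1))
    qed
    have el: "\<exists>x y. f = {x, y} \<and> x \<in> U \<and> y \<in> U" if f: "f \<in> F" for f
    proof -
      obtain e where e: "e \<in> uedges Y" "f \<in> M e" by (rule UN_E[OF subsetD[OF FM f]])
      obtain u v where uv: "e = {u, v}" "u \<noteq> v" "(u, v) \<in> parcs Y" "u \<in> pverts Y" "v \<in> pverts Y"
        by (rule uedgesE[OF e(1)])
      have "M e \<in> fibre_matchings n {u, v}" using MS[OF e(1)] by (simp only: uv)
      then obtain i j where "f = {(u, i), (v, j)}" "i \<in> {1..n}" "j \<in> {1..n}"
        by (rule fibre_matching_elem[OF _ e(2)])
      then show ?thesis using uv(4,5) by (intro exI[of _ "(u, i)"] exI[of _ "(v, j)"]) (simp add: U_def)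
    qed
    have UF: "\<Union>F \<subseteq> U" using el by blast
    have "F \<subseteq> pairs (\<Union>F)"
    proof
      fix f assume f: "f \<in> F"
      then obtain x y where "f = {x, y}" using el by blast
      then show "f \<in> pairs (\<Union>F)" using f unfolding pairs_def by (intro image_eqI[of _ _ "(x, y)"]) auto
    qed
    then have "M \<in> E F" "F \<in> G (\<Union>F) (card F)" "\<Union>F \<in> TT (card (\<Union>F))"
      using FM UF by (auto simp: E_def G_def TT_def)
    moreover have "card (\<Union>F) \<in> {..N}" "card F \<in> {card (\<Union>F) + c + 1..N}" using F by simp_all
    ultimately show "M \<in> ?B" by blast
  qed
  have EF: "?P (E F) \<le> y ^ k" if "F \<in> G T k" "finite T" "k \<le> N" for F T k
    using prob_lift_contains[of F N n] finF[OF that(1,2)] that N by (simp add: E_def G_def y_def)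
  define b where "b = (2 * real (card (pverts Y)) * real N ^ 2) ^ N * (2 / real n) ^ (c + 1)"
  have main: "?P (\<Union>T\<in>TT v. \<Union>F\<in>G T k. E F) \<le> b" if vk: "v \<le> N" "v + c + 1 \<le> k" "k \<le> N" for v k
  proof -
    have "?P (\<Union>T\<in>TT v. \<Union>F\<in>G T k. E F) \<le> (\<Sum>T\<in>TT v. ?P (\<Union>F\<in>G T k. E F))"
      by (rule measure_UNION_le[OF finTT]) simp
    also have "\<dots> \<le> (\<Sum>T\<in>TT v. real (v\<^sup>2) ^ k * y ^ k)"
    proof (rule sum_mono)
      fix T assume T: "T \<in> TT v"
      have "?P (\<Union>F\<in>G T k. E F) \<le> (\<Sum>F\<in>G T k. ?P (E F))"
        by (rule measure_UNION_le[OF finG[OF finT[OF T]]]) simp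
      also have "\<dots> \<le> (\<Sum>F\<in>G T k. y ^ k)"
        using EF finT[OF T] vk by (intro sum_mono) blast
      also have "\<dots> = real (card (G T k)) * y ^ k" by simp
      also have "\<dots> \<le> real (v\<^sup>2) ^ k * y ^ k"
        using cardG[OF finT[OF T], of k] T y(1)
        by (intro mult_right_mono) (auto simp: TT_def simp flip: of_nat_power)
      finally show "?P (\<Union>F\<in>G T k. E F) \<le> real (v\<^sup>2) ^ k * y ^ k" .
    qed
    also have "\<dots> = real (card (TT v)) * (real (v\<^sup>2) ^ k * y ^ k)" by simp
    also have "\<dots> \<le> real (card U) ^ v * ((real N ^ 2) ^ N * y ^ (v + c + 1))"
    proof (intro mult_mono)
      have "card (TT v) = card U choose v" unfolding TT_def by (rule n_subsets[OF finU])
      also have "\<dots> \<le> card U ^ v"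
        by (cases "v \<le> card U") (auto simp: binomial_le_pow binomial_eq_0)
      finally show "real (card (TT v)) \<le> real (card U) ^ v" by (simp flip: of_nat_power)
      have "real (v\<^sup>2) ^ k \<le> (real N ^ 2) ^ k" using vk by (intro power_mono) simp_all
      also have "\<dots> \<le> (real N ^ 2) ^ N" using vk assms(1) by (intro power_increasing) simp_all
      finally show "real (v\<^sup>2) ^ k \<le> (real N ^ 2) ^ N" .
      show "y ^ k \<le> y ^ (v + c + 1)" using vk y by (intro power_decreasing) simp_all
    qed (use y in auto)
    \<comment> \<open>Of the \<open>v + c + 1\<close> powers of \<open>y\<close>, \<open>v\<close>
      cancel the choices of fibre indices for the \<open>v\<close> vertices; the remaining
      \<open>c + 1\<close> make the event unlikely.\<close>
    also have "\<dots> = (real (card (pverts Y)) * (real n * y)) ^ v * (real N ^ 2) ^ N * y ^ (c + 1)"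
      by (simp add: cardU power_add power_mult_distrib mult_ac)
    also have "\<dots> \<le> (real (card (pverts Y)) * 2) ^ N * (real N ^ 2) ^ N * (2 / real n) ^ (c + 1)"
    proof (intro mult_mono power_mono)
      have "real n * y \<le> 2" using y(3) N by (simp add: field_simps)
      then have "(real (card (pverts Y)) * (real n * y)) ^ v \<le> (real (card (pverts Y)) * 2) ^ v"
        using y(1) by (intro power_mono mult_left_mono) simp_all
      also have "\<dots> \<le> (real (card (pverts Y)) * 2) ^ N"
        using V vk by (intro power_increasing) simp_all
      finally show "(real (card (pverts Y)) * (real n * y)) ^ v \<le> (real (card (pverts Y)) * 2) ^ N" .
    qed (use y in auto)
    finally show ?thesis by (simp add: b_def power_mult_distrib mult_ac)
  qed
  have b0: "0 \<le> b" by (simp add: b_def)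
  have "measure_pmf.prob (random_lift Y n) {L. \<not> excess_le (parcs L) N c}
      = ?P (lift_graph Y n -` {L. \<not> excess_le (parcs L) N c} \<inter> set_pmf (lift_pmf Y n))"
    by (simp add: random_lift_def lift_pmf_def measure_Int_set_pmf)
  also have "\<dots> \<le> ?P ?B" by (rule measure_pmf.finite_measure_mono[OF sub]) simp
  also have "\<dots> \<le> (\<Sum>v\<in>{..N}. ?P (\<Union>k\<in>{v + c + 1..N}. \<Union>T\<in>TT v. \<Union>F\<in>G T k. E F))"
    by (rule measure_UNION_le) simp_all
  also have "\<dots> \<le> (\<Sum>v\<in>{..N}. \<Sum>k\<in>{v + c + 1..N}. ?P (\<Union>T\<in>TT v. \<Union>F\<in>G T k. E F))"
    by (intro sum_mono measure_UNION_le) simp_all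
  also have "\<dots> \<le> (\<Sum>v\<in>{..N}. \<Sum>k\<in>{v + c + 1..N}. b)"
    using main by (intro sum_mono) simp
  also have "\<dots> \<le> (\<Sum>v\<in>{..N}. real (N + 1) * b)"
    using b0 by (intro sum_mono) (auto intro!: mult_right_mono)
  also have "\<dots> = real (N + 1) ^ 2 * b" by (simp add: power2_eq_square algebra_simps)
  finally show ?thesis by (simp add: b_def mult_ac)
qed

end

section \<open>Hikes and powers of the non-backtracking matrix\<close>

text \<open>Matrices are real but vectors complex, because \<open>B\<close> is not symmetric and its
  eigenvectors need not be real.\<close>

definition mat_app :: "('a \<Rightarrow> 'a \<Rightarrow> real) \<Rightarrow> 'a set \<Rightarrow> ('a \<Rightarrow> complex) \<Rightarrow> 'a \<Rightarrow> complex" where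
  "mat_app M A g a = (\<Sum>b\<in>A. of_real (M a b) * g b)"

primrec mat_power :: "('a \<Rightarrow> 'a \<Rightarrow> real) \<Rightarrow> 'a set \<Rightarrow> nat \<Rightarrow> 'a \<Rightarrow> 'a \<Rightarrow> real" where
  "mat_power M A 0 a b = (if a = b then 1 else 0)"
| "mat_power M A (Suc k) a b = (\<Sum>c\<in>A. M a c * mat_power M A k c b)"

definition norm2 :: "'a set \<Rightarrow> ('a \<Rightarrow> complex) \<Rightarrow> real" where
  "norm2 A g = (\<Sum>a\<in>A. (cmod (g a))\<^sup>2)"

lemma norm2_nonneg: "0 \<le> norm2 A g"
  by (simp add: norm2_def sum_nonneg)

lemma mat_power_add:
  assumes "finite A" "a \<in> A"
  shows "mat_power M A (i + j) a b = (\<Sum>c\<in>A. mat_power M A i a c * mat_power M A j c b)"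
  using assms(2)
proof (induction i arbitrary: a)
  case 0
  have "(\<Sum>c\<in>A. (if a = c then 1 else 0) * mat_power M A j c b)
      = (\<Sum>c\<in>A. if a = c then mat_power M A j c b else 0)"
    by (intro sum.cong) simp_all
  then show ?case using 0 assms(1) by simp
next
  case (Suc i)
  have "mat_power M A (Suc i + j) a b
      = (\<Sum>d\<in>A. M a d * (\<Sum>c\<in>A. mat_power M A i d c * mat_power M A j c b))"
    using Suc.IH by simp
  also have "\<dots> = (\<Sum>d\<in>A. \<Sum>c\<in>A. M a d * mat_power M A i d c * mat_power M A j c b)"
    by (simp add: sum_distrib_left mult.assoc)
  also have "\<dots> = (\<Sum>c\<in>A. \<Sum>d\<in>A. M a d * mat_power M A i d c * mat_power M A j c b)"
    by (rule sum.swap)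
  also have "\<dots> = (\<Sum>c\<in>A. mat_power M A (Suc i) a c * mat_power M A j c b)"
    by (simp add: sum_distrib_right)
  finally show ?case .
qed

lemma mat_power_symmetric:
  assumes "finite A" and sym: "\<And>a b. a \<in> A \<Longrightarrow> b \<in> A \<Longrightarrow> M a b = M b a"
    and "a \<in> A" "b \<in> A"
  shows "mat_power M A k a b = mat_power M A k b a"
  using assms(3,4)
proof (induction k arbitrary: a b)
  case (Suc k)
  have one: "mat_power M A 1 c b = M c b" if "c \<in> A" for c
  proof -
    have "mat_power M A 1 c b = (\<Sum>d\<in>A. if d = b then M c d else 0)"
      unfolding One_nat_def mat_power.simps by (intro sum.cong) simp_all
    then show ?thesis using assms(1) Suc.prems by simp
  qed
  have "mat_power M A (Suc k) a b = (\<Sum>c\<in>A. mat_power M A k a c * mat_power M A 1 c b)"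
    using mat_power_add[OF assms(1) Suc.prems(1), of M k 1 b] by simp
  also have "\<dots> = (\<Sum>c\<in>A. M b c * mat_power M A k c a)"
    using Suc one sym by (intro sum.cong) (simp_all add: mult.commute)
  finally show ?case by simp
qed simp

lemma mat_app_power:
  assumes "finite A" "a \<in> A"
  shows "(mat_app M A ^^ k) g a = (\<Sum>b\<in>A. of_real (mat_power M A k a b) * g b)"
  using assms(2)
proof (induction k arbitrary: a)
  case 0
  have "(\<Sum>b\<in>A. complex_of_real (if a = b then 1 else 0) * g b) = (\<Sum>b\<in>A. if a = b then g b else 0)"
    by (intro sum.cong) simp_all
  then show ?case using 0 assms(1) by simp
next
  case (Suc k)
  have "(mat_app M A ^^ Suc k) g a = (\<Sum>c\<in>A. of_real (M a c) * (mat_app M A ^^ k) g c)"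
    by (simp add: mat_app_def[of M A "(mat_app M A ^^ k) g"])
  also have "\<dots> = (\<Sum>c\<in>A. of_real (M a c) * (\<Sum>b\<in>A. of_real (mat_power M A k c b) * g b))"
    using Suc.IH by (intro sum.cong) simp_all
  also have "\<dots> = (\<Sum>c\<in>A. \<Sum>b\<in>A. of_real (M a c * mat_power M A k c b) * g b)"
    by (simp add: sum_distrib_left mult.assoc)
  also have "\<dots> = (\<Sum>b\<in>A. \<Sum>c\<in>A. of_real (M a c * mat_power M A k c b) * g b)"
    by (rule sum.swap)
  also have "\<dots> = (\<Sum>b\<in>A. of_real (mat_power M A (Suc k) a b) * g b)"
    by (simp add: sum_distrib_right)
  finally show ?case .
qed

lemma norm_sum_mult_le:
  fixes x y :: "'a \<Rightarrow> complex"
  shows "(cmod (\<Sum>b\<in>A. x b * y b))\<^sup>2 \<le> (\<Sum>b\<in>A. (cmod (x b))\<^sup>2) * (\<Sum>b\<in>A. (cmod (y b))\<^sup>2)"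
proof -
  have "cmod (\<Sum>b\<in>A. x b * y b) \<le> (\<Sum>b\<in>A. cmod (x b) * cmod (y b))"
    by (rule order.trans[OF norm_sum]) (simp add: norm_mult)
  then have "(cmod (\<Sum>b\<in>A. x b * y b))\<^sup>2 \<le> (\<Sum>b\<in>A. cmod (x b) * cmod (y b))\<^sup>2"
    by (intro power_mono) simp_all
  also have "\<dots> \<le> (\<Sum>b\<in>A. (cmod (x b))\<^sup>2) * (\<Sum>b\<in>A. (cmod (y b))\<^sup>2)"
    by (rule Cauchy_Schwarz_ineq_sum)
  finally show ?thesis .
qed

text \<open>By symmetry the squared norm of \<open>M g\<close> is the inner product of
  \<open>g\<close> with \<open>M (M g)\<close>, to which Cauchy-Schwarz applies.\<close>

lemma norm2_log_convex:
  assumes sym: "\<And>a b. a \<in> A \<Longrightarrow> b \<in> A \<Longrightarrow> M a b = M b a"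
  shows "(norm2 A (mat_app M A g))\<^sup>2 \<le> norm2 A g * norm2 A (mat_app M A (mat_app M A g))"
proof -
  let ?h = "mat_app M A g" and ?k = "mat_app M A (mat_app M A g)"
  have "of_real (norm2 A ?h) = (\<Sum>a\<in>A. cnj (?h a) * ?h a)"
    by (simp add: norm2_def complex_norm_square mult.commute del: of_real_power)
  also have "\<dots> = (\<Sum>a\<in>A. \<Sum>b\<in>A. cnj (?h a) * (of_real (M a b) * g b))"
    by (simp add: mat_app_def[of M A g] sum_distrib_left)
  also have "\<dots> = (\<Sum>b\<in>A. \<Sum>a\<in>A. cnj (?h a) * (of_real (M a b) * g b))"
    by (rule sum.swap)
  also have "\<dots> = (\<Sum>b\<in>A. \<Sum>a\<in>A. cnj (of_real (M b a) * ?h a) * g b)"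
    using sym by (intro sum.cong) (simp_all add: mult_ac)
  also have "\<dots> = (\<Sum>b\<in>A. cnj (?k b) * g b)"
    by (simp add: mat_app_def[of M A ?h] sum_distrib_right)
  finally have "norm2 A ?h = cmod (\<Sum>b\<in>A. cnj (?k b) * g b)"
    using norm2_nonneg[of A ?h] by (metis norm_of_real abs_of_nonneg)
  then have "(norm2 A ?h)\<^sup>2 = (cmod (\<Sum>b\<in>A. cnj (?k b) * g b))\<^sup>2" by (simp only:)
  also have "\<dots> \<le> (\<Sum>b\<in>A. (cmod (cnj (?k b)))\<^sup>2) * (\<Sum>b\<in>A. (cmod (g b))\<^sup>2)"
    by (rule norm_sum_mult_le)
  finally show ?thesis by (simp add: norm2_def mult.commute)
qed

text \<open>Works without diagonalising \<open>M\<close>: the squared norms of the iterates of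
  \<open>g\<close> are log-convex, so the growth factor \<open>c\<close> of the first step persists
  in all later ones. No eigenvector of \<open>M\<close> is required, only one vector that
  \<open>M\<close> stretches enough.\<close>

lemma power_le_trace:
  assumes "finite A" and sym: "\<And>a b. a \<in> A \<Longrightarrow> b \<in> A \<Longrightarrow> M a b = M b a"
    and "0 \<le> c" and pos: "0 < norm2 A g" and ge: "c * norm2 A g \<le> norm2 A (mat_app M A g)"
  shows "c ^ m \<le> (\<Sum>a\<in>A. mat_power M A (2 * m) a a)"
proof -
  define u where "u k = norm2 A ((mat_app M A ^^ k) g)" for k
  have u0: "0 \<le> u k" for k by (simp add: u_def norm2_nonneg)
  have convex: "(u (Suc k))\<^sup>2 \<le> u k * u (Suc (Suc k))" for k
    using norm2_log_convex[OF sym, where g = "(mat_app M A ^^ k) g"] by (simp add: u_def)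
  have ratio: "c * u k \<le> u (Suc k)" for k
  proof (induction k)
    case 0
    then show ?case using ge by (simp add: u_def)
  next
    case (Suc k)
    show ?case
    \<comment> \<open>Log-convexity passes the ratio on after division by \<open>u k\<close>; if
      \<open>u k\<close> vanishes, so does \<open>u (Suc k)\<close>.\<close>
    proof (cases "u k = 0")
      case True
      then have "u (Suc k) = 0" using convex[of k] by simp
      then show ?thesis using u0[of "Suc (Suc k)"] by simp
    next
      case False
      then have pos: "0 < u k" using u0[of k] by simp
      have "u k * (c * u (Suc k)) = (c * u k) * u (Suc k)" by simp
      also have "\<dots> \<le> u (Suc k) * u (Suc k)" using Suc u0 by (intro mult_right_mono)
      also have "\<dots> \<le> u k * u (Suc (Suc k))" using convex[of k] by (simp add: power2_eq_square)
      finally show ?thesis using pos by simp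
    qed
  qed
  have lower: "c ^ k * u 0 \<le> u k" for k
  proof (induction k)
    case (Suc k)
    have "c ^ Suc k * u 0 = c * (c ^ k * u 0)" by simp
    also have "\<dots> \<le> c * u k" using Suc assms(3) by (intro mult_left_mono)
    also have "\<dots> \<le> u (Suc k)" by (rule ratio)
    finally show ?case .
  qed simp
  \<comment> \<open>Cauchy-Schwarz in each row bounds the iterate by the sum of the squared entries
    of the \<open>m\<close>-th power, which by symmetry is the trace of the power
    \<open>2 * m\<close>.\<close>
  have "u m \<le> (\<Sum>a\<in>A. (\<Sum>b\<in>A. (mat_power M A m a b)\<^sup>2) * norm2 A g)"
    unfolding u_def norm2_def[of A "(mat_app M A ^^ m) g"]
  proof (rule sum_mono)
    fix a assume "a \<in> A"
    have "(cmod ((mat_app M A ^^ m) g a))\<^sup>2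
        = (cmod (\<Sum>b\<in>A. complex_of_real (mat_power M A m a b) * g b))\<^sup>2"
      using mat_app_power[OF assms(1) \<open>a \<in> A\<close>] by simp
    also have "\<dots> \<le> (\<Sum>b\<in>A. (cmod (complex_of_real (mat_power M A m a b)))\<^sup>2) * (\<Sum>b\<in>A. (cmod (g b))\<^sup>2)"
      by (rule norm_sum_mult_le)
    finally show "(cmod ((mat_app M A ^^ m) g a))\<^sup>2 \<le> (\<Sum>b\<in>A. (mat_power M A m a b)\<^sup>2) * norm2 A g"
      by (simp add: norm2_def)
  qed
  also have "\<dots> = (\<Sum>a\<in>A. mat_power M A (2 * m) a a) * norm2 A g"
    unfolding sum_distrib_right[symmetric]
  proof (intro arg_cong2[of _ _ _ _ "(*)"] sum.cong refl)
    fix a assume "a \<in> A"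
    have "(\<Sum>b\<in>A. (mat_power M A m a b)\<^sup>2) = (\<Sum>b\<in>A. mat_power M A m a b * mat_power M A m b a)"
    proof (rule sum.cong[OF refl])
      fix b assume "b \<in> A"
      show "(mat_power M A m a b)\<^sup>2 = mat_power M A m a b * mat_power M A m b a"
        unfolding power2_eq_square
        using mat_power_symmetric[of A M a b m] assms(1) sym \<open>a \<in> A\<close> \<open>b \<in> A\<close> by simp
    qed
    also have "\<dots> = mat_power M A (m + m) a a"
      by (rule mat_power_add[OF assms(1) \<open>a \<in> A\<close>, symmetric])
    finally show "(\<Sum>b\<in>A. (mat_power M A m a b)\<^sup>2) = mat_power M A (2 * m) a a" by (simp add: mult_2)
  qed
  finally have "c ^ m * norm2 A g \<le> (\<Sum>a\<in>A. mat_power M A (2 * m) a a) * norm2 A g"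
    using lower[of m] by (simp add: u_def)
  then show ?thesis using pos by simp
qed

section \<open>Expansion of matrix powers into signed walks and hikes\<close>

definition nb_paths :: "('w \<times> 'w) set \<Rightarrow> nat \<Rightarrow> 'w \<times> 'w \<Rightarrow> 'w \<times> 'w \<Rightarrow> ('w \<times> 'w) list set" where
  "nb_paths A q a b = {p \<in> nb_walks A q. p \<noteq> [] \<and> hd p = a \<and> last p = b}"

definition nb_extensions :: "('w \<times> 'w) set \<Rightarrow> nat \<Rightarrow> 'w \<times> 'w \<Rightarrow> ('w \<times> 'w) list set" where
  "nb_extensions A q a = {p \<in> nb_walks A q. p \<noteq> [] \<and> hd p = a}"

definition walk_sign :: "('w \<times> 'w \<Rightarrow> real) \<Rightarrow> ('w \<times> 'w) list \<Rightarrow> real" where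
  "walk_sign \<sigma> p = prod_list (map \<sigma> p)"

lemma walk_sign_simps [simp]:
  "walk_sign \<sigma> [] = 1" "walk_sign \<sigma> (a # p) = \<sigma> a * walk_sign \<sigma> p"
  "walk_sign \<sigma> (p @ p') = walk_sign \<sigma> p * walk_sign \<sigma> p'"
  by (simp_all add: walk_sign_def)

lemma finite_nb_paths: "finite A \<Longrightarrow> finite (nb_paths A q a b)"
  using finite_nb_walks[of A q] by (auto simp: nb_paths_def)

lemma finite_nb_extensions: "finite A \<Longrightarrow> finite (nb_extensions A q a)"
  using finite_nb_walks[of A q] by (auto simp: nb_extensions_def)

lemma nb_extensions_1: "a \<in> A \<Longrightarrow> nb_extensions A (Suc 0) a = {[a]}"
  by (auto simp: nb_extensions_def nb_walks_def length_Suc_conv)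

lemma nb_extensions_Suc:
  assumes "a \<in> A"
  shows "nb_extensions A (Suc (Suc k)) a
    = (\<Union>b\<in>{b \<in> A. nb_step a b}. (#) a ` nb_extensions A (Suc k) b)" (is "?L = ?R")
proof (intro equalityI subsetI)
  fix p assume "p \<in> ?L"
  then obtain b r where p: "p = a # b # r" "length r = k" "a \<in> A" "b \<in> A" "set r \<subseteq> A"
    "nb_step a b" "successively nb_step (b # r)"
    by (auto simp: nb_extensions_def nb_walks_def length_Suc_conv successively_Cons)
  then have "b # r \<in> nb_extensions A (Suc k) b" by (simp add: nb_extensions_def nb_walks_def)
  then have "p \<in> (#) a ` nb_extensions A (Suc k) b" unfolding p(1) by (rule imageI)
  then show "p \<in> ?R" using p by (intro UN_I[of b]) simp_all
next
  fix p assume "p \<in> ?R"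
  then obtain b r where "b \<in> A" "nb_step a b" "r \<in> nb_extensions A (Suc k) b" "p = a # r" by blast
  then show "p \<in> ?L"
    using assms by (auto simp: nb_extensions_def nb_walks_def successively_Cons)
qed

text \<open>The row of \<open>B\<close> at an arc carries the sign of that arc. Hence
  \<open>k\<close> applications of \<open>B\<close> collect the signs of the first \<open>k\<close>
  arcs of a walk and evaluate \<open>f\<close> at its last arc, whose sign is left out by
  \<open>butlast\<close>.\<close>

lemma eigenvector_iterate:
  fixes f :: "'w \<times> 'w \<Rightarrow> complex"
  assumes "finite A"
    and eig: "\<And>a. a \<in> A \<Longrightarrow> (\<Sum>b\<in>{b \<in> A. nb_step a b}. of_real (\<sigma> a) * f b) = z * f a"
    and "a \<in> A"
  shows "(\<Sum>p\<in>nb_extensions A (Suc k) a. of_real (walk_sign \<sigma> (butlast p)) * f (last p)) = z ^ k * f a"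
  using assms(3)
proof (induction k arbitrary: a)
  case 0
  then show ?case by (simp add: nb_extensions_1)
next
  case (Suc k)
  have ne: "p \<noteq> []" if "p \<in> nb_extensions A (Suc k) b" for p b
    using that by (simp add: nb_extensions_def)
  have "(\<Sum>p\<in>nb_extensions A (Suc (Suc k)) a. of_real (walk_sign \<sigma> (butlast p)) * f (last p))
      = (\<Sum>b\<in>{b \<in> A. nb_step a b}. \<Sum>p\<in>(#) a ` nb_extensions A (Suc k) b.
            of_real (walk_sign \<sigma> (butlast p)) * f (last p))"
    unfolding nb_extensions_Suc[OF Suc.prems]
  proof (rule sum.UNION_disjoint)
    show "\<forall>i\<in>{b \<in> A. nb_step a b}. \<forall>j\<in>{b \<in> A. nb_step a b}. i \<noteq> j \<longrightarrow>
        (#) a ` nb_extensions A (Suc k) i \<inter> (#) a ` nb_extensions A (Suc k) j = {}"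
      by (auto simp: nb_extensions_def)
  qed (use assms(1) in \<open>simp_all add: finite_nb_extensions\<close>)
  also have "\<dots> = (\<Sum>b\<in>{b \<in> A. nb_step a b}. \<Sum>p\<in>nb_extensions A (Suc k) b.
        of_real (\<sigma> a) * (of_real (walk_sign \<sigma> (butlast p)) * f (last p)))"
  proof (rule sum.cong[OF refl])
    fix b assume "b \<in> {b \<in> A. nb_step a b}"
    have "(\<Sum>p\<in>(#) a ` nb_extensions A (Suc k) b. of_real (walk_sign \<sigma> (butlast p)) * f (last p))
        = (\<Sum>p\<in>nb_extensions A (Suc k) b. of_real (walk_sign \<sigma> (butlast (a # p))) * f (last (a # p)))"
      by (subst sum.reindex) (simp_all add: o_def)
    also have "\<dots> = (\<Sum>p\<in>nb_extensions A (Suc k) b.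
        of_real (\<sigma> a) * (of_real (walk_sign \<sigma> (butlast p)) * f (last p)))"
      by (intro sum.cong refl) (simp add: ne)
    finally show "(\<Sum>p\<in>(#) a ` nb_extensions A (Suc k) b. of_real (walk_sign \<sigma> (butlast p)) * f (last p))
        = (\<Sum>p\<in>nb_extensions A (Suc k) b. of_real (\<sigma> a) * (of_real (walk_sign \<sigma> (butlast p)) * f (last p)))" .
  qed
  also have "\<dots> = (\<Sum>b\<in>{b \<in> A. nb_step a b}. of_real (\<sigma> a) * (z ^ k * f b))"
    using Suc.IH by (intro sum.cong refl) (simp add: sum_distrib_left[symmetric])
  also have "\<dots> = z ^ k * (\<Sum>b\<in>{b \<in> A. nb_step a b}. of_real (\<sigma> a) * f b)"
    by (simp add: sum_distrib_left mult_ac)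
  also have "\<dots> = z ^ Suc k * f a" using eig[OF Suc.prems] by simp
  finally show ?case .
qed

text \<open>
  With \<open>J\<close> the reversal of arcs and \<open>S\<close> the diagonal matrix of signs, this is the matrix
  \<open>B\<^bsup>q-1\<^esup> S J\<close> of the signed non-backtracking matrix \<open>B\<close>. It is symmetric, and \<open>S J\<close> is orthogonal.
\<close>

definition hike_matrix :: "('w \<times> 'w) set \<Rightarrow> ('w \<times> 'w \<Rightarrow> real) \<Rightarrow> nat \<Rightarrow> 'w \<times> 'w \<Rightarrow> 'w \<times> 'w \<Rightarrow> real" where
  "hike_matrix A \<sigma> q a b = (\<Sum>p\<in>nb_paths A q a (prod.swap b). walk_sign \<sigma> p)"

lemma walk_sign_rev: "walk_sign \<sigma> (rev p) = walk_sign \<sigma> p"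
  by (induction p) (simp_all add: mult.commute)

lemma walk_sign_map_swap:
  "(\<And>a. a \<in> set p \<Longrightarrow> \<sigma> (prod.swap a) = \<sigma> a) \<Longrightarrow> walk_sign \<sigma> (map prod.swap p) = walk_sign \<sigma> p"
  by (induction p) simp_all

lemma rev_swap_nb_paths:
  assumes "\<And>a. a \<in> A \<Longrightarrow> prod.swap a \<in> A" "p \<in> nb_paths A q a (prod.swap b)"
  shows "rev (map prod.swap p) \<in> nb_paths A q b (prod.swap a)"
proof -
  have sw: "nb_step (prod.swap y) (prod.swap x) = nb_step x y" for x y :: "'a \<times> 'a"
    by (auto simp: nb_step_def)
  have p: "p \<noteq> []" "hd p = a" "last p = prod.swap b" "length p = q" "set p \<subseteq> A" "successively nb_step p"
    using assms(2) by (simp_all add: nb_paths_def nb_walks_def)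
  have "successively nb_step (rev (map prod.swap p))"
    using p(6) by (simp add: successively_map sw)
  moreover have "set (rev (map prod.swap p)) \<subseteq> A"
    using p(5) assms(1) by auto
  ultimately show ?thesis
    using p(1-4) by (simp add: nb_paths_def nb_walks_def hd_rev last_rev last_map hd_map)
qed

text \<open>Traversing a walk backwards exchanges the roles of \<open>a\<close> and \<open>b\<close>
  and preserves the sign.\<close>

lemma hike_matrix_symmetric:
  assumes swap: "\<And>a. a \<in> A \<Longrightarrow> prod.swap a \<in> A" and \<sigma>: "\<And>a. \<sigma> (prod.swap a) = \<sigma> a"
  shows "hike_matrix A \<sigma> q a b = hike_matrix A \<sigma> q b a"
  unfolding hike_matrix_def
  by (rule sum.reindex_bij_witness[of _ "\<lambda>p. rev (map prod.swap p)" "\<lambda>p. rev (map prod.swap p)"])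
    (auto simp: rev_map o_def walk_sign_rev walk_sign_map_swap \<sigma> simp flip: rev_map
      intro!: rev_swap_nb_paths swap)

text \<open>\<open>S J\<close> is an involution, since signs square to one and agree on opposite
  arcs. So the matrix sends \<open>S J f\<close> to \<open>B^k f\<close>, which is a multiple of
  \<open>f\<close>. This is not an eigenvector equation, but \<open>f\<close> and
  \<open>S J f\<close> have the same norm, which is all that \<open>power_le_trace\<close>
  needs.\<close>

lemma hike_matrix_eigenvector:
  fixes f :: "'w \<times> 'w \<Rightarrow> complex"
  assumes "finite A" and swap: "\<And>a. a \<in> A \<Longrightarrow> prod.swap a \<in> A"
    and \<sigma>: "\<And>a. \<sigma> (prod.swap a) = \<sigma> a" "\<And>a. a \<in> A \<Longrightarrow> (\<sigma> a)\<^sup>2 = 1"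
    and eig: "\<And>a. a \<in> A \<Longrightarrow> (\<Sum>b\<in>{b \<in> A. nb_step a b}. of_real (\<sigma> a) * f b) = z * f a"
    and "a \<in> A"
  shows "mat_app (hike_matrix A \<sigma> (Suc k)) A (\<lambda>b. of_real (\<sigma> b) * f (prod.swap b)) a = z ^ k * f a"
proof -
  let ?g = "\<lambda>b. of_real (\<sigma> b) * f (prod.swap b)"
  have union: "nb_extensions A (Suc k) a = (\<Union>b\<in>A. nb_paths A (Suc k) a (prod.swap b))"
  proof (intro equalityI subsetI)
    fix p assume p: "p \<in> nb_extensions A (Suc k) a"
    then have "last p \<in> A" by (auto simp: nb_extensions_def nb_walks_def)
    then show "p \<in> (\<Union>b\<in>A. nb_paths A (Suc k) a (prod.swap b))"
      using p swap by (intro UN_I[of "prod.swap (last p)"]) (simp_all add: nb_extensions_def nb_paths_def)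
  qed (auto simp: nb_extensions_def nb_paths_def)
  have "z ^ k * f a = (\<Sum>p\<in>nb_extensions A (Suc k) a. of_real (walk_sign \<sigma> (butlast p)) * f (last p))"
    by (rule eigenvector_iterate[OF assms(1) eig \<open>a \<in> A\<close>, symmetric])
  also have "\<dots> = (\<Sum>b\<in>A. \<Sum>p\<in>nb_paths A (Suc k) a (prod.swap b). of_real (walk_sign \<sigma> (butlast p)) * f (last p))"
    unfolding union
  proof (rule sum.UNION_disjoint)
    show "\<forall>i\<in>A. \<forall>j\<in>A. i \<noteq> j \<longrightarrow>
        nb_paths A (Suc k) a (prod.swap i) \<inter> nb_paths A (Suc k) a (prod.swap j) = {}"
      by (auto simp: nb_paths_def)
  qed (use assms(1) in \<open>simp_all add: finite_nb_paths\<close>)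
  also have "\<dots> = (\<Sum>b\<in>A. \<Sum>p\<in>nb_paths A (Suc k) a (prod.swap b). of_real (walk_sign \<sigma> p) * ?g b)"
  proof (intro sum.cong refl)
    fix b p assume b: "b \<in> A" and p: "p \<in> nb_paths A (Suc k) a (prod.swap b)"
    have last: "p \<noteq> []" "last p = prod.swap b" using p by (simp_all add: nb_paths_def)
    have "walk_sign \<sigma> p = walk_sign \<sigma> (butlast p @ [last p])"
      by (simp only: append_butlast_last_id[OF last(1)])
    also have "\<dots> = walk_sign \<sigma> (butlast p) * \<sigma> b" using last(2) \<sigma>(1) by simp
    finally have "walk_sign \<sigma> p * \<sigma> b = walk_sign \<sigma> (butlast p) * (\<sigma> b)\<^sup>2"
      by (simp add: power2_eq_square)
    then have "walk_sign \<sigma> (butlast p) = walk_sign \<sigma> p * \<sigma> b" using \<sigma>(2)[OF b] by simp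
    then show "of_real (walk_sign \<sigma> (butlast p)) * f (last p) = of_real (walk_sign \<sigma> p) * ?g b"
      by (simp add: last(2))
  qed
  also have "\<dots> = mat_app (hike_matrix A \<sigma> (Suc k)) A ?g a"
    by (simp add: mat_app_def hike_matrix_def sum_distrib_right)
  finally show ?thesis by simp
qed

text \<open>A segment ends in the reverse of the arc \<open>c\<close> with which the next one
  starts; this is the turn. For equal end arcs the last arc is likewise the reverse of the
  first.\<close>

primrec hikes :: "('w \<times> 'w) set \<Rightarrow> nat \<Rightarrow> nat \<Rightarrow> 'w \<times> 'w \<Rightarrow> 'w \<times> 'w \<Rightarrow> ('w \<times> 'w) list set" where
  "hikes A q 0 a b = (if a = b then {[]} else {})"
| "hikes A q (Suc k) a b =
     (\<Union>c\<in>A. (\<lambda>(p, w). p @ w) ` (nb_paths A q a (prod.swap c) \<times> hikes A q k c b))"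

lemma finite_hikes: "finite A \<Longrightarrow> finite (hikes A q k a b)"
  by (induction k arbitrary: a) (auto simp: finite_nb_paths)

text \<open>Expanding the matrix product gives sequences of segments. Concatenation loses nothing
  because all segments have length \<open>q\<close>, and the end of a segment reveals the
  intermediate index.\<close>

lemma mat_power_hike_matrix:
  assumes "finite A"
  shows "mat_power (hike_matrix A \<sigma> q) A k a b = (\<Sum>w\<in>hikes A q k a b. walk_sign \<sigma> w)"
proof (induction k arbitrary: a)
  case (Suc k)
  let ?T = "\<lambda>c. (\<lambda>(p, w). p @ w) ` (nb_paths A q a (prod.swap c) \<times> hikes A q k c b)"
  have len: "length p = q" if "p \<in> nb_paths A q a c" for p c
    using that by (simp add: nb_paths_def nb_walks_def)
  have "(\<Sum>w\<in>hikes A q (Suc k) a b. walk_sign \<sigma> w) = (\<Sum>c\<in>A. \<Sum>w\<in>?T c. walk_sign \<sigma> w)"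
    unfolding hikes.simps
  proof (rule sum.UNION_disjoint)
    show "\<forall>i\<in>A. \<forall>j\<in>A. i \<noteq> j \<longrightarrow> ?T i \<inter> ?T j = {}"
    proof (intro ballI impI equals0I)
      fix i j w assume ij: "i \<noteq> j" and w: "w \<in> ?T i \<inter> ?T j"
      obtain p v where p: "w = p @ v" "p \<in> nb_paths A q a (prod.swap i)" using w by auto
      obtain p' v' where p': "w = p' @ v'" "p' \<in> nb_paths A q a (prod.swap j)" using w by auto
      have "p = p'" using p p' len by (metis append_eq_append_conv)
      then have "prod.swap i = prod.swap j" using p(2) p'(2) by (simp add: nb_paths_def)
      then have "prod.swap (prod.swap i) = prod.swap (prod.swap j)" by (rule arg_cong)
      then show False using ij by simp
    qed
  qed (use assms in \<open>simp_all add: finite_nb_paths finite_hikes\<close>)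
  also have "\<dots> = (\<Sum>c\<in>A. hike_matrix A \<sigma> q a c * mat_power (hike_matrix A \<sigma> q) A k c b)"
  proof (rule sum.cong[OF refl])
    fix c assume "c \<in> A"
    have inj: "inj_on (\<lambda>(p, w). p @ w) (nb_paths A q a (prod.swap c) \<times> hikes A q k c b)"
    proof (rule inj_onI, clarify)
      fix p w p' w' assume "p \<in> nb_paths A q a (prod.swap c)" "p' \<in> nb_paths A q a (prod.swap c)"
        and eq: "p @ w = p' @ w'"
      then have "length p = length p'" using len by simp
      then show "p = p' \<and> w = w'" using eq by simp
    qed
    have "(\<Sum>w\<in>?T c. walk_sign \<sigma> w)
        = (\<Sum>(p, w)\<in>nb_paths A q a (prod.swap c) \<times> hikes A q k c b. walk_sign \<sigma> p * walk_sign \<sigma> w)"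
      by (subst sum.reindex[OF inj]) (simp add: o_def case_prod_beta')
    also have "\<dots> = hike_matrix A \<sigma> q a c * (\<Sum>w\<in>hikes A q k c b. walk_sign \<sigma> w)"
      by (simp add: hike_matrix_def sum_product sum.cartesian_product)
    finally show "(\<Sum>w\<in>?T c. walk_sign \<sigma> w) = hike_matrix A \<sigma> q a c * mat_power (hike_matrix A \<sigma> q) A k c b"
      by (simp only: Suc.IH)
  qed
  finally show ?case by simp
qed simp

lemma hikes_props:
  assumes "0 < q" "w \<in> hikes A q k a b" "a \<in> A"
  shows "length w = k * q \<and> hike A q w \<and> (0 < k \<longrightarrow> w \<noteq> [] \<and> hd w = a)"
  using assms(2,3)
proof (induction k arbitrary: w a)
  case 0
  then show ?case by (simp add: hike_def split: if_splits)
next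
  case (Suc k)
  then obtain c p v where c: "c \<in> A" and p: "p \<in> nb_paths A q a (prod.swap c)"
    and v: "v \<in> hikes A q k c b" and w: "w = p @ v" by auto
  have IH: "length v = k * q" "hike A q v" "0 < k \<Longrightarrow> v \<noteq> [] \<and> hd v = c"
    using Suc.IH[OF v c] by simp_all
  have pp: "length p = q" "set p \<subseteq> A" "p \<noteq> []" "hd p = a" "last p = prod.swap c"
    using p by (simp_all add: nb_paths_def nb_walks_def)
  have nb: "nb_step (p ! t) (p ! Suc t)" if "Suc t < q" for t
    using nb_walks_nth(2)[of p A q t] p that by (simp add: nb_paths_def)
  have "hike A q w"
    unfolding hike_def
  proof (intro conjI allI impI)
    show "set w \<subseteq> A" using IH(2) pp(2) by (simp add: w hike_def)
    fix t assume t: "Suc t < length w"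
    consider "Suc t < q" | "Suc t = q" | "q < Suc t" by linarith
    then show "if Suc t mod q = 0 then w ! Suc t = prod.swap (w ! t) else nb_step (w ! t) (w ! Suc t)"
    proof cases
      case 1
      then show ?thesis using nb[OF 1] by (simp add: w nth_append pp(1))
    next
      case 2
      then have "0 < length v" using t by (simp add: w pp(1))
      then have "0 < k" using IH(1) by (cases k) simp_all
      then have v0: "v \<noteq> []" "v ! 0 = c" using IH(3)[OF \<open>0 < k\<close>] by (simp_all add: hd_conv_nth[symmetric])
      have "w ! Suc t = c" using 2 v0 by (simp add: w nth_append pp(1))
      moreover have "w ! t = last p" using pp(1,3) by (simp add: w nth_append last_conv_nth 2[symmetric])
      ultimately show ?thesis using 2 pp(5) by simp
    next
      case 3
      then have q: "q \<le> t" by simp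
      have "Suc (t - q) < length v" using t q by (simp add: w pp(1))
      moreover have "Suc (t - q) mod q = Suc t mod q"
      proof -
        have "Suc t mod q = (Suc (t - q) + q) mod q" using q by simp
        then show ?thesis by (simp only: mod_add_self2)
      qed
      ultimately have "if Suc t mod q = 0 then v ! Suc (t - q) = prod.swap (v ! (t - q))
          else nb_step (v ! (t - q)) (v ! Suc (t - q))"
        using IH(2) unfolding hike_def by (metis (no_types, lifting))
      moreover have "w ! Suc t = v ! Suc (t - q)" "w ! t = v ! (t - q)"
        using q by (simp_all add: w nth_append pp(1) Suc_diff_le)
      ultimately show ?thesis by simp
    qed
  qed
  then show ?case using IH(1) pp by (simp add: w)
qed

section \<open>Random signings\<close>

definition even_walk :: "('w \<times> 'w) list \<Rightarrow> bool" where
  "even_walk w \<longleftrightarrow> (\<forall>e. even (count_list (map uedge w) e))"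

lemma even_walk_card_uedges:
  assumes "even_walk w"
  shows "2 * card (uedge ` set w) \<le> length w"
proof -
  have "card (uedge ` set w) * 2 = (\<Sum>e\<in>uedge ` set w. 2)" by simp
  also have "\<dots> \<le> (\<Sum>e\<in>uedge ` set w. count_list (map uedge w) e)"
  proof (rule sum_mono)
    fix e assume "e \<in> uedge ` set w"
    then have "e \<in> set (map uedge w)" by simp
    then have "count_list (map uedge w) e \<noteq> 0" by (simp only: count_list_0_iff not_not)
    moreover have "even (count_list (map uedge w) e)" using assms by (simp add: even_walk_def)
    ultimately show "2 \<le> count_list (map uedge w) e" by (auto elim!: evenE)
  qed
  also have "\<dots> = length (map uedge w)" by (rule sum_count_set) simp_all
  finally show ?thesis by simp
qed

lemma excess_le_mono: "excess_le A N c \<Longrightarrow> N' \<le> N \<Longrightarrow> excess_le A N' c"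
  by (simp add: excess_le_def)

lemma Union_uedges_hike:
  assumes "hike A q w" "w \<noteq> []"
  shows "\<Union>(uedge ` set w) \<subseteq> visited (fst (hd w)) w"
proof -
  have "fst (w ! i) \<in> visited (fst (hd w)) w" if "i < length w" for i
  proof (cases i)
    case 0
    then show ?thesis using assms(2) by (simp add: visited_def hd_conv_nth)
  next
    case (Suc j)
    then have "fst (w ! i) = snd (w ! j)"
      using assms(1) that by (auto simp: hike_def nb_step_def split: if_splits)
    moreover have "w ! j \<in> set w" using that Suc by simp
    ultimately show ?thesis by (simp add: visited_def)
  qed
  then have "fst a \<in> visited (fst (hd w)) w" if "a \<in> set w" for a
    using that by (auto simp: in_set_conv_nth)
  then show ?thesis by (auto simp: uedge_def visited_def)
qed

text \<open>By \<open>hike_in_phases\<close> a hike is one of the phase sequences given by its start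
  vertex, the number \<open>J\<close> of phases and the number \<open>e\<close> of distinct edges.
  The last two have at most \<open>J0 + 1\<close> and \<open>m * q + 1\<close> values, and
  \<open>R\<close> and the cost of a phase are at least one, so \<open>J\<close> and
  \<open>e\<close> may be replaced by their maxima.\<close>

lemma card_even_hikes:
  fixes R c :: real
  assumes "finite A" and loopless: "\<And>a. a \<in> A \<Longrightarrow> fst a \<noteq> snd a"
    and "0 < q" "0 < m" "1 \<le> R" "1 \<le> c"
    and exc: "excess_le A (3 * q) 0" "excess_le A (m * q) d"
    and growth: "\<And>y b. real (card (walks_from A y b)) \<le> c * R ^ b"
  defines "J0 \<equiv> 2 * m + d + 1"
  shows "real (\<Sum>a\<in>A. card {w \<in> hikes A q (2 * m) a a. even_walk w})
    \<le> real (card (fst ` A)) * (real (J0 + 1) * (real (m * q + 1) *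
        ((real ((q + 1) ^ 2 * (2 * q * J0 + 1) * (q * q + 1)) * c) ^ J0 * R ^ (m * q))))"
proof -
  define K where "K = real ((q + 1) ^ 2 * (2 * q * J0 + 1) * (q * q + 1)) * c"
  define E where "E a = {w \<in> hikes A q (2 * m) a a. even_walk w}" for a
  have between: "card (walks_between A y z a) \<le> q * q + 1" if "a \<le> q" for y z a
  proof -
    have "excess_le A (3 * a) 0" by (rule excess_le_mono[OF exc(1)]) (use that in simp)
    then have "card (walks_between A y z a) \<le> a * a + 1"
      unfolding walks_between_def by (intro card_nb_walks_between assms(1) loopless)
    also have "\<dots> \<le> q * q + 1" using that by (simp add: mult_le_mono)
    finally show ?thesis .
  qed
  have "0 < (q + 1) ^ 2 * (2 * q * J0 + 1) * (q * q + 1)" by simp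
  then have "1 \<le> real ((q + 1) ^ 2 * (2 * q * J0 + 1) * (q * q + 1))" by linarith
  then have K1: "1 \<le> K" unfolding K_def using mult_mono[of 1 _ 1 c] assms(6) by simp
  have phase: "real (card (phases A q x J e)) \<le> K ^ J0 * R ^ (m * q)" if "J \<le> J0" "e \<le> m * q" for x J e
  proof -
    have "real (card (phases A q x J e)) \<le> K ^ J * R ^ e"
      unfolding K_def
      by (rule card_phases[OF assms(1)]) (use assms(5,6) between growth that in simp_all)
    also have "\<dots> \<le> K ^ J0 * R ^ (m * q)"
      using that K1 assms(5) by (intro mult_mono power_increasing) simp_all
    finally show ?thesis .
  qed
  let ?U = "\<Union>x\<in>fst ` A. \<Union>J\<in>{..J0}. \<Union>e\<in>{..m * q}. phases A q x J e"
  have sub: "E a \<subseteq> ?U" if a: "a \<in> A" for a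
  proof
    fix w assume "w \<in> E a"
    then have w: "w \<in> hikes A q (2 * m) a a" "even_walk w" by (simp_all add: E_def)
    have props: "length w = 2 * m * q" "hike A q w" "w \<noteq> []" "hd w = a"
      using hikes_props[OF \<open>0 < q\<close> w(1) a] \<open>0 < m\<close> by simp_all
    define e where "e = card (uedge ` set w)"
    have e: "e \<le> m * q" using even_walk_card_uedges[OF w(2)] props(1) by (simp add: e_def)
    obtain J where J: "w \<in> phases A q (fst (hd w)) J e"
      "J + card (visited (fst (hd w)) w) \<le> (length w - 1) div q + e + 2"
      using hike_in_phases[OF props(2,3) refl \<open>0 < q\<close> loopless] unfolding e_def by metis
    have "set w \<subseteq> A" using props(2) by (simp add: hike_def)
    then have "e \<le> card (\<Union>(uedge ` set w)) + d"
      using exc(2) e unfolding e_def excess_le_def by (metis image_mono)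
    also have "card (\<Union>(uedge ` set w)) \<le> card (visited (fst (hd w)) w)"
      by (rule card_mono[OF finite_visited Union_uedges_hike[OF props(2,3)]])
    finally have "e \<le> card (visited (fst (hd w)) w) + d" by simp
    \<comment> \<open>At most \<open>2 * m - 1\<close> turns, excess at most \<open>d\<close> and
      the additive 2 of \<open>hike_in_phases\<close> give \<open>J0\<close>.\<close>
    moreover have "(length w - 1) div q < 2 * m"
      using \<open>0 < q\<close> \<open>0 < m\<close> by (simp add: props(1) div_less_iff_less_mult)
    ultimately have "J \<le> J0" using J(2) by (simp add: J0_def)
    moreover have "fst (hd w) \<in> fst ` A" using props(4) a by simp
    ultimately show "w \<in> ?U" using J(1) e by blast
  qed
  have hd: "hd w = a" if "w \<in> E a" "a \<in> A" for w a
    using hikes_props[OF \<open>0 < q\<close> _ that(2), of w "2 * m" a] that \<open>0 < m\<close> by (simp add: E_def)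
  \<comment> \<open>The first arc of a hike is \<open>a\<close>, so the sum counts each hike once,
    and below only start vertices have to be summed over.\<close>
  have "(\<Sum>a\<in>A. card (E a)) = card (\<Union>a\<in>A. E a)"
  proof (rule card_UN_disjoint[symmetric])
    show "\<forall>i\<in>A. \<forall>j\<in>A. i \<noteq> j \<longrightarrow> E i \<inter> E j = {}" using hd by blast
  qed (use assms(1) in \<open>simp_all add: E_def finite_hikes\<close>)
  also have "\<dots> \<le> card ?U"
  proof (rule card_mono)
    show "finite ?U" using assms(1) by (intro finite_UN_I finite_imageI finite_atMost finite_phases)
    show "(\<Union>a\<in>A. E a) \<subseteq> ?U" by (rule UN_least) (rule sub)
  qed
  also have "\<dots> \<le> (\<Sum>x\<in>fst ` A. card (\<Union>J\<in>{..J0}. \<Union>e\<in>{..m * q}. phases A q x J e))"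
    by (rule card_UN_le) (use assms(1) in simp)
  also have "\<dots> \<le> (\<Sum>x\<in>fst ` A. \<Sum>J\<in>{..J0}. card (\<Union>e\<in>{..m * q}. phases A q x J e))"
    by (intro sum_mono card_UN_le) simp
  also have "\<dots> \<le> (\<Sum>x\<in>fst ` A. \<Sum>J\<in>{..J0}. \<Sum>e\<in>{..m * q}. card (phases A q x J e))"
    by (intro sum_mono card_UN_le) simp
  finally have "real (\<Sum>a\<in>A. card (E a))
      \<le> real (\<Sum>x\<in>fst ` A. \<Sum>J\<in>{..J0}. \<Sum>e\<in>{..m * q}. card (phases A q x J e))"
    by (rule of_nat_mono)
  also have "\<dots> = (\<Sum>x\<in>fst ` A. \<Sum>J\<in>{..J0}. \<Sum>e\<in>{..m * q}. real (card (phases A q x J e)))"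
    by (simp only: of_nat_sum)
  also have "\<dots> \<le> (\<Sum>x\<in>fst ` A. \<Sum>J\<in>{..J0}. \<Sum>e\<in>{..m * q}. K ^ J0 * R ^ (m * q))"
    using phase by (intro sum_mono) simp
  also have "\<dots> = real (card (fst ` A)) * (real (J0 + 1) * (real (m * q + 1) * (K ^ J0 * R ^ (m * q))))"
    by (simp only: sum_constant card_atMost Suc_eq_plus1)
  finally show ?thesis by (simp only: E_def K_def)
qed

section \<open>Averages of products of signs\<close>

definition edge_sign :: "('w set \<Rightarrow> int) \<Rightarrow> 'w \<times> 'w \<Rightarrow> real" where
  "edge_sign s a = real_of_int (s (uedge a))"

lemma walk_sign_flip:
  "walk_sign (edge_sign (s(e := - s e))) w = (-1) ^ count_list (map uedge w) e * walk_sign (edge_sign s) w"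
  by (induction w) (auto simp: edge_sign_def)

lemma prod_list_map_eq_prod_count:
  fixes f :: "'a \<Rightarrow> 'b :: comm_monoid_mult"
  assumes "finite X" "set xs \<subseteq> X"
  shows "prod_list (map f xs) = (\<Prod>x\<in>X. f x ^ count_list xs x)"
  using assms(2)
proof (induction xs)
  case (Cons a xs)
  have "(\<Prod>x\<in>X. f x ^ count_list (a # xs) x)
      = (\<Prod>x\<in>X. (if a = x then f x else 1) * f x ^ count_list xs x)"
    by (intro prod.cong refl) simp
  also have "\<dots> = f a * (\<Prod>x\<in>X. f x ^ count_list xs x)"
    using Cons.prems assms(1) by (simp add: prod.distrib)
  finally show ?case using Cons by simp
qed simp

lemma walk_sign_even:
  assumes "\<And>a. a \<in> set w \<Longrightarrow> s (uedge a) \<in> {-1, 1}"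
  shows "walk_sign (edge_sign s) w = (\<Prod>e\<in>uedge ` set w. real_of_int (s e) ^ count_list (map uedge w) e)"
proof -
  have "walk_sign (edge_sign s) w = prod_list (map (\<lambda>e. real_of_int (s e)) (map uedge w))"
    by (simp add: walk_sign_def edge_sign_def[abs_def] o_def)
  also have "\<dots> = (\<Prod>e\<in>set (map uedge w). real_of_int (s e) ^ count_list (map uedge w) e)"
    by (rule prod_list_map_eq_prod_count) simp_all
  finally show ?thesis by simp
qed

text \<open>The default value 1 agrees with that of \<open>random_signing\<close>, which is
  therefore the uniform distribution on this finite set.\<close>

definition signings :: "'w set set \<Rightarrow> ('w set \<Rightarrow> int) set" where
  "signings U = PiE_dflt U 1 (\<lambda>_. {-1, 1})"

lemma finite_signings: "finite U \<Longrightarrow> finite (signings U)"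
  unfolding signings_def by (rule finite_PiE_dflt) simp_all

lemma signings_nonempty: "signings U \<noteq> {}"
  by (simp add: signings_def)

text \<open>On an even walk every sign occurs to an even power. Otherwise, flipping the sign of an
  edge used an odd number of times is an involution of the signings that negates the
  summand.\<close>

lemma sum_signings_walk_sign:
  assumes "finite U" "uedge ` set w \<subseteq> U"
  shows "(\<Sum>s\<in>signings U. walk_sign (edge_sign s) w) = (if even_walk w then real (card (signings U)) else 0)"
proof (cases "even_walk w")
  case True
  have "walk_sign (edge_sign s) w = 1" if s: "s \<in> signings U" for s
  proof -
    have sU: "s e \<in> {-1, 1}" if "e \<in> U" for e using s that unfolding signings_def PiE_dflt_def by simp
    have "walk_sign (edge_sign s) w = (\<Prod>e\<in>uedge ` set w. real_of_int (s e) ^ count_list (map uedge w) e)"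
      by (rule walk_sign_even) (use sU assms(2) in blast)
    also have "\<dots> = 1"
    proof (rule prod.neutral, rule ballI)
      fix e assume "e \<in> uedge ` set w"
      then have "s e = -1 \<or> s e = 1" using sU assms(2) by blast
      moreover have "even (count_list (map uedge w) e)" using True by (simp add: even_walk_def)
      ultimately show "real_of_int (s e) ^ count_list (map uedge w) e = 1" by auto
    qed
    finally show ?thesis .
  qed
  then show ?thesis using True by simp
next
  case False
  then obtain e where e: "odd (count_list (map uedge w) e)" by (auto simp: even_walk_def)
  then have "count_list (map uedge w) e \<noteq> 0" by (metis even_zero)
  then have "e \<in> set (map uedge w)" by (simp only: count_list_0_iff not_not)
  then have eU: "e \<in> U" using assms(2) by auto
  have flip: "s(e := - s e) \<in> signings U" if "s \<in> signings U" for s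
    using that eU unfolding signings_def PiE_dflt_def by auto
  have "(\<Sum>s\<in>signings U. walk_sign (edge_sign s) w)
      = (\<Sum>s\<in>signings U. walk_sign (edge_sign (s(e := - s e))) w)"
    by (rule sum.reindex_bij_witness[of _ "\<lambda>s. s(e := - s e)" "\<lambda>s. s(e := - s e)"])
      (simp_all add: flip)
  also have "\<dots> = - (\<Sum>s\<in>signings U. walk_sign (edge_sign s) w)"
    using e by (simp add: walk_sign_flip sum_negf)
  finally show ?thesis using False by simp
qed

section \<open>The trace bound for the random signing of a fixed graph\<close>

context
  fixes L :: "'w pair_pre_digraph"
  assumes L: "pair_graph L"
begin

interpretation L: pair_graph L by (rule L)

lemma uedges_eq: "uedges L = uedge ` parcs L"
proof (intro equalityI subsetI)
  fix e assume "e \<in> uedges L"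
  then obtain u v where "e = uedge (u, v)" "(u, v) \<in> parcs L" by (auto simp: uedges_def uedge_def)
  then show "e \<in> uedge ` parcs L" by (simp only: imageI)
next
  fix e assume "e \<in> uedge ` parcs L"
  then obtain a where "e = uedge a" "a \<in> parcs L" by (rule imageE)
  then show "e \<in> uedges L" by (cases a) (auto simp: uedges_def uedge_def)
qed

lemma swap_parcs: "a \<in> parcs L \<Longrightarrow> prod.swap a \<in> parcs L"
  using L.arcs_symmetric by (cases a) simp

lemma parcs_loopless: "a \<in> parcs L \<Longrightarrow> fst a \<noteq> snd a"
  using L.no_loops'[of "fst a" "snd a"] by simp

lemma eigenvalue_eigenfunction:
  assumes "eigenvalue (nb_matrix L s) z"
  obtains f where "\<exists>a\<in>parcs L. f a \<noteq> 0"
    and "\<forall>a\<in>parcs L. (\<Sum>b\<in>{b \<in> parcs L. nb_step a b}. of_real (edge_sign s a) * f b) = z * f a"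
proof -
  obtain f where f: "\<exists>a\<in>parcs L. f a \<noteq> 0"
    "\<forall>a\<in>parcs L. (\<Sum>b\<in>parcs L. nb_entry s a b * f b) = z * f a"
    using assms eigenvalue_nb_matrix_iff[OF L.pair_finite_arcs, of s z] by auto
  have "(\<Sum>b\<in>{b \<in> parcs L. nb_step a b}. of_real (edge_sign s a) * f b) = z * f a" if "a \<in> parcs L" for a
  proof -
    have "(\<Sum>b\<in>{b \<in> parcs L. nb_step a b}. of_real (edge_sign s a) * f b)
        = (\<Sum>b\<in>parcs L. if nb_step a b then of_real (edge_sign s a) * f b else 0)"
      using L.pair_finite_arcs by (simp add: sum.inter_filter)
    also have "\<dots> = (\<Sum>b\<in>parcs L. nb_entry s a b * f b)"
      by (intro sum.cong refl) (auto simp: nb_entry_def nb_step_def edge_sign_def uedge_def split: prod.splits)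
    finally show ?thesis using f(2) that by simp
  qed
  then show thesis using that f(1) by blast
qed

text \<open>Apply \<open>power_le_trace\<close> to \<open>S J f\<close> for an eigenfunction
  \<open>f\<close>. Signs have modulus one and reversal permutes the arcs, so \<open>S J f\<close>
  and \<open>f\<close> have equal norms and the squared growth factor is
  \<open>cmod z ^ (2 * k)\<close>.\<close>

lemma eigenvalue_power_le_trace:
  assumes s: "s \<in> signings (uedges L)" and ev: "eigenvalue (nb_matrix L s) z"
  shows "cmod z ^ (2 * k * m) \<le> (\<Sum>a\<in>parcs L. \<Sum>w\<in>hikes (parcs L) (Suc k) (2 * m) a a. walk_sign (edge_sign s) w)"
proof -
  let ?A = "parcs L" and ?\<sigma> = "edge_sign s"
  let ?M = "hike_matrix ?A ?\<sigma> (Suc k)"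
  obtain f where f: "\<exists>a\<in>?A. f a \<noteq> 0"
    and eig0: "\<forall>a\<in>?A. (\<Sum>b\<in>{b \<in> ?A. nb_step a b}. of_real (?\<sigma> a) * f b) = z * f a"
    by (rule eigenvalue_eigenfunction[OF ev])
  note eig = eig0[rule_format]
  have fin: "finite ?A" by (rule L.pair_finite_arcs)
  have \<sigma>: "(?\<sigma> a)\<^sup>2 = 1" if "a \<in> ?A" for a
  proof -
    have "s (uedge a) \<in> {-1, 1}"
      using s that unfolding signings_def PiE_dflt_def uedges_eq by simp
    then show ?thesis by (auto simp: edge_sign_def)
  qed
  have \<sigma>swap: "?\<sigma> (prod.swap a) = ?\<sigma> a" for a by (simp add: edge_sign_def)
  let ?g = "\<lambda>b. of_real (?\<sigma> b) * f (prod.swap b)"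
  have "norm2 ?A ?g = (\<Sum>a\<in>?A. (cmod (f (prod.swap a)))\<^sup>2)"
    unfolding norm2_def
  proof (rule sum.cong[OF refl])
    fix a assume "a \<in> ?A"
    have "(cmod (?g a))\<^sup>2 = (?\<sigma> a)\<^sup>2 * (cmod (f (prod.swap a)))\<^sup>2"
      by (simp add: norm_mult power_mult_distrib)
    then show "(cmod (?g a))\<^sup>2 = (cmod (f (prod.swap a)))\<^sup>2" using \<sigma>[OF \<open>a \<in> ?A\<close>] by simp
  qed
  also have "\<dots> = norm2 ?A f"
    unfolding norm2_def
    by (rule sum.reindex_bij_witness[of _ prod.swap prod.swap]) (simp_all add: swap_parcs)
  finally have ng: "norm2 ?A ?g = norm2 ?A f" .
  have pos: "0 < norm2 ?A f"
  proof -
    obtain a where "a \<in> ?A" "f a \<noteq> 0" using f by blast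
    then show ?thesis unfolding norm2_def by (intro sum_pos2[OF fin]) simp_all
  qed
  have app: "mat_app ?M ?A ?g a = z ^ k * f a" if "a \<in> ?A" for a
    by (rule hike_matrix_eigenvector[OF fin _ _ _ eig that]) (use swap_parcs \<sigma> \<sigma>swap in simp_all)
  have "norm2 ?A (mat_app ?M ?A ?g) = (\<Sum>a\<in>?A. (cmod z ^ k)\<^sup>2 * (cmod (f a))\<^sup>2)"
    unfolding norm2_def
    by (intro sum.cong refl) (simp add: app norm_mult norm_power power_mult_distrib)
  also have "\<dots> = (cmod z ^ k)\<^sup>2 * norm2 ?A f"
    by (simp add: norm2_def sum_distrib_left)
  finally have ge: "(cmod z ^ k)\<^sup>2 * norm2 ?A ?g \<le> norm2 ?A (mat_app ?M ?A ?g)"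
    unfolding ng by (rule eq_refl[OF sym])
  have pos': "0 < norm2 ?A ?g" unfolding ng by (rule pos)
  have sym: "?M a b = ?M b a" for a b
    by (rule hike_matrix_symmetric) (simp_all add: swap_parcs \<sigma>swap)
  have "((cmod z ^ k)\<^sup>2) ^ m \<le> (\<Sum>a\<in>?A. mat_power ?M ?A (2 * m) a a)"
    by (rule power_le_trace[OF fin sym _ pos' ge]) simp
  then show ?thesis
    by (simp add: mat_power_hike_matrix[OF fin] power_mult[symmetric] mult_ac)
qed

text \<open>The case of growth factor 0 in \<open>power_le_trace\<close>. In Markov's inequality it
  permits extending the sum from the signings of large spectral radius to all signings.\<close>

lemma trace_nonneg:
  "0 < m \<Longrightarrow> 0 \<le> (\<Sum>a\<in>parcs L. \<Sum>w\<in>hikes (parcs L) (Suc k) (2 * m) a a. walk_sign (edge_sign s) w)"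
proof (cases "parcs L = {}")
  case False
  let ?A = "parcs L" and ?\<sigma> = "edge_sign s"
  let ?M = "hike_matrix ?A ?\<sigma> (Suc k)"
  assume "0 < m"
  have fin: "finite ?A" by (rule L.pair_finite_arcs)
  have sym: "?M a b = ?M b a" for a b
    by (rule hike_matrix_symmetric) (simp_all add: swap_parcs edge_sign_def)
  have "0 < norm2 ?A (\<lambda>_. 1)" using False fin by (simp add: norm2_def card_gt_0_iff)
  then have "0 ^ m \<le> (\<Sum>a\<in>?A. mat_power ?M ?A (2 * m) a a)"
    by (intro power_le_trace[OF fin sym]) (simp_all add: norm2_nonneg)
  then show ?thesis using \<open>0 < m\<close> by (simp add: mat_power_hike_matrix[OF fin] zero_power)
qed simp

lemma random_signing_eq: "random_signing L = pmf_of_set (signings (uedges L))"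
  unfolding random_signing_def signings_def
  by (rule Pi_pmf_of_set) (simp_all add: finite_uedges L.pair_finite_arcs)

lemma prob_spectral_radius_ge:
  assumes "parcs L \<noteq> {}" "0 < \<Lambda>" "0 < m"
  shows "measure_pmf.prob (random_signing L) {s. \<Lambda> \<le> spectral_radius (nb_matrix L s)}
    \<le> real (\<Sum>a\<in>parcs L. card {w \<in> hikes (parcs L) (Suc k) (2 * m) a a. even_walk w}) / \<Lambda> ^ (2 * k * m)"
proof -
  let ?A = "parcs L" and ?S = "signings (uedges L)"
  let ?H = "\<lambda>a. hikes ?A (Suc k) (2 * m) a a"
  define T where "T s = (\<Sum>a\<in>?A. \<Sum>w\<in>?H a. walk_sign (edge_sign s) w)" for s
  let ?Bad = "{s. \<Lambda> \<le> spectral_radius (nb_matrix L s)}"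
  have finA: "finite ?A" by (rule L.pair_finite_arcs)
  have finU: "finite (uedges L)" by (rule finite_uedges[OF finA])
  have finS: "finite ?S" by (rule finite_signings[OF finU])
  have bad: "\<Lambda> ^ (2 * k * m) \<le> T s" if s: "s \<in> ?S \<inter> ?Bad" for s
  proof -
    have "nb_matrix L s \<in> carrier_mat (card ?A) (card ?A)" by (simp add: nb_matrix_def)
    moreover have "0 < card ?A" using assms(1) finA by (simp add: card_gt_0_iff)
    ultimately have "spectral_radius (nb_matrix L s) \<in> norm ` spectrum (nb_matrix L s)"
      by (rule spectral_radius_mem_max(1))
    then obtain z where z: "eigenvalue (nb_matrix L s) z" "spectral_radius (nb_matrix L s) = cmod z"
      by (auto simp: spectrum_def)
    have "\<Lambda> ^ (2 * k * m) \<le> cmod z ^ (2 * k * m)"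
      using s z(2) assms(2) by (intro power_mono) simp_all
    also have "\<dots> \<le> T s" unfolding T_def using s by (intro eigenvalue_power_le_trace[OF _ z(1)]) simp
    finally show ?thesis .
  qed
  have sumT: "(\<Sum>s\<in>?S. T s) = real (card ?S) * real (\<Sum>a\<in>?A. card {w \<in> ?H a. even_walk w})"
  proof -
    have "(\<Sum>s\<in>?S. T s) = (\<Sum>a\<in>?A. \<Sum>s\<in>?S. \<Sum>w\<in>?H a. walk_sign (edge_sign s) w)"
      unfolding T_def by (rule sum.swap)
    also have "\<dots> = (\<Sum>a\<in>?A. \<Sum>w\<in>?H a. \<Sum>s\<in>?S. walk_sign (edge_sign s) w)"
      by (intro sum.cong refl) (rule sum.swap)
    also have "\<dots> = (\<Sum>a\<in>?A. \<Sum>w\<in>?H a. if even_walk w then real (card ?S) else 0)"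
    proof (intro sum.cong refl)
      fix a w assume a: "a \<in> ?A" and w: "w \<in> ?H a"
      have "hike ?A (Suc k) w" using hikes_props[OF zero_less_Suc w a] by (elim conjE)
      then have "set w \<subseteq> ?A" by (simp only: hike_def)
      then have "uedge ` set w \<subseteq> uedges L" unfolding uedges_eq by (rule image_mono)
      then show "(\<Sum>s\<in>?S. walk_sign (edge_sign s) w) = (if even_walk w then real (card ?S) else 0)"
        by (rule sum_signings_walk_sign[OF finU])
    qed
    also have "\<dots> = (\<Sum>a\<in>?A. real (card {w \<in> ?H a. even_walk w}) * real (card ?S))"
    proof (rule sum.cong[OF refl])
      fix a
      have "(\<Sum>w\<in>?H a. if even_walk w then real (card ?S) else 0)
          = (\<Sum>w\<in>{w \<in> ?H a. even_walk w}. real (card ?S))"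
        by (rule sum.inter_filter[OF finite_hikes[OF finA], symmetric])
      then show "(\<Sum>w\<in>?H a. if even_walk w then real (card ?S) else 0)
          = real (card {w \<in> ?H a. even_walk w}) * real (card ?S)"
        by (simp only: sum_constant)
    qed
    finally show ?thesis unfolding of_nat_sum sum_distrib_left by (simp only: mult.commute)
  qed
  have "real (card (?S \<inter> ?Bad)) * \<Lambda> ^ (2 * k * m) = (\<Sum>s\<in>?S \<inter> ?Bad. \<Lambda> ^ (2 * k * m))" by simp
  also have "\<dots> \<le> (\<Sum>s\<in>?S \<inter> ?Bad. T s)" using bad by (rule sum_mono)
  also have "\<dots> \<le> (\<Sum>s\<in>?S. T s)"
    using trace_nonneg[OF assms(3)] by (intro sum_mono2[OF finS]) (simp_all add: T_def)
  finally have "real (card (?S \<inter> ?Bad)) * \<Lambda> ^ (2 * k * m)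
      \<le> real (card ?S) * real (\<Sum>a\<in>?A. card {w \<in> ?H a. even_walk w})"
    by (simp only: sumT)
  moreover have "0 < real (card ?S)" using signings_nonempty finS by (simp add: card_gt_0_iff)
  moreover have "measure_pmf.prob (random_signing L) ?Bad = real (card (?S \<inter> ?Bad)) / real (card ?S)"
    unfolding random_signing_eq by (rule measure_pmf_of_set[OF signings_nonempty finS])
  ultimately show ?thesis
    using assms(2) by (simp only:) (simp add: divide_simps mult_ac)
qed

text \<open>An eigenfunction satisfies \<open>z ^ k * f a = 0\<close>, the left-hand side being a
  sum over walks of \<open>k + 1\<close> arcs, of which there are none.\<close>

lemma nb_matrix_nilpotent:
  assumes "parcs L \<noteq> {}" "nb_walks (parcs L) (Suc k) = {}"
  shows "spectral_radius (nb_matrix L s) = 0"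
proof -
  have finA: "finite (parcs L)" by (rule L.pair_finite_arcs)
  have "nb_matrix L s \<in> carrier_mat (card (parcs L)) (card (parcs L))" by (simp add: nb_matrix_def)
  moreover have "0 < card (parcs L)" using assms(1) finA by (simp add: card_gt_0_iff)
  ultimately have "spectral_radius (nb_matrix L s) \<in> norm ` spectrum (nb_matrix L s)"
    by (rule spectral_radius_mem_max(1))
  then obtain z where z: "eigenvalue (nb_matrix L s) z" "spectral_radius (nb_matrix L s) = cmod z"
    by (auto simp: spectrum_def)
  obtain f where f: "\<exists>a\<in>parcs L. f a \<noteq> 0"
    and eig0: "\<forall>a\<in>parcs L. (\<Sum>b\<in>{b \<in> parcs L. nb_step a b}. of_real (edge_sign s a) * f b) = z * f a"
    by (rule eigenvalue_eigenfunction[OF z(1)])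
  note eig = eig0[rule_format]
  obtain a where a: "a \<in> parcs L" "f a \<noteq> 0" using f by blast
  have "nb_extensions (parcs L) (Suc k) a = {}" using assms(2) by (simp add: nb_extensions_def)
  then have "z ^ k * f a = 0" using eigenvector_iterate[OF finA eig a(1), of k] by simp
  then show ?thesis using a(2) z(2) by simp
qed

end

section \<open>Growth of non-backtracking walks\<close>

lemma card_nb_extensions_Suc:
  assumes "finite A" "a \<in> A"
  shows "card (nb_extensions A (Suc (Suc k)) a) = (\<Sum>b\<in>{b \<in> A. nb_step a b}. card (nb_extensions A (Suc k) b))"
proof -
  have "card (nb_extensions A (Suc (Suc k)) a)
      = (\<Sum>b\<in>{b \<in> A. nb_step a b}. card ((#) a ` nb_extensions A (Suc k) b))"
    unfolding nb_extensions_Suc[OF assms(2)]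
  proof (rule card_UN_disjoint)
    show "\<forall>i\<in>{b \<in> A. nb_step a b}. \<forall>j\<in>{b \<in> A. nb_step a b}. i \<noteq> j \<longrightarrow>
        (#) a ` nb_extensions A (Suc k) i \<inter> (#) a ` nb_extensions A (Suc k) j = {}"
      by (auto simp: nb_extensions_def)
  qed (use assms(1) in \<open>simp_all add: finite_nb_extensions\<close>)
  also have "\<dots> = (\<Sum>b\<in>{b \<in> A. nb_step a b}. card (nb_extensions A (Suc k) b))"
    by (intro sum.cong refl card_image) simp
  finally show ?thesis .
qed

lemma card_nb_walks_Suc:
  assumes "finite A"
  shows "card (nb_walks A (Suc k)) = (\<Sum>a\<in>A. card (nb_extensions A (Suc k) a))"
proof -
  have "nb_walks A (Suc k) = (\<Union>a\<in>A. nb_extensions A (Suc k) a)"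
  proof (intro equalityI subsetI)
    fix p assume p: "p \<in> nb_walks A (Suc k)"
    then have "p \<noteq> []" by (auto simp: nb_walks_def)
    moreover from this have "hd p \<in> A" using p hd_in_set[of p] by (auto simp: nb_walks_def)
    ultimately show "p \<in> (\<Union>a\<in>A. nb_extensions A (Suc k) a)"
      using p by (intro UN_I[of "hd p"]) (simp_all add: nb_extensions_def)
  qed (auto simp: nb_extensions_def)
  moreover have "card (\<Union>a\<in>A. nb_extensions A (Suc k) a) = (\<Sum>a\<in>A. card (nb_extensions A (Suc k) a))"
    by (rule card_UN_disjoint) (use assms in \<open>auto simp: nb_extensions_def finite_nb_walks\<close>)
  ultimately show ?thesis by simp
qed

text \<open>The numbers of walks with a given first arc are the entries of powers of
  \<open>B\<close> applied to the all-ones vector. After division by \<open>R\<close> the spectral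
  radius is below one, so the entries of all powers are bounded by one constant. Keeping
  \<open>R\<close> strictly above the radius avoids the polynomial factors that Jordan blocks may
  cause.\<close>

lemma nb_walks_growth:
  fixes Y :: "'v pair_pre_digraph" and R :: real
  assumes Y: "pair_graph Y" and ne: "parcs Y \<noteq> {}"
    and R: "spectral_radius (nb_matrix Y (\<lambda>_. 1)) < R" "0 < R"
  obtains c where "\<And>k. real (card (nb_walks (parcs Y) k)) \<le> c * R ^ k"
proof -
  interpret Y: pair_graph Y by (rule Y)
  define A where "A = parcs Y"
  define N where "N = card A"
  define e where "e = from_nat_into A"
  define B where "B = nb_matrix Y (\<lambda>_. 1)"
  define B' where "B' = complex_of_real (1 / R) \<cdot>\<^sub>m B"
  have finA: "finite A" by (simp add: A_def)
  have N: "0 < N" using ne finA by (simp add: N_def A_def card_gt_0_iff)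
  have bij: "bij_betw e {..<N} A"
    using bij_betw_from_nat_into_finite[OF finA] by (simp add: e_def N_def)
  have eA: "e p \<in> A" if "p < N" for p using bij_betwE[OF bij] that by simp
  have B: "B = Matrix.mat N N (\<lambda>(p, q). nb_entry (\<lambda>_. 1) (e p) (e q))"
    by (simp add: B_def nb_matrix_def A_def N_def e_def)
  have carrier: "B \<in> carrier_mat N N" "B' \<in> carrier_mat N N" by (simp_all add: B B'_def)
  have entry: "nb_entry (\<lambda>_. 1) a b = (if nb_step a b then 1 else 0)" for a b :: "'v \<times> 'v"
    by (auto simp: nb_entry_def nb_step_def split: prod.splits)
  have "spectral_radius B' < 1"
  proof -
    have "spectral_radius B' \<in> norm ` spectrum B'"
      by (rule spectral_radius_mem_max(1)[OF carrier(2) N])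
    then obtain z where z: "eigenvalue B' z" "spectral_radius B' = cmod z" by (auto simp: spectrum_def)
    obtain v where v: "v \<in> carrier_vec N" "v \<noteq> 0\<^sub>v N" "B' *\<^sub>v v = z \<cdot>\<^sub>v v"
      using z(1) carrier(2) by (auto simp: eigenvalue_def eigenvector_def)
    have "B *\<^sub>v v = complex_of_real R \<cdot>\<^sub>v (B' *\<^sub>v v)"
      using v(1) carrier R(2)
      by (intro eq_vecI) (simp_all add: B'_def scalar_prod_def sum_distrib_left)
    also have "\<dots> = (complex_of_real R * z) \<cdot>\<^sub>v v" by (simp add: v(3) smult_smult_assoc)
    finally have "eigenvalue B (complex_of_real R * z)"
      using v carrier(1) by (auto simp: eigenvalue_def eigenvector_def)
    then have "cmod (complex_of_real R * z) \<in> norm ` spectrum B" by (auto simp: spectrum_def)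
    then have "cmod (complex_of_real R * z) \<le> spectral_radius B"
      by (rule spectral_radius_mem_max(2)[OF carrier(1) N])
    then have "R * cmod z \<le> spectral_radius B" using R(2) by (simp add: norm_mult)
    then have "R * cmod z < R * 1" using R(1) unfolding B_def by linarith
    then have "cmod z < 1" by (simp only: mult_less_cancel_left_pos[OF R(2)])
    then show ?thesis by (simp only: z(2))
  qed
  then have "\<exists>c. \<forall>k. norm_bound (B' ^\<^sub>m k) c"
    by (rule spectral_radius_jnf_norm_bound_less_1_upper_triangular[OF carrier(2)])
  then obtain c0 where c0: "\<forall>k. norm_bound (B' ^\<^sub>m k) c0" by (rule exE)
  \<comment> \<open>Entry \<open>p\<close> counts the walks of \<open>j + 1\<close> arcs that begin
    with the arc \<open>e p\<close>, scaled by \<open>R ^ j\<close>; thus \<open>u 0\<close> is the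
    all-ones vector and \<open>B'\<close> maps \<open>u j\<close> to
    \<open>u (Suc j)\<close>.\<close>
  define u where "u j = Matrix.vec N (\<lambda>p. complex_of_real (real (card (nb_extensions A (Suc j) (e p))) / R ^ j))" for j
  have u: "u j \<in> carrier_vec N" for j by (simp add: u_def)
  have step: "B' *\<^sub>v u j = u (Suc j)" for j
  proof (rule eq_vecI)
    show "dim_vec (B' *\<^sub>v u j) = dim_vec (u (Suc j))" using carrier by (simp add: u_def)
    fix p assume "p < dim_vec (u (Suc j))"
    then have p: "p < N" by (simp add: u_def)
    have "vec_index (B' *\<^sub>v u j) p
        = (\<Sum>q\<in>{..<N}. complex_of_real (1 / R) * nb_entry (\<lambda>_. 1) (e p) (e q)
            * complex_of_real (real (card (nb_extensions A (Suc j) (e q))) / R ^ j))"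
      using p by (simp add: B'_def B scalar_prod_def u_def lessThan_atLeast0)
    also have "\<dots> = (\<Sum>b\<in>A. complex_of_real (1 / R) * nb_entry (\<lambda>_. 1) (e p) b
            * complex_of_real (real (card (nb_extensions A (Suc j) b)) / R ^ j))"
      by (rule sum.reindex_bij_betw[OF bij])
    also have "\<dots> = (\<Sum>b\<in>A. if nb_step (e p) b
            then complex_of_real (real (card (nb_extensions A (Suc j) b)) / R ^ Suc j) else 0)"
      by (intro sum.cong refl) (simp add: entry)
    also have "\<dots> = (\<Sum>b\<in>{b \<in> A. nb_step (e p) b}. complex_of_real (real (card (nb_extensions A (Suc j) b)) / R ^ Suc j))"
      by (rule sum.inter_filter[OF finA, symmetric])
    also have "\<dots> = complex_of_real (real (\<Sum>b\<in>{b \<in> A. nb_step (e p) b}. card (nb_extensions A (Suc j) b)) / R ^ Suc j)"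
      by (simp only: of_real_sum[symmetric] sum_divide_distrib[symmetric] of_nat_sum[symmetric])
    also have "\<dots> = vec_index (u (Suc j)) p"
      using p card_nb_extensions_Suc[OF finA eA[OF p], of j] by (simp add: u_def)
    finally show "vec_index (B' *\<^sub>v u j) p = vec_index (u (Suc j)) p" .
  qed
  have power: "B' ^\<^sub>m k *\<^sub>v u j = u (k + j)" for k j
  proof (induction k arbitrary: j)
    case 0
    then show ?case using u[of j] carrier(2) by simp
  next
    case (Suc k)
    have "B' ^\<^sub>m Suc k *\<^sub>v u j = B' ^\<^sub>m k *\<^sub>v (B' *\<^sub>v u j)"
      using assoc_mult_mat_vec[OF pow_carrier_mat[OF carrier(2)] carrier(2) u] by simp
    then show ?case using Suc step by simp
  qed
  have c0': "cmod ((B' ^\<^sub>m k) $$ (p, q)) \<le> c0" if "p < N" "q < N" for k p q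
  proof -
    have "norm_bound (B' ^\<^sub>m k) c0" using c0 by (rule spec)
    moreover have "dim_row (B' ^\<^sub>m k) = N" "dim_col (B' ^\<^sub>m k) = N"
      using pow_carrier_mat[OF carrier(2), of k] unfolding carrier_mat_def by blast+
    ultimately show ?thesis using that unfolding norm_bound_def by metis
  qed
  define K where "K = (\<Sum>q\<in>{..<N}. cmod (vec_index (u 0) q))"
  have ext: "real (card (nb_extensions A (Suc k) a)) \<le> c0 * K * R ^ k" if "a \<in> A" for k a
  proof -
    have "a \<in> e ` {..<N}" using bij that by (simp add: bij_betw_def)
    then obtain p where p: "a = e p" "p < N" by auto
    have dim: "B' ^\<^sub>m k \<in> carrier_mat N N" by (rule pow_carrier_mat[OF carrier(2)])
    have "real (card (nb_extensions A (Suc k) a)) / R ^ k = cmod (vec_index (u k) p)"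
      using p R(2) by (simp add: u_def norm_divide norm_power)
    also have "\<dots> = cmod (vec_index (B' ^\<^sub>m k *\<^sub>v u 0) p)" by (simp add: power)
    also have "\<dots> = cmod (\<Sum>q\<in>{..<N}. (B' ^\<^sub>m k) $$ (p, q) * vec_index (u 0) q)"
      using p(2) carrier_matD[OF carrier(2)] carrier_vecD[OF u[of 0]]
      by (simp add: scalar_prod_def lessThan_atLeast0)
    also have "\<dots> \<le> (\<Sum>q\<in>{..<N}. c0 * cmod (vec_index (u 0) q))"
    proof (rule order.trans[OF norm_sum sum_mono])
      fix q assume "q \<in> {..<N}"
      then show "cmod ((B' ^\<^sub>m k) $$ (p, q) * vec_index (u 0) q) \<le> c0 * cmod (vec_index (u 0) q)"
        unfolding norm_mult using c0'[OF p(2)] by (intro mult_right_mono) simp_all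
    qed
    also have "\<dots> = c0 * K" by (simp add: K_def sum_distrib_left)
    finally show ?thesis using R(2) by (simp add: pos_divide_le_eq)
  qed
  \<comment> \<open>A walk of \<open>k\<close> arcs makes only \<open>k - 1\<close> steps, hence the
    division by \<open>R\<close>; the maximum with 1 covers the empty walk.\<close>
  define c where "c = max 1 (real N * (c0 * K) / R)"
  have bound: "real (card (nb_walks A k)) \<le> c * R ^ k" for k
  proof (cases k)
    case 0
    have "nb_walks A 0 \<subseteq> {[]}" by (auto simp: nb_walks_def)
    then have "card (nb_walks A 0) \<le> card {[] :: ('v \<times> 'v) list}" by (intro card_mono) simp_all
    then show ?thesis using 0 by (simp add: c_def)
  next
    case (Suc j)
    have "real (card (nb_walks A (Suc j))) = (\<Sum>a\<in>A. real (card (nb_extensions A (Suc j) a)))"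
      by (simp add: card_nb_walks_Suc[OF finA])
    also have "\<dots> \<le> (\<Sum>a\<in>A. c0 * K * R ^ j)" using ext by (intro sum_mono) simp
    also have "\<dots> = (real N * (c0 * K) / R) * R ^ Suc j" using R(2) by (simp add: N_def)
    also have "\<dots> \<le> c * R ^ Suc j" using R(2) by (intro mult_right_mono) (simp_all add: c_def)
    finally show ?thesis using Suc by simp
  qed
  show thesis by (rule that[of c]) (use bound in \<open>simp only: A_def\<close>)
qed

section \<open>Walks in a lift and their projections to the base graph\<close>

definition proj_arc :: "('v \<times> nat) \<times> ('v \<times> nat) \<Rightarrow> 'v \<times> 'v" where
  "proj_arc a = (fst (fst a), fst (snd a))"

context
  fixes Y :: "'v pair_pre_digraph" and n :: nat and M :: "'v set \<Rightarrow> ('v \<times> nat) set set"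
  assumes Y: "pair_graph Y" and M: "\<And>e. e \<in> uedges Y \<Longrightarrow> M e \<in> fibre_matchings n e"
begin

interpretation Y: pair_graph Y by (rule Y)

lemma lift_graph_arcD:
  assumes "(x, y) \<in> parcs (lift_graph Y n M)"
  shows "{fst x, fst y} \<in> uedges Y \<and> {x, y} \<in> M {fst x, fst y} \<and> x \<noteq> y \<and> x \<in> {fst x} \<times> {1..n}"
proof -
  obtain e where e: "e \<in> uedges Y" "{x, y} \<in> M e" using assms by (auto simp: lift_graph_def)
  obtain u v where uv: "e = {u, v}" "u \<noteq> v" "(u, v) \<in> parcs Y" "u \<in> pverts Y" "v \<in> pverts Y"
    by (rule uedgesE[OF Y e(1)])
  have "M e \<in> fibre_matchings n {u, v}" using M[OF e(1)] by (simp only: uv)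
  then obtain i j where ij: "{x, y} = {(u, i), (v, j)}" "i \<in> {1..n}" "j \<in> {1..n}"
    by (rule fibre_matching_elem[OF _ e(2)])
  have cases: "(x = (u, i) \<and> y = (v, j)) \<or> (x = (v, j) \<and> y = (u, i))"
    using ij(1) unfolding doubleton_eq_iff by blast
  then have "{fst x, fst y} = e" using uv(1) by auto
  moreover have "x \<noteq> y \<and> x \<in> {fst x} \<times> {1..n}" using cases uv(2) ij(2,3) by auto
  ultimately show ?thesis using e by simp
qed

lemma proj_arc_parcs:
  assumes "a \<in> parcs (lift_graph Y n M)"
  shows "proj_arc a \<in> parcs Y"
proof -
  have "{fst (fst a), fst (snd a)} \<in> uedges Y"
    using lift_graph_arcD[of "fst a" "snd a"] assms by simp
  then obtain u v where uv: "{fst (fst a), fst (snd a)} = {u, v}" "(u, v) \<in> parcs Y"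
    unfolding uedges_def mem_Collect_eq by (elim exE conjE) (rule that)
  have "(v, u) \<in> parcs Y" using Y.arcs_symmetric uv(2) by simp
  then show ?thesis
    using uv unfolding proj_arc_def doubleton_eq_iff by auto
qed

lemma lift_graph_symmetric:
  "(x, y) \<in> parcs (lift_graph Y n M) \<Longrightarrow> (y, x) \<in> parcs (lift_graph Y n M)"
  by (simp add: lift_graph_def insert_commute)

text \<open>The covering property: both edges belong to the matching above one base edge, and a
  matching has only one edge at \<open>x\<close>.\<close>

lemma lift_graph_neighbour_unique:
  assumes "(x, y) \<in> parcs (lift_graph Y n M)" "(x, y') \<in> parcs (lift_graph Y n M)" "fst y = fst y'"
  shows "y = y'"
proof -
  define e where "e = {fst x, fst y}"
  have 1: "e \<in> uedges Y" "{x, y} \<in> M e" "x \<noteq> y" "x \<in> {fst x} \<times> {1..n}"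
    using lift_graph_arcD[OF assms(1)] by (simp_all add: e_def)
  have 2: "{x, y'} \<in> M e" "x \<noteq> y'"
    using lift_graph_arcD[OF assms(2)] assms(3) by (simp_all add: e_def)
  have "M e \<in> fibre_matchings n {fst x, fst y}" using M[OF 1(1)] by (simp add: e_def)
  then have "M e \<in> perfect_matchings_between ({fst x} \<times> {1..n}) ({fst y} \<times> {1..n})"
    by (simp only: fibre_matchings_eq_between)
  then have "\<exists>!f. f \<in> M e \<and> x \<in> f"
    unfolding perfect_matchings_between_def using 1(4) by blast
  then obtain h where h: "\<forall>f. f \<in> M e \<and> x \<in> f \<longrightarrow> f = h" by (elim ex1E) blast
  have "{x, y} = h" using h 1(2) by blast
  moreover have "{x, y'} = h" using h 2(1) by blast
  ultimately have "{x, y} = {x, y'}" by (simp only:)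
  then show ?thesis unfolding doubleton_eq_iff using 1(3) by metis
qed

text \<open>A backtracking projection would give the middle vertex two different neighbours in the
  same fibre.\<close>

lemma proj_arc_nb_step:
  assumes "nb_step a b" "a \<in> parcs (lift_graph Y n M)" "b \<in> parcs (lift_graph Y n M)"
  shows "nb_step (proj_arc a) (proj_arc b)"
proof -
  obtain x y z where ab: "a = (x, y)" "b = (y, z)" "x \<noteq> z"
    using assms(1) by (cases a; cases b) (simp add: nb_step_def)
  have "(y, x) \<in> parcs (lift_graph Y n M)" "(y, z) \<in> parcs (lift_graph Y n M)"
    using lift_graph_symmetric[of x y] assms(2,3) by (simp_all only: ab)
  then have "fst x \<noteq> fst z" using lift_graph_neighbour_unique[of y x z] ab(3) by blast
  then show ?thesis by (simp add: ab nb_step_def proj_arc_def)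
qed

text \<open>Uniqueness of path lifting, by induction along the walk.\<close>

lemma proj_walk_inj:
  assumes "p \<in> walks_from (parcs (lift_graph Y n M)) x k" "p' \<in> walks_from (parcs (lift_graph Y n M)) x k"
    and "map proj_arc p = map proj_arc p'"
  shows "p = p'"
  using assms
proof (induction p arbitrary: p' x k)
  case Nil
  then show ?case by simp
next
  case (Cons a r)
  then obtain a' r' where p': "p' = a' # r'" "proj_arc a = proj_arc a'" "map proj_arc r = map proj_arc r'"
    by (cases p') auto
  obtain y y' where a: "a = (x, y)" "a' = (x, y')"
    using Cons.prems(1,2) p'(1) by (cases a; cases a') (simp add: walks_from_def starts_at_def)
  have A: "(x, y) \<in> parcs (lift_graph Y n M)" "(x, y') \<in> parcs (lift_graph Y n M)"
    using Cons.prems(1,2) by (simp_all add: p'(1) a walks_from_def nb_walks_def)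
  have y: "y = y'"
    by (rule lift_graph_neighbour_unique[OF A]) (use p'(2) in \<open>simp add: a proj_arc_def\<close>)
  have tl: "s \<in> walks_from (parcs (lift_graph Y n M)) y (k - 1)"
    if s: "(x, y) # s \<in> walks_from (parcs (lift_graph Y n M)) x k" for s
    using s by (cases s) (auto simp: walks_from_def nb_walks_def starts_at_def nb_step_def)
  have "r = r'"
  proof (rule Cons.IH)
    show "r \<in> walks_from (parcs (lift_graph Y n M)) y (k - 1)"
      using Cons.prems(1) by (intro tl) (simp only: a)
    show "r' \<in> walks_from (parcs (lift_graph Y n M)) y (k - 1)"
      using Cons.prems(2) by (intro tl) (simp only: a p'(1) y)
  qed (rule p'(3))
  then show ?case using a y p'(1) by simp
qed

lemma map_proj_arc_nb_walks:
  assumes "p \<in> nb_walks (parcs (lift_graph Y n M)) k"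
  shows "map proj_arc p \<in> nb_walks (parcs Y) k"
proof -
  have p: "length p = k" "set p \<subseteq> parcs (lift_graph Y n M)" "successively nb_step p"
    using assms by (simp_all add: nb_walks_def)
  have "successively (\<lambda>a b. nb_step (proj_arc a) (proj_arc b)) p"
    using p(3) by (rule successively_mono) (use p(2) proj_arc_nb_step in blast)
  moreover have "proj_arc ` set p \<subseteq> parcs Y"
    by (rule image_subsetI) (use p(2) proj_arc_parcs in blast)
  ultimately show ?thesis using p(1) by (simp add: nb_walks_def successively_map)
qed

lemma card_walks_from_lift:
  "card (walks_from (parcs (lift_graph Y n M)) x k) \<le> card (nb_walks (parcs Y) k)"
proof (rule card_inj_on_le)
  show "inj_on (map proj_arc) (walks_from (parcs (lift_graph Y n M)) x k)"
    by (rule inj_onI) (rule proj_walk_inj)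
  show "map proj_arc ` walks_from (parcs (lift_graph Y n M)) x k \<subseteq> nb_walks (parcs Y) k"
    by (rule image_subsetI) (simp add: walks_from_def map_proj_arc_nb_walks)
  show "finite (nb_walks (parcs Y) k)" by (rule finite_nb_walks) simp
qed

lemma nb_walks_lift_empty:
  assumes "nb_walks (parcs Y) k = {}"
  shows "nb_walks (parcs (lift_graph Y n M)) k = {}"
  using map_proj_arc_nb_walks[of _ k] assms by blast

lemma fst_lift_graph_arcs:
  "fst ` parcs (lift_graph Y n M) \<subseteq> pverts Y \<times> {1..n}"
proof (rule image_subsetI)
  fix a assume a: "a \<in> parcs (lift_graph Y n M)"
  have "fst (fst a) \<in> pverts Y"
    using proj_arc_parcs[OF a] Y.in_arcsD1[of "fst (fst a)" "fst (snd a)"] by (simp add: proj_arc_def)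
  moreover have "fst a \<in> {fst (fst a)} \<times> {1..n}"
    using lift_graph_arcD[of "fst a" "snd a"] a by simp
  ultimately show "fst a \<in> pverts Y \<times> {1..n}" by (cases "fst a") simp
qed

lemma lift_graph_arcs_nonempty:
  assumes "parcs Y \<noteq> {}" "0 < n"
  shows "parcs (lift_graph Y n M) \<noteq> {}"
proof -
  obtain u v where uv: "(u, v) \<in> parcs Y" using assms(1) by auto
  have "u \<noteq> v" using Y.no_loops'[OF uv] .
  have e: "{u, v} \<in> uedges Y" unfolding uedges_def using uv by (intro CollectI exI conjI) simp_all
  obtain \<pi> where \<pi>: "M {u, v} = matching_of u v n \<pi>" "\<pi> \<in> {\<pi>. \<pi> permutes {1..n}}"
    using M[OF e] unfolding fibre_matchings_eq[OF \<open>u \<noteq> v\<close>] by (rule imageE)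
  have "{(u, 1), (v, \<pi> 1)} \<in> M {u, v}"
    unfolding \<pi>(1) matching_of_def by (rule image_eqI[of _ _ 1]) (use assms(2) in simp_all)
  then have "{(u, 1), (v, \<pi> 1)} \<in> (\<Union>e\<in>uedges Y. M e)" by (rule UN_I[OF e])
  then have "((u, 1), (v, \<pi> 1)) \<in> parcs (lift_graph Y n M)" by (simp add: lift_graph_def)
  then show ?thesis by blast
qed

end

section \<open>Asymptotics\<close>

text \<open>Conditions on the first component: a bad \<open>D\<close>-outcome is charged with
  probability one, any other with \<beta>.\<close>

lemma prob_bind_Pair_le:
  assumes good: "\<And>L. L \<in> set_pmf D \<Longrightarrow> L \<notin> Bad \<Longrightarrow> measure_pmf.prob (N L) {s. P L s} \<le> \<beta>" and "0 \<le> \<beta>"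
  shows "measure_pmf.prob (bind_pmf D (\<lambda>L. map_pmf (\<lambda>s. (L, s)) (N L))) {(L, s). P L s}
    \<le> measure_pmf.prob D Bad + \<beta>"
proof -
  let ?Q = "bind_pmf D (\<lambda>L. map_pmf (\<lambda>s. (L, s)) (N L))"
  have "emeasure (measure_pmf ?Q) {(L, s). P L s}
      = (\<integral>\<^sup>+L. emeasure (measure_pmf (N L)) {s. P L s} \<partial>measure_pmf D)"
    by (simp add: vimage_def)
  also have "\<dots> \<le> (\<integral>\<^sup>+L. indicator Bad L + ennreal \<beta> \<partial>measure_pmf D)"
  proof (rule nn_integral_mono_AE, rule AE_pmfI)
    fix L assume L: "L \<in> set_pmf D"
    have e: "emeasure (measure_pmf (N L)) {s. P L s} = ennreal (measure_pmf.prob (N L) {s. P L s})"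
      by (rule measure_pmf.emeasure_eq_measure)
    show "emeasure (measure_pmf (N L)) {s. P L s} \<le> indicator Bad L + ennreal \<beta>"
    proof (cases "L \<in> Bad")
      case True
      have "emeasure (measure_pmf (N L)) {s. P L s} \<le> 1" by (rule measure_pmf.emeasure_le_1)
      also have "\<dots> \<le> indicator Bad L + ennreal \<beta>" using True by simp
      finally show ?thesis .
    next
      case False
      have "ennreal (measure_pmf.prob (N L) {s. P L s}) \<le> ennreal \<beta>"
        by (rule ennreal_leI[OF good[OF L False]])
      then show ?thesis unfolding e using False by simp
    qed
  qed
  also have "\<dots> = emeasure (measure_pmf D) Bad + ennreal \<beta>"
    by (subst nn_integral_add) simp_all
  also have "\<dots> = ennreal (measure_pmf.prob D Bad + \<beta>)"
    using assms(2) by (simp add: measure_pmf.emeasure_eq_measure)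
  finally have "ennreal (measure_pmf.prob ?Q {(L, s). P L s}) \<le> ennreal (measure_pmf.prob D Bad + \<beta>)"
    by (simp only: measure_pmf.emeasure_eq_measure)
  moreover have "0 \<le> measure_pmf.prob D Bad + \<beta>" using assms(2) by simp
  ultimately show ?thesis by (simp only: ennreal_le_iff)
qed

lemma random_liftE:
  assumes "pair_graph Y" "L \<in> set_pmf (random_lift Y n)"
  obtains M where "L = lift_graph Y n M" "\<forall>e\<in>uedges Y. M e \<in> fibre_matchings n e"
proof -
  have "L \<in> lift_graph Y n ` set_pmf (lift_pmf Y n)"
    using assms(2) by (simp add: random_lift_def lift_pmf_def)
  then obtain M where "L = lift_graph Y n M" "M \<in> set_pmf (lift_pmf Y n)" by (rule imageE)
  then show thesis using that set_lift_pmf[OF assms(1)] by blast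
qed

text \<open>The three summands belong to lifts with two cycles close together, to lifts with a
  subgraph of large excess, and to the signing of all other lifts. Allowing excess \<open>m\<close>
  turns the number \<open>2 * m + d + 1\<close> of phases into \<open>3 * m + 1\<close>;
  \<open>V * n\<close> bounds the number of start vertices.\<close>

lemma prob_spectral_radius_lift_le:
  fixes R c \<Lambda> :: real
  assumes Y: "pair_graph Y" and ne: "parcs Y \<noteq> {}"
    and R: "1 \<le> R" and c: "1 \<le> c" and growth: "\<And>b. real (card (nb_walks (parcs Y) b)) \<le> c * R ^ b"
    and "0 < \<Lambda>" "0 < m" and n: "2 * (3 * Suc k) \<le> n" "2 * (m * Suc k) \<le> n"
  defines "V \<equiv> real (card (pverts Y))" and "q \<equiv> Suc k" and "J0 \<equiv> 3 * m + 1"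
  shows "measure_pmf.prob (random_signed_lift Y n) {(L, s). \<Lambda> \<le> spectral_radius (nb_matrix L s)}
    \<le> real (3 * q + 1) ^ 2 * (2 * V * real (3 * q) ^ 2) ^ (3 * q) * (2 / real n)
      + real (m * q + 1) ^ 2 * (2 * V * real (m * q) ^ 2) ^ (m * q) * (2 / real n) ^ (m + 1)
      + V * real n * (real (J0 + 1) * (real (m * q + 1) *
          ((real ((q + 1) ^ 2 * (2 * q * J0 + 1) * (q * q + 1)) * c) ^ J0 * R ^ (m * q)))) / \<Lambda> ^ (2 * k * m)"
proof -
  interpret Y: pair_graph Y by (rule Y)
  define W where "W = real (J0 + 1) * (real (m * q + 1) *
          ((real ((q + 1) ^ 2 * (2 * q * J0 + 1) * (q * q + 1)) * c) ^ J0 * R ^ (m * q)))"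
  define \<beta> where "\<beta> = V * real n * W / \<Lambda> ^ (2 * k * m)"
  have W0: "0 \<le> W" using R c by (simp add: W_def)
  have \<beta>0: "0 \<le> \<beta>" using W0 assms(6) by (simp add: \<beta>_def V_def)
  have "pverts Y \<noteq> {}"
  proof -
    obtain u v where "(u, v) \<in> parcs Y" using ne by auto
    then have "u \<in> pverts Y" by (rule Y.in_arcsD1)
    then show ?thesis by blast
  qed
  then have V: "0 < card (pverts Y)" using Y.pair_finite_verts by (simp add: card_gt_0_iff)
  define Bad1 where "Bad1 = {L :: ('a \<times> nat) pair_pre_digraph. \<not> excess_le (parcs L) (3 * q) 0}"
  define Bad2 where "Bad2 = {L :: ('a \<times> nat) pair_pre_digraph. \<not> excess_le (parcs L) (m * q) m}"
  have good: "measure_pmf.prob (random_signing L) {s. \<Lambda> \<le> spectral_radius (nb_matrix L s)} \<le> \<beta>"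
    if L: "L \<in> set_pmf (random_lift Y n)" and nb: "L \<notin> Bad1 \<union> Bad2" for L
  proof -
    obtain M where M: "L = lift_graph Y n M" "\<forall>e\<in>uedges Y. M e \<in> fibre_matchings n e"
      by (rule random_liftE[OF Y L])
    note M' = M(2)[rule_format]
    have pg: "pair_graph L" unfolding M(1) by (rule pair_graph_lift_graph[OF Y M'])
    interpret L: pair_graph L by (rule pg)
    have neL: "parcs L \<noteq> {}"
      unfolding M(1) by (rule lift_graph_arcs_nonempty[OF Y M' ne]) (use n in simp_all)
    have gr: "real (card (walks_from (parcs L) y b)) \<le> c * R ^ b" for y b
    proof -
      have "card (walks_from (parcs L) y b) \<le> card (nb_walks (parcs Y) b)"
        unfolding M(1) by (rule card_walks_from_lift[OF Y M'])
      then have "real (card (walks_from (parcs L) y b)) \<le> real (card (nb_walks (parcs Y) b))" by simp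
      then show ?thesis using growth[of b] by linarith
    qed
    have ex: "excess_le (parcs L) (3 * q) 0" "excess_le (parcs L) (m * q) m"
      using nb by (simp_all add: Bad1_def Bad2_def)
    have J0: "2 * m + m + 1 = J0" by (simp add: J0_def)
    have count: "real (\<Sum>a\<in>parcs L. card {w \<in> hikes (parcs L) q (2 * m) a a. even_walk w})
        \<le> real (card (fst ` parcs L)) * W"
      unfolding W_def
      by (rule card_even_hikes[OF L.pair_finite_arcs parcs_loopless[OF pg] _ \<open>0 < m\<close> R c ex gr, unfolded J0])
        (simp_all add: q_def)
    have "card (fst ` parcs L) \<le> card (pverts Y \<times> {1..n})"
      unfolding M(1) using Y.pair_finite_verts by (intro card_mono fst_lift_graph_arcs[OF Y M']) simp
    then have "real (card (fst ` parcs L)) \<le> V * real n"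
      unfolding V_def by (simp flip: of_nat_mult)
    then have "real (card (fst ` parcs L)) * W \<le> V * real n * W" using W0 by (rule mult_right_mono)
    with count have le: "real (\<Sum>a\<in>parcs L. card {w \<in> hikes (parcs L) q (2 * m) a a. even_walk w}) \<le> V * real n * W"
      by (rule order.trans)
    have "measure_pmf.prob (random_signing L) {s. \<Lambda> \<le> spectral_radius (nb_matrix L s)}
        \<le> real (\<Sum>a\<in>parcs L. card {w \<in> hikes (parcs L) q (2 * m) a a. even_walk w}) / \<Lambda> ^ (2 * k * m)"
      unfolding q_def by (rule prob_spectral_radius_ge[OF pg neL \<open>0 < \<Lambda>\<close> \<open>0 < m\<close>])
    also have "\<dots> \<le> \<beta>" unfolding \<beta>_def using assms(6) by (intro divide_right_mono le) simp
    finally show ?thesis .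
  qed
  have "measure_pmf.prob (random_signed_lift Y n) {(L, s). \<Lambda> \<le> spectral_radius (nb_matrix L s)}
      \<le> measure_pmf.prob (random_lift Y n) (Bad1 \<union> Bad2) + \<beta>"
    unfolding random_signed_lift_def by (rule prob_bind_Pair_le[OF good \<beta>0])
  also have "measure_pmf.prob (random_lift Y n) (Bad1 \<union> Bad2)
      \<le> measure_pmf.prob (random_lift Y n) Bad1 + measure_pmf.prob (random_lift Y n) Bad2"
    by (rule measure_Un_le) simp_all
  also have "measure_pmf.prob (random_lift Y n) Bad1
      \<le> real (3 * q + 1) ^ 2 * (2 * V * real (3 * q) ^ 2) ^ (3 * q) * (2 / real n) ^ (0 + 1)"
    unfolding Bad1_def V_def by (rule prob_excess[OF Y _ _ V]) (use n in \<open>simp_all add: q_def\<close>)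
  also have "measure_pmf.prob (random_lift Y n) Bad2
      \<le> real (m * q + 1) ^ 2 * (2 * V * real (m * q) ^ 2) ^ (m * q) * (2 / real n) ^ (m + 1)"
    unfolding Bad2_def V_def by (rule prob_excess[OF Y _ _ V]) (use n \<open>0 < m\<close> in \<open>simp_all add: q_def\<close>)
  finally show ?thesis by (simp add: \<beta>_def W_def)
qed

section \<open>From the explicit bound to the limit, with \<open>x\<close> in the role of
  \<open>ln n\<close>\<close>

lemma power_le_powr:
  fixes b B a :: real
  assumes "0 \<le> b" "b \<le> B" "1 \<le> B" "real N \<le> a"
  shows "b ^ N \<le> B powr a"
proof -
  have "b ^ N \<le> B ^ N" using assms by (intro power_mono)
  also have "\<dots> = B powr real N" using assms(3) by (simp add: powr_realpow)
  also have "\<dots> \<le> B powr a" using assms by (intro powr_mono)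
  finally show ?thesis .
qed

text \<open>In the exponent, \<open>sqrt x * ln x\<close> competes with \<open>x\<close>.\<close>

lemma tendsto_small_excess:
  fixes V :: real
  assumes "0 < V"
  shows "((\<lambda>x. (3 * (sqrt x + 2) + 1) ^ 2 * (2 * V * (3 * (sqrt x + 2)) ^ 2) powr (3 * (sqrt x + 2))
    * (2 * exp (- x))) \<longlongrightarrow> 0) at_top"
  using assms by real_asymp

text \<open>In the exponent, \<open>x * sqrt x * ln x\<close> competes with
  \<open>x ^ 2\<close>.\<close>

lemma tendsto_large_excess:
  fixes V :: real
  assumes "0 < V"
  shows "((\<lambda>x. ((x + 1) * (sqrt x + 2) + 1) ^ 2 * (2 * V * ((x + 1) * (sqrt x + 2)) ^ 2) powr ((x + 1) * (sqrt x + 2))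
    * exp (x * (ln 2 - x))) \<longlongrightarrow> 0) at_top"
  using assms by real_asymp

text \<open>The number of starts and the surplus power of \<open>R\<close> are exponential in
  \<open>x\<close> and the phases contribute \<open>exp(O(x * ln x))\<close>; all are absorbed by
  \<open>exp (- \<delta> * (x * sqrt x))\<close>.\<close>

lemma tendsto_hikes:
  fixes V c l \<delta> :: real
  assumes "0 < V" "0 < c" "0 < \<delta>" "0 < l"
  shows "((\<lambda>x. V * exp x * ((3 * x + 5) * (((x + 1) * (sqrt x + 2) + 1) *
     (((sqrt x + 3) ^ 2 * (2 * (sqrt x + 2) * (3 * x + 4) + 1) * ((sqrt x + 2) ^ 2 + 1) * c) powr (3 * x + 4)
      * (exp (l * (x + 1)) * exp (- \<delta> * (x * sqrt x))))))) \<longlongrightarrow> 0) at_top"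
  using assms by real_asymp

text \<open>Most factors grow with \<open>m\<close> and \<open>k\<close> and are estimated by
  \<open>m \<le> x + 1\<close>, \<open>q \<le> sqrt x + 2\<close> and
  \<open>J0 \<le> 3 * x + 4\<close>. The lower bounds on \<open>m\<close> and \<open>k\<close> serve
  the two decaying factors: the power of \<open>2 / n\<close> and the quotient of the powers of
  \<open>R\<close> and \<Lambda>.\<close>

lemma lift_bound_le:
  fixes x V c R \<Lambda> :: real and n m k :: nat
  assumes x: "1 \<le> x" "real n = exp x" and m: "x \<le> real m" "real m \<le> x + 1"
    and k: "sqrt x \<le> real k" "real k \<le> sqrt x + 1"
    and V: "1 \<le> V" and c: "1 \<le> c" and R: "1 < R" and \<Lambda>: "R < \<Lambda>\<^sup>2" "0 < \<Lambda>"
  defines "q \<equiv> Suc k" and "J0 \<equiv> 3 * m + 1" and "\<delta> \<equiv> 2 * ln \<Lambda> - ln R"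
  shows "real (3 * q + 1) ^ 2 * (2 * V * real (3 * q) ^ 2) ^ (3 * q) * (2 / real n)
      + real (m * q + 1) ^ 2 * (2 * V * real (m * q) ^ 2) ^ (m * q) * (2 / real n) ^ (m + 1)
      + V * real n * (real (J0 + 1) * (real (m * q + 1) *
          ((real ((q + 1) ^ 2 * (2 * q * J0 + 1) * (q * q + 1)) * c) ^ J0 * R ^ (m * q)))) / \<Lambda> ^ (2 * k * m)
    \<le> (3 * (sqrt x + 2) + 1) ^ 2 * (2 * V * (3 * (sqrt x + 2)) ^ 2) powr (3 * (sqrt x + 2)) * (2 * exp (- x))
      + ((x + 1) * (sqrt x + 2) + 1) ^ 2 * (2 * V * ((x + 1) * (sqrt x + 2)) ^ 2) powr ((x + 1) * (sqrt x + 2))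
        * exp (x * (ln 2 - x))
      + V * exp x * ((3 * x + 5) * (((x + 1) * (sqrt x + 2) + 1) *
         (((sqrt x + 3) ^ 2 * (2 * (sqrt x + 2) * (3 * x + 4) + 1) * ((sqrt x + 2) ^ 2 + 1) * c) powr (3 * x + 4)
          * (exp (ln R * (x + 1)) * exp (- \<delta> * (x * sqrt x))))))"
proof -
  have sx: "1 \<le> sqrt x" using x(1) by simp
  have q: "real q \<le> sqrt x + 2" using k by (simp add: q_def)
  have mq: "real (m * q) \<le> (x + 1) * (sqrt x + 2)"
    unfolding of_nat_mult using m q x(1) by (intro mult_mono) simp_all
  have big: "1 \<le> 2 * V * a ^ 2" if "1 \<le> a" for a :: real
  proof -
    have "1 * 1 \<le> (2 * V) * a ^ 2" using V that by (intro mult_mono) simp_all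
    then show ?thesis by simp
  qed
  have mq1: "1 \<le> (x + 1) * (sqrt x + 2)"
    using mult_mono[of 1 "x + 1" 1 "sqrt x + 2"] x(1) sx by simp
  have part1: "real (3 * q + 1) ^ 2 * (2 * V * real (3 * q) ^ 2) ^ (3 * q) * (2 / real n)
      \<le> (3 * (sqrt x + 2) + 1) ^ 2 * (2 * V * (3 * (sqrt x + 2)) ^ 2) powr (3 * (sqrt x + 2)) * (2 * exp (- x))"
  proof (intro mult_mono)
    show "real (3 * q + 1) ^ 2 \<le> (3 * (sqrt x + 2) + 1) ^ 2" using q by (intro power_mono) simp_all
    show "(2 * V * real (3 * q) ^ 2) ^ (3 * q) \<le> (2 * V * (3 * (sqrt x + 2)) ^ 2) powr (3 * (sqrt x + 2))"
    proof (rule power_le_powr)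
      show "2 * V * real (3 * q) ^ 2 \<le> 2 * V * (3 * (sqrt x + 2)) ^ 2"
        using V q by (intro mult_left_mono power_mono) simp_all
      show "1 \<le> 2 * V * (3 * (sqrt x + 2)) ^ 2" using sx by (intro big) simp
    qed (use q V in simp_all)
    show "2 / real n \<le> 2 * exp (- x)" by (simp add: x(2) exp_minus divide_inverse)
  qed (use V in simp_all)
  have part2: "real (m * q + 1) ^ 2 * (2 * V * real (m * q) ^ 2) ^ (m * q) * (2 / real n) ^ (m + 1)
      \<le> ((x + 1) * (sqrt x + 2) + 1) ^ 2 * (2 * V * ((x + 1) * (sqrt x + 2)) ^ 2) powr ((x + 1) * (sqrt x + 2))
        * exp (x * (ln 2 - x))"
  proof (intro mult_mono)
    show "real (m * q + 1) ^ 2 \<le> ((x + 1) * (sqrt x + 2) + 1) ^ 2" using mq by (intro power_mono) simp_all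
    show "(2 * V * real (m * q) ^ 2) ^ (m * q)
        \<le> (2 * V * ((x + 1) * (sqrt x + 2)) ^ 2) powr ((x + 1) * (sqrt x + 2))"
    proof (rule power_le_powr)
      show "2 * V * real (m * q) ^ 2 \<le> 2 * V * ((x + 1) * (sqrt x + 2)) ^ 2"
        using V mq by (intro mult_left_mono power_mono) simp_all
      show "1 \<le> 2 * V * ((x + 1) * (sqrt x + 2)) ^ 2" by (rule big[OF mq1])
      show "real (m * q) \<le> (x + 1) * (sqrt x + 2)" by (rule mq)
    qed (use V in simp)
    have "2 / real n = exp (ln 2 - x)" by (simp add: x(2) exp_diff)
    then have "(2 / real n) ^ (m + 1) = exp (real (m + 1) * (ln 2 - x))"
      by (simp only: exp_of_nat_mult)
    also have "\<dots> \<le> exp (x * (ln 2 - x))"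
    proof -
      have "ln 2 \<le> (1 :: real)" using ln_le_minus_one[of "2 :: real"] by simp
      then have "ln 2 - x \<le> 0" using x(1) by simp
      moreover have "x \<le> real (m + 1)" using m(1) by simp
      ultimately show ?thesis by (simp only: exp_le_cancel_iff mult_right_mono_neg)
    qed
    finally show "(2 / real n) ^ (m + 1) \<le> exp (x * (ln 2 - x))" .
  qed (use V in simp_all)
  define K where "K = (sqrt x + 3) ^ 2 * (2 * (sqrt x + 2) * (3 * x + 4) + 1) * ((sqrt x + 2) ^ 2 + 1) * c"
  have J0: "real J0 \<le> 3 * x + 4" using m by (simp add: J0_def)
  have "real ((q + 1) ^ 2 * (2 * q * J0 + 1) * (q * q + 1))
      = real (q + 1) ^ 2 * (2 * real q * real J0 + 1) * (real q ^ 2 + 1)"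
    by (simp only: of_nat_mult of_nat_add of_nat_power of_nat_1 of_nat_numeral power2_eq_square)
  also have "\<dots> \<le> (sqrt x + 3) ^ 2 * (2 * (sqrt x + 2) * (3 * x + 4) + 1) * ((sqrt x + 2) ^ 2 + 1)"
  proof (intro mult_mono add_mono power_mono)
    show "real (q + 1) \<le> sqrt x + 3" using q by simp
  qed (use q J0 x(1) sx in simp_all)
  finally have Kle: "real ((q + 1) ^ 2 * (2 * q * J0 + 1) * (q * q + 1)) * c \<le> K"
    unfolding K_def using c by (intro mult_right_mono) simp_all
  have "0 < (q + 1) ^ 2 * (2 * q * J0 + 1) * (q * q + 1)" by simp
  then have "1 \<le> real ((q + 1) ^ 2 * (2 * q * J0 + 1) * (q * q + 1))" by linarith
  then have K1: "1 * 1 \<le> real ((q + 1) ^ 2 * (2 * q * J0 + 1) * (q * q + 1)) * c"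
    using c by (intro mult_mono) simp_all
  have exps: "R ^ (m * q) / \<Lambda> ^ (2 * k * m) \<le> exp (ln R * (x + 1)) * exp (- \<delta> * (x * sqrt x))"
  proof -
    have "R ^ (m * q) = exp (real (m * q) * ln R)" using R by (simp only: exp_of_nat_mult exp_ln)
    moreover have "\<Lambda> ^ (2 * k * m) = exp (real (2 * k * m) * ln \<Lambda>)"
      using \<Lambda>(2) by (simp only: exp_of_nat_mult exp_ln)
    ultimately have "R ^ (m * q) / \<Lambda> ^ (2 * k * m) = exp (real (m * q) * ln R - real (2 * k * m) * ln \<Lambda>)"
      by (simp only: exp_diff)
    \<comment> \<open>As \<open>q = k + 1\<close>, a factor \<open>R ^ m\<close> is left over once
      \<open>k * m\<close> powers of \<open>R\<close> are set against \<Lambda>; it is only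
      exponential in \<open>x\<close>.\<close>
    also have "real (m * q) * ln R - real (2 * k * m) * ln \<Lambda> = ln R * real m + - \<delta> * (real m * real k)"
      by (simp add: q_def \<delta>_def algebra_simps)
    also have "exp \<dots> = exp (ln R * real m) * exp (- \<delta> * (real m * real k))" by (rule exp_add)
    also have "\<dots> \<le> exp (ln R * (x + 1)) * exp (- \<delta> * (x * sqrt x))"
    proof (intro mult_mono)
      show "exp (ln R * real m) \<le> exp (ln R * (x + 1))" using R m by (simp add: mult_left_mono)
      have "ln R < ln (\<Lambda>\<^sup>2)" using R \<Lambda> by (simp only: ln_less_cancel_iff)
      then have "0 \<le> \<delta>" using \<Lambda>(2) by (simp add: \<delta>_def ln_realpow)
      moreover have "x * sqrt x \<le> real m * real k" using m(1) k(1) x(1) by (intro mult_mono) simp_all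
      ultimately have "\<delta> * (x * sqrt x) \<le> \<delta> * (real m * real k)" by (intro mult_left_mono)
      then show "exp (- \<delta> * (real m * real k)) \<le> exp (- \<delta> * (x * sqrt x))" by simp
    qed simp_all
    finally show ?thesis .
  qed
  have "V * real n * (real (J0 + 1) * (real (m * q + 1) *
          ((real ((q + 1) ^ 2 * (2 * q * J0 + 1) * (q * q + 1)) * c) ^ J0 * R ^ (m * q)))) / \<Lambda> ^ (2 * k * m)
      = V * exp x * (real (J0 + 1) * (real (m * q + 1) *
          ((real ((q + 1) ^ 2 * (2 * q * J0 + 1) * (q * q + 1)) * c) ^ J0 * (R ^ (m * q) / \<Lambda> ^ (2 * k * m)))))"
    by (simp add: x(2))
  also have "\<dots> \<le> V * exp x * ((3 * x + 5) * (((x + 1) * (sqrt x + 2) + 1) * (K powr (3 * x + 4)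
          * (exp (ln R * (x + 1)) * exp (- \<delta> * (x * sqrt x))))))"
  proof (intro mult_mono order.refl)
    show "real (J0 + 1) \<le> 3 * x + 5" using J0 by simp
    show "real (m * q + 1) \<le> (x + 1) * (sqrt x + 2) + 1" using mq by simp
    show "(real ((q + 1) ^ 2 * (2 * q * J0 + 1) * (q * q + 1)) * c) ^ J0 \<le> K powr (3 * x + 4)"
      by (rule power_le_powr) (use K1 Kle J0 in linarith)+
    show "R ^ (m * q) / \<Lambda> ^ (2 * k * m) \<le> exp (ln R * (x + 1)) * exp (- \<delta> * (x * sqrt x))" by (rule exps)
  qed (use V c R \<Lambda>(2) x(1) mq1 in simp_all)
  finally show ?thesis using part1 part2 unfolding K_def by (intro add_mono)
qed

lemma eventually_lift_size:
  "\<forall>\<^sub>F n in sequentially. 6 * (sqrt (ln (real n)) + 2) \<le> real n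
     \<and> 2 * ((ln (real n) + 1) * (sqrt (ln (real n)) + 2)) \<le> real n \<and> 1 \<le> ln (real n)"
  by (intro eventually_conj; real_asymp)

theorem theorem4p2:
  fixes Y :: "'v pair_pre_digraph" and \<epsilon> :: real
  assumes "pair_graph Y"
    and "Digraph_Component.connected (with_proj Y)"
    and "card (uedges Y) > card (pverts Y)"
    and "\<epsilon> > 0"
  shows "(\<lambda>n. measure_pmf.prob (random_signed_lift Y n)
            {(L, s). spectral_radius (nb_matrix L s)
                       \<ge> sqrt (spectral_radius (nb_matrix Y (\<lambda>_. 1))) + \<epsilon>})
         \<longlonglongrightarrow> 0"
proof -
  interpret Y: pair_graph Y by (rule assms(1))
  define \<rho> where "\<rho> = spectral_radius (nb_matrix Y (\<lambda>_. 1))"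
  define \<Lambda> where "\<Lambda> = sqrt \<rho> + \<epsilon>"
  let ?p = "\<lambda>n. measure_pmf.prob (random_signed_lift Y n) {(L, s). \<Lambda> \<le> spectral_radius (nb_matrix L s)}"
  have ne: "parcs Y \<noteq> {}"
  proof
    assume "parcs Y = {}"
    then have "uedges Y = {}" by (simp add: uedges_def)
    then show False using assms(3) by simp
  qed
  have "0 < card (parcs Y)" using ne by (simp add: card_gt_0_iff)
  moreover have "nb_matrix Y (\<lambda>_. 1) \<in> carrier_mat (card (parcs Y)) (card (parcs Y))"
    by (simp add: nb_matrix_def)
  ultimately have "\<rho> \<in> norm ` spectrum (nb_matrix Y (\<lambda>_. 1))"
    unfolding \<rho>_def by (intro spectral_radius_mem_max(1))
  then have \<rho>0: "0 \<le> \<rho>" by auto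
  have \<Lambda>0: "0 < \<Lambda>" using \<rho>0 assms(4) by (simp add: \<Lambda>_def add_nonneg_pos)
  have "?p \<longlonglongrightarrow> 0"
  proof (cases "\<rho> < 1")
    case True
    \<comment> \<open>Any value strictly between \<rho> and 1 would do. The number of walks is an
      integer at most \<open>c * R ^ k\<close>, hence zero for large \<open>k\<close>. Projection
      then excludes long walks in the lifts, whose matrices are nilpotent.\<close>
    define R where "R = (\<rho> + 1) / 2"
    have R: "\<rho> < R" "0 < R" "R < 1" using True \<rho>0 by (simp_all add: R_def)
    obtain c where c: "\<And>k. real (card (nb_walks (parcs Y) k)) \<le> c * R ^ k"
      using nb_walks_growth[OF assms(1) ne, folded \<rho>_def, OF R(1,2)] by blast
    have "(\<lambda>k. c * R ^ k) \<longlonglongrightarrow> c * 0"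
      using R by (intro tendsto_mult_left LIMSEQ_power_zero) simp
    then have "(\<lambda>k. c * R ^ Suc k) \<longlonglongrightarrow> 0" by (simp only: mult_zero_right filterlim_sequentially_Suc[of "\<lambda>k. c * R ^ k"])
    then have "\<forall>\<^sub>F k in sequentially. c * R ^ Suc k < 1" by (rule order_tendstoD(2)) simp
    then obtain k where "c * R ^ Suc k < 1" unfolding eventually_sequentially by blast
    then have "real (card (nb_walks (parcs Y) (Suc k))) < 1" using c[of "Suc k"] by linarith
    then have "card (nb_walks (parcs Y) (Suc k)) = 0" by simp
    then have empty: "nb_walks (parcs Y) (Suc k) = {}"
      using finite_nb_walks[OF Y.pair_finite_arcs, of "Suc k"] by simp
    have "?p n = 0" if "0 < n" for n
    proof -
      have "?p n \<le> measure_pmf.prob (random_lift Y n) {} + 0"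
        unfolding random_signed_lift_def
      proof (rule prob_bind_Pair_le)
        fix L assume "L \<in> set_pmf (random_lift Y n)"
        then obtain M where M: "L = lift_graph Y n M" "\<forall>e\<in>uedges Y. M e \<in> fibre_matchings n e"
          by (rule random_liftE[OF assms(1)])
        note M' = M(2)[rule_format]
        have pg: "pair_graph L" unfolding M(1) by (rule pair_graph_lift_graph[OF assms(1) M'])
        have "parcs L \<noteq> {}"
          unfolding M(1) by (rule lift_graph_arcs_nonempty[OF assms(1) M' ne \<open>0 < n\<close>])
        moreover have "nb_walks (parcs L) (Suc k) = {}"
          unfolding M(1) by (rule nb_walks_lift_empty[OF assms(1) M' empty])
        ultimately have "spectral_radius (nb_matrix L s) = 0" for s
          by (rule nb_matrix_nilpotent[OF pg])
        then have "{s. \<Lambda> \<le> spectral_radius (nb_matrix L s)} = {}" using \<Lambda>0 by auto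
        then show "measure_pmf.prob (random_signing L) {s. \<Lambda> \<le> spectral_radius (nb_matrix L s)} \<le> 0"
          by (simp only: measure_empty)
      qed simp
      then show ?thesis by (simp add: measure_le_0_iff)
    qed
    then show ?thesis by (intro tendsto_eventually eventually_sequentiallyI[of 1]) simp
  next
    case False
    \<comment> \<open>Above \<rho>, so that \<open>nb_walks_growth\<close> applies, and below the
      square of \<Lambda>, so that the hike term decays; it exceeds 1 because \<rho> is at least 1
      here.\<close>
    define R where "R = (\<rho> + \<Lambda>\<^sup>2) / 2"
    have "\<rho> < \<Lambda>\<^sup>2"
    proof -
      have "(sqrt \<rho>)\<^sup>2 < \<Lambda>\<^sup>2" using assms(4) \<rho>0 by (intro power_strict_mono) (simp_all add: \<Lambda>_def)
      then show ?thesis using \<rho>0 by simp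
    qed
    then have R: "\<rho> < R" "1 < R" "R < \<Lambda>\<^sup>2" using False by (simp_all add: R_def)
    obtain c0 where c0: "\<And>k. real (card (nb_walks (parcs Y) k)) \<le> c0 * R ^ k"
      using nb_walks_growth[OF assms(1) ne, folded \<rho>_def, OF R(1)] R(2) by force
    define c where "c = max 1 c0"
    have c: "1 \<le> c" by (simp add: c_def)
    have growth: "real (card (nb_walks (parcs Y) k)) \<le> c * R ^ k" for k
    proof -
      have "c0 * R ^ k \<le> c * R ^ k" using R(2) by (intro mult_right_mono) (simp_all add: c_def)
      then show ?thesis using c0[of k] by linarith
    qed
    define V where "V = real (card (pverts Y))"
    obtain u v where "(u, v) \<in> parcs Y" using ne by auto
    then have "u \<in> pverts Y" by (rule Y.in_arcsD1)
    then have "0 < card (pverts Y)" using Y.pair_finite_verts card_gt_0_iff by blast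
    then have V: "1 \<le> V" unfolding V_def by linarith
    \<comment> \<open>\<open>exp (- \<delta>)\<close> equals
      \<open>R / (\<Lambda> * \<Lambda>)\<close>, the gain per unit of \<open>k * m\<close>.\<close>
    define \<delta> where "\<delta> = 2 * ln \<Lambda> - ln R"
    have "ln R < ln (\<Lambda>\<^sup>2)" using R \<Lambda>0 by simp
    then have \<delta>: "0 < \<delta>" using \<Lambda>0 by (simp add: \<delta>_def ln_realpow)
    define F where "F x = (3 * (sqrt x + 2) + 1) ^ 2 * (2 * V * (3 * (sqrt x + 2)) ^ 2) powr (3 * (sqrt x + 2)) * (2 * exp (- x))
      + ((x + 1) * (sqrt x + 2) + 1) ^ 2 * (2 * V * ((x + 1) * (sqrt x + 2)) ^ 2) powr ((x + 1) * (sqrt x + 2))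
        * exp (x * (ln 2 - x))
      + V * exp x * ((3 * x + 5) * (((x + 1) * (sqrt x + 2) + 1) *
         (((sqrt x + 3) ^ 2 * (2 * (sqrt x + 2) * (3 * x + 4) + 1) * ((sqrt x + 2) ^ 2 + 1) * c) powr (3 * x + 4)
          * (exp (ln R * (x + 1)) * exp (- \<delta> * (x * sqrt x))))))" for x
    have "(F \<longlongrightarrow> 0 + 0 + 0) at_top"
      unfolding F_def
      by (intro tendsto_add tendsto_small_excess tendsto_large_excess tendsto_hikes) (use V c R \<delta> in simp_all)
    then have "((\<lambda>n. F (ln (real n))) \<longlongrightarrow> 0) sequentially"
      by (auto intro: filterlim_compose filterlim_compose[OF ln_at_top filterlim_real_sequentially])
    moreover have "\<forall>\<^sub>F n in sequentially. norm (?p n) \<le> F (ln (real n))"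
      using eventually_lift_size
    proof eventually_elim
      case (elim n)
      define x where "x = ln (real n)"
      \<comment> \<open>Rounding up supplies the lower bounds needed for decay and costs at most one
        in the upper bounds.\<close>
      define m where "m = nat \<lceil>x\<rceil>"
      define k where "k = nat \<lceil>sqrt x\<rceil>"
      have x: "1 \<le> x" using elim by (simp add: x_def)
      have "0 < n"
      proof (rule ccontr)
        assume "\<not> 0 < n"
        then show False using elim by simp
      qed
      then have nx: "real n = exp x" by (simp add: x_def)
      have m: "x \<le> real m" "real m \<le> x + 1" using x unfolding m_def by linarith+
      have sx: "0 \<le> sqrt x" using x by simp
      then have k: "sqrt x \<le> real k" "real k \<le> sqrt x + 1" unfolding k_def by linarith+
      have n1: "2 * (3 * Suc k) \<le> n"
      proof -
        have "real (2 * (3 * Suc k)) \<le> 6 * (sqrt x + 2)" using k by simp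
        also have "\<dots> \<le> real n" using elim by (simp add: x_def)
        finally show ?thesis by (simp only: of_nat_le_iff)
      qed
      have n2: "2 * (m * Suc k) \<le> n"
      proof -
        have le: "real m * real (Suc k) \<le> (x + 1) * (sqrt x + 2)" using m k x by (intro mult_mono) simp_all
        have "real (2 * (m * Suc k)) = 2 * (real m * real (Suc k))" by (simp only: of_nat_mult of_nat_numeral)
        also have "\<dots> \<le> 2 * ((x + 1) * (sqrt x + 2))" by (rule mult_left_mono[OF le]) simp
        also have "\<dots> \<le> real n" using elim by (simp add: x_def)
        finally show ?thesis by (simp only: of_nat_le_iff)
      qed
      have "0 < m" using m(1) x by simp
      have "?p n \<le> F x"
        unfolding F_def \<delta>_def
        by (rule order.trans[OF prob_spectral_radius_lift_le[OF assms(1) ne less_imp_le[OF R(2)] c growth \<Lambda>0 \<open>0 < m\<close> n1 n2, folded V_def]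
              lift_bound_le[OF x nx m k V c R(2,3) \<Lambda>0]])
      then show ?case by (simp add: x_def)
    qed
    ultimately show ?thesis by (rule Lim_null_comparison[rotated])
  qed
  then show ?thesis by (simp only: \<Lambda>_def \<rho>_def)
qed

end
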